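(* (1) The toric Fano threefold $\mathcal{B}_1=\mathbf{P}_{\mathbf{P}^2}(\mathcal{O}\oplus\mathcal{O}(2))$ is relatively $K$-stable, but it is relatively Ding unstable. (2) The toric Fano fourfolds $B_1=\mathbf{P}_{\mathbf{P}^3}(\mathcal{O}\oplus\mathcal{O}(3))$ and $B_2=\mathbf{P}_{\mathbf{P}^3}(\mathcal{O}\oplus\mathcal{O}(2))$ are relatively $K$-stable, but they are relatively Ding unstable. (Relative $K$-stability is with respect to the anticanonical polarization.)
   Context: A Fano polytope is an $n$-dimensional lattice polytope $P\subset\mathbf{R}^n$ (lattice $\mathbf{Z}^n$) that is Delzant, contains the origin in its interior, and is reflexive, i.e. its dual $P^\vee=\{y\in\mathbf{R}^n\mid \langle x,y\rangle\ge -1 \text{ for all } x\in P\}$ is again a lattice polytope. Isomorphism classes of Fano polytopes (under the action of $GL(n,\mathbf{Z})$) correspond bijectively to isomorphism classes of $n$-dimensional toric Fano manifolds $X_P$ with the anticanonical polarization; $P$ is the moment polytope of $(X_P,-K_{X_P})$. Let $\mathrm{vol}(P)=\int_P dx$ (Lebesgue measure). The potential function $\theta_P$ of the extremal K\"ahler vector field is the unique affine function on $\mathbf{R}^n$ with $\int_P\theta_P\,dx=0$ and $\int_P x_i(1-\theta_P(x))\,dx=0$ for $i=1,\dots,n$. A rational PL convex function on $P$ is a convex function $f\colon P\to\mathbf{R}$ of the form $f=\max\{\ell_1,\dots,\ell_m\}$ with each $\ell_k$ a rational affine function. Relative $K$-stability. Let $\sigma$ be the measure on $\partial P$ which on each facet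 is the $(n-1)$-dimensional Lebesgue measure normalized by the lattice (if the facet lies on $\{x\mid\langle x,u\rangle=-1\}$ with $u\in\mathbf{Z}^n$ the primitive inward normal, $\sigma$ is the Euclidean $(n-1)$-dimensional measure divided by $|u|$). For a convex function $f$ put $$\mathscr{L}_P(f)=\int_{\partial P}f\,d\sigma-\int_P(n+\theta_P(x))f(x)\,dx.$$ Equivalently, $\theta_P$ is the affine function determined by $\mathscr{L}_P(1)=0$ and $\mathscr{L}_P(x_i)=0$ for $i=1,\dots,n$. The polarized manifold $(X_P,-K_{X_P})$ is relatively $K$-stable if $\mathscr{L}_P(f)\ge0$ for every rational PL convex function $f$, with equality if and only if $f$ is affine linear. Relative Ding stability. For a rational PL convex function $f$ put $$D_v^{NA}(f)=-f(0)+\frac{1}{\mathrm{vol}(P)}\int_P f(x)(1-\theta_P(x))\,dx.$$ $X_P$ is relatively Ding semistable if $D_v^{NA}(f)\ge 0$ for every rational PL convex function $f$ on $P$, and relatively Ding unstable if it is not relatively Ding semistable. *)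

theory Defs
  imports "HOL-Analysis.Analysis"
begin

section \<open>Fano polytopes\<close>

definition int_lattice :: "(real ^ 'n::finite) set" where
  "int_lattice = {x. \<forall>i. x $ i \<in> \<int>}"

definition lattice_polytope :: "(real ^ 'n::finite) set \<Rightarrow> bool" where
  "lattice_polytope P \<longleftrightarrow> (\<exists>V. finite V \<and> V \<subseteq> int_lattice \<and> P = convex hull V)"

definition primitive_vector :: "real ^ 'n::finite \<Rightarrow> bool" where
  "primitive_vector u \<longleftrightarrow> u \<in> int_lattice \<and> u \<noteq> 0 \<and>
     (\<forall>(k::int) w. w \<in> int_lattice \<and> u = of_int k *\<^sub>R w \<longrightarrow> \<bar>k\<bar> = 1)"

definition lattice_basis :: "(real ^ 'n::finite) set \<Rightarrow> bool" where
  "lattice_basis B \<longleftrightarrow> B \<subseteq> int_lattice \<and> independent B \<and>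
     (\<forall>z\<in>int_lattice. \<exists>c :: real ^ 'n \<Rightarrow> int. z = (\<Sum>b\<in>B. of_int (c b) *\<^sub>R b))"

text \<open>The description is unique for a facet of a full-dimensional lattice polytope, the only
  case in which it is used.\<close>

definition inward_normal :: "(real ^ 'n::finite) set \<Rightarrow> (real ^ 'n) set \<Rightarrow> real ^ 'n" where
  "inward_normal P F = (THE u. primitive_vector u \<and>
     (\<exists>c. F = P \<inter> {x. x \<bullet> u = c} \<and> (\<forall>x\<in>P. x \<bullet> u \<ge> c)))"

text \<open>The Delzant condition in terms of the normal fan: at every vertex the primitive normals of
  the facets through it form a basis of the lattice (in particular the polytope is simple).\<close>

definition delzant :: "(real ^ 'n::finite) set \<Rightarrow> bool" where
  "delzant P \<longleftrightarrow> (\<forall>v. v extreme_point_of P \<longrightarrow>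
     lattice_basis (inward_normal P ` {F. F facet_of P \<and> v \<in> F}))"

definition dual_polytope :: "(real ^ 'n::finite) set \<Rightarrow> (real ^ 'n) set" where
  "dual_polytope P = {y. \<forall>x\<in>P. x \<bullet> y \<ge> -1}"

definition fano_polytope :: "(real ^ 'n::finite) set \<Rightarrow> bool" where
  "fano_polytope P \<longleftrightarrow> lattice_polytope P \<and> 0 \<in> interior P \<and> delzant P \<and>
     lattice_polytope (dual_polytope P)"


section \<open>The potential function of the extremal vector field\<close>

definition affine_fun :: "(real ^ 'n::finite \<Rightarrow> real) \<Rightarrow> bool" where
  "affine_fun g \<longleftrightarrow> (\<exists>a b. g = (\<lambda>x. a \<bullet> x + b))"

definition extremal_potential :: "(real ^ 'n::finite) set \<Rightarrow> real ^ 'n \<Rightarrow> real" where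
  "extremal_potential P = (THE \<theta>. affine_fun \<theta> \<and>
     (LINT x:P|lborel. \<theta> x) = 0 \<and> (\<forall>i. (LINT x:P|lborel. x $ i * (1 - \<theta> x)) = 0))"


section \<open>Rational PL convex functions\<close>

text \<open>Functions on \<open>P\<close> are represented by functions on the whole space whose values
  outside \<open>P\<close> are irrelevant. A pair \<open>(a, b)\<close> stands for the affine function
  \<open>x \<mapsto> a \<bullet> x + b\<close>. A maximum of affine functions is convex, so convexity
  is not listed separately.\<close>

definition rational_PL_convex_on :: "(real ^ 'n::finite) set \<Rightarrow> (real ^ 'n \<Rightarrow> real) \<Rightarrow> bool" where
  "rational_PL_convex_on P f \<longleftrightarrow>
     (\<exists>S. finite S \<and> S \<noteq> {} \<and> (\<forall>(a, b)\<in>S. (\<forall>i. a $ i \<in> \<rat>) \<and> b \<in> \<rat>) \<and>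
          (\<forall>x\<in>P. f x = Max ((\<lambda>(a, b). a \<bullet> x + b) ` S)))"

definition affine_linear_on :: "(real ^ 'n::finite) set \<Rightarrow> (real ^ 'n \<Rightarrow> real) \<Rightarrow> bool" where
  "affine_linear_on P f \<longleftrightarrow> (\<exists>g. affine_fun g \<and> (\<forall>x\<in>P. f x = g x))"


section \<open>Relative K-stability\<close>

text \<open>The Euclidean measure of codimension one on the hyperplane \<open>{x. x \<bullet> u = c}\<close>, as a
  Borel measure on the ambient space: a subset \<open>A\<close> of the hyperplane gets the volume of the
  orthogonal cylinder of height 1 over \<open>A\<close>. Lebesgue measure is the product of the
  Lebesgue measures of the hyperplane and of the normal line, so this is the Lebesgue measure of
  the hyperplane.\<close>

definition hyperplane_lborel :: "real ^ 'n::finite \<Rightarrow> real \<Rightarrow> (real ^ 'n) measure" where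
  "hyperplane_lborel u c =
     distr (restrict_space lborel {y. 0 \<le> (y \<bullet> u - c) / norm u \<and> (y \<bullet> u - c) / norm u \<le> 1}) borel
       (\<lambda>y. y - ((y \<bullet> u - c) / (norm u)\<^sup>2) *\<^sub>R u)"

text \<open>The integral over the boundary of a reflexive polytope, all of whose facets \<open>F\<close> lie
  on hyperplanes \<open>{x. x \<bullet> u = -1}\<close> with \<open>u = inward_normal P F\<close>. Distinct facets
  meet in null sets.\<close>

definition boundary_integral :: "(real ^ 'n::finite) set \<Rightarrow> (real ^ 'n \<Rightarrow> real) \<Rightarrow> real" where
  "boundary_integral P f = (\<Sum>F | F facet_of P.
     (LINT x:F|hyperplane_lborel (inward_normal P F) (-1). f x) / norm (inward_normal P F))"

definition K_functional :: "(real ^ 'n::finite) set \<Rightarrow> (real ^ 'n \<Rightarrow> real) \<Rightarrow> real" where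
  "K_functional P f = boundary_integral P f
     - (LINT x:P|lborel. (real CARD('n) + extremal_potential P x) * f x)"

definition relatively_K_stable :: "(real ^ 'n::finite) set \<Rightarrow> bool" where
  "relatively_K_stable P \<longleftrightarrow> (\<forall>f. rational_PL_convex_on P f \<longrightarrow>
     K_functional P f \<ge> 0 \<and> (K_functional P f = 0 \<longleftrightarrow> affine_linear_on P f))"


section \<open>Relative Ding stability\<close>

definition ding_functional :: "(real ^ 'n::finite) set \<Rightarrow> (real ^ 'n \<Rightarrow> real) \<Rightarrow> real" where
  "ding_functional P f = - f 0
     + 1 / measure lborel P * (LINT x:P|lborel. f x * (1 - extremal_potential P x))"

definition relatively_Ding_semistable :: "(real ^ 'n::finite) set \<Rightarrow> bool" where
  "relatively_Ding_semistable P \<longleftrightarrow> (\<forall>f. rational_PL_convex_on P f \<longrightarrow> ding_functional P f \<ge> 0)"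

definition relatively_Ding_unstable :: "(real ^ 'n::finite) set \<Rightarrow> bool" where
  "relatively_Ding_unstable P \<longleftrightarrow> \<not> relatively_Ding_semistable P"


section \<open>Projective line bundles over projective space\<close>

text \<open>Primitive ray generators of the fan of the total space of
  \<open>\<P>(\<O> \<oplus> \<O>(a))\<close> over projective space of dimension \<open>n - 1\<close>,
  where \<open>n = CARD('n)\<close> and the coordinate \<open>k\<close> is the fibre direction: the rays
  \<open>e\<^sub>i\<close> (\<open>i \<noteq> k\<close>) and \<open>- (\<Sum>i\<noteq>k. e\<^sub>i)\<close> of the base, the last one
  twisted by \<open>a e\<^sub>k\<close>, and the rays \<open>\<plusminus> e\<^sub>k\<close> of the fibre. Replacing \<open>a\<close> by
  \<open>- a\<close> (the other convention for projectivization) gives an isomorphic fan via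
  \<open>e\<^sub>k \<mapsto> - e\<^sub>k\<close>.\<close>

definition proj_bundle_rays :: "'n::finite \<Rightarrow> int \<Rightarrow> (real ^ 'n) set" where
  "proj_bundle_rays k a =
     {axis i 1 | i. i \<noteq> k} \<union>
     {of_int a *\<^sub>R axis k 1 - (\<Sum>i | i \<noteq> k. axis i 1)} \<union>
     {axis k 1, - axis k 1}"

text \<open>The moment polytope of the anticanonical polarization:
  \<open>{y. \<langle>u, y\<rangle> \<ge> -1}\<close> for all ray generators \<open>u\<close>.\<close>

definition proj_bundle_polytope :: "'n::finite \<Rightarrow> int \<Rightarrow> (real ^ 'n) set" where
  "proj_bundle_polytope k a = dual_polytope (proj_bundle_rays k a)"

text \<open>In the index type \<open>3\<close> the numeral 3 denotes the same element as 0, distinct from 1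
  and 2; similarly for the index type \<open>4\<close>.\<close>

text \<open>\<open>\<P>(\<O> \<oplus> \<O>(2))\<close> over the projective plane.\<close>
definition threefold_B1 :: "(real ^ 3) set" where
  "threefold_B1 = proj_bundle_polytope 3 2"

text \<open>\<open>\<P>(\<O> \<oplus> \<O>(3))\<close> and \<open>\<P>(\<O> \<oplus> \<O>(2))\<close> over
  projective 3-space.\<close>
definition fourfold_B1 :: "(real ^ 4) set" where
  "fourfold_B1 = proj_bundle_polytope 4 3"

definition fourfold_B2 :: "(real ^ 4) set" where
  "fourfold_B2 = proj_bundle_polytope 4 2"

end

theory Submission
  imports Defs
begin

text \<open>The polytope \<open>P\<close> is a frustum whose slice at height \<open>t\<close> is a simplex of size
  \<open>s(t) = n + a t\<close>, and by symmetry \<open>\<theta>\<close> depends on \<open>t\<close> only. For K-stability let \<open>f\<close> be convex. The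
  trapezoid rule along the lines parallel to an edge of the slice, summed over the edges, bounds the
  integral of \<open>f\<close> over the lateral facets below by \<open>\<integral>\<^sub>P n (n - 1) f / s\<close>. What remains splits
  over the lines through the apex of the frustum into integrals of a one-dimensional functional which
  annihilates affine functions and is given by point masses at \<open>t = \<plusminus>1\<close> and a density with a single
  sign change from \<open>+\<close> to \<open>-\<close>; comparison with a chord shows that it is nonnegative on
  convex functions. If equality holds, \<open>f\<close> is affine along both kinds of lines, and
  \<open>f - g\<close>, where \<open>g\<close> is the affine piece of \<open>f\<close> active at \<open>0\<close>, is nonnegative and its zero set spreads
  along these lines from \<open>0\<close> to all of \<open>P\<close>. Ding semistability fails since \<open>1 - \<theta>\<close> is negative near
  \<open>t = 1\<close>.\<close>

section \<open>Integration over slabs and hyperplanes\<close>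

text \<open>The surface measure is defined by orthogonal cylinders, while the argument needs lines
  in edge directions, which are oblique to the facets. So a facet integral is rewritten as a
  Lebesgue integral over a slab \<open>c \<le> x \<bullet> u \<le> c + 1\<close>, along any
  direction \<open>v\<close> with \<open>u \<bullet> v = 1\<close>; the factor \<open>norm u\<close>
  cancels against the lattice normalisation. Fubini and translation invariance then replace every
  change of variables except the scaling of a slice. The trapezoid rule is exact on affine
  functions, so nothing is lost on them. Its nonnegative remainder \<open>defect\<close>, and the
  remainder \<open>gap\<close> on the lines through the apex, are carried through the estimates
  because their vanishing is the equality case. That the one-dimensional functional kills 1 and t is
  integration by parts combined with the two moment equations of \<theta>. The single sign change
  comes from the density being a concave quadratic \<open>q\<close> times a positive power of s. The
  three bundles enter only through n, a and the numbers \<alpha>, \<beta> of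
  \<open>extremal_bundle\<close>.\<close>

lemma lborel_integral_translation:
  fixes f :: "'a::euclidean_space \<Rightarrow> real"
  assumes [measurable]: "f \<in> borel_measurable borel"
  shows "(\<integral>x. f (x + d) \<partial>lborel) = (\<integral>x. f x \<partial>lborel)"
proof -
  have "(\<integral>x. f x \<partial>lborel) = (\<integral>x. f x \<partial>(distr lborel borel ((+) d)))"
    by (simp add: lborel_distr_plus)
  also have "\<dots> = (\<integral>x. f (d + x) \<partial>lborel)"
    by (subst integral_distr) auto
  finally show ?thesis by (simp add: add.commute)
qed

text \<open>Indicators of slabs and of \<open>P\<close> spoil continuity, but this class suffices
  for integrability and Fubini, and membership reduces to measurability and two bounds.\<close>

definition bounded_supported :: "('a::euclidean_space \<Rightarrow> real) \<Rightarrow> bool" where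
  "bounded_supported g \<longleftrightarrow> g \<in> borel_measurable borel \<and> (\<exists>B. \<forall>x. \<bar>g x\<bar> \<le> B) \<and>
     (\<exists>R. \<forall>x. g x \<noteq> 0 \<longrightarrow> norm x \<le> R)"

lemma bounded_supported_measurable [measurable_dest]:
  "bounded_supported g \<Longrightarrow> g \<in> borel_measurable borel"
  by (simp add: bounded_supported_def)

lemma bounded_supported_integrable:
  assumes "bounded_supported g" shows "integrable lborel g"
proof -
  obtain B R where B: "\<And>x. \<bar>g x\<bar> \<le> B" and R: "\<And>x. g x \<noteq> 0 \<Longrightarrow> norm x \<le> R"
    and [measurable]: "g \<in> borel_measurable borel"
    using assms by (auto simp: bounded_supported_def)
  show ?thesis
    by (rule integrableI_bounded_set[where A = "cball 0 R" and B = B])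
      (use B R emeasure_bounded_finite[OF bounded_cball, of 0 R] in \<open>auto simp: infinity_ennreal_def\<close>)
qed

lemma bounded_supported_Fubini:
  fixes g :: "'a::euclidean_space \<times> 'b::euclidean_space \<Rightarrow> real"
  assumes "bounded_supported g"
  shows "(\<integral>x. (\<integral>y. g (x, y) \<partial>lborel) \<partial>lborel) = (\<integral>y. (\<integral>x. g (x, y) \<partial>lborel) \<partial>lborel)"
    and "integrable lborel (\<lambda>x. \<integral>y. g (x, y) \<partial>lborel)"
proof -
  have i: "integrable (lborel \<Otimes>\<^sub>M lborel) (case_prod (\<lambda>x y. g (x, y)))"
    using bounded_supported_integrable[OF assms] by (simp add: lborel_prod)
  show "(\<integral>x. (\<integral>y. g (x, y) \<partial>lborel) \<partial>lborel) = (\<integral>y. (\<integral>x. g (x, y) \<partial>lborel) \<partial>lborel)"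
    using lborel_pair.Fubini_integral[OF i] by simp
  show "integrable lborel (\<lambda>x. \<integral>y. g (x, y) \<partial>lborel)"
    using lborel_pair.integrable_fst'[OF i] by simp
qed

text \<open>Since \<open>(x + \<tau> *\<^sub>R v) \<bullet> u = x \<bullet> u + \<tau>\<close>,
  keeping x in the slab and the moved point in the support of g bounds \<tau>, and then x.\<close>

lemma line_slab_bounded_supported:
  fixes g :: "'a::euclidean_space \<Rightarrow> real"
  assumes g: "bounded_supported g" and uv: "u \<bullet> v = 1"
  shows "bounded_supported (\<lambda>(x, \<tau>::real). indicator {c..c+1} (x \<bullet> u) * g (x + \<tau> *\<^sub>R v))"
proof -
  obtain B R where B: "\<And>x. \<bar>g x\<bar> \<le> B" and R: "\<And>x. g x \<noteq> 0 \<Longrightarrow> norm x \<le> R"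
    and [measurable]: "g \<in> borel_measurable borel"
    using g by (auto simp: bounded_supported_def)
  have vu: "v \<bullet> u = 1" using uv by (simp add: inner_commute)
  define T where "T = R * norm u + \<bar>c\<bar> + 1"
  have "\<bar>\<tau>\<bar> \<le> T \<and> norm x \<le> R + T * norm v"
    if nz: "indicator {c..c+1} (x \<bullet> u) * g (x + \<tau> *\<^sub>R v) \<noteq> 0" for x and \<tau> :: real
  proof
    have c: "c \<le> x \<bullet> u" "x \<bullet> u \<le> c + 1" and r: "norm (x + \<tau> *\<^sub>R v) \<le> R"
      using nz R[of "x + \<tau> *\<^sub>R v"] by (auto simp: indicator_def split: if_splits)
    have "\<bar>(x + \<tau> *\<^sub>R v) \<bullet> u\<bar> \<le> R * norm u"
      using Cauchy_Schwarz_ineq2[of "x + \<tau> *\<^sub>R v" u] mult_right_mono[OF r norm_ge_zero[of u]] by linarith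
    moreover have "(x + \<tau> *\<^sub>R v) \<bullet> u = x \<bullet> u + \<tau>"
      using vu by (simp add: inner_add_left)
    ultimately show \<tau>: "\<bar>\<tau>\<bar> \<le> T" using c by (auto simp: T_def)
    have "norm x = norm ((x + \<tau> *\<^sub>R v) - \<tau> *\<^sub>R v)" by simp
    also have "\<dots> \<le> norm (x + \<tau> *\<^sub>R v) + norm (\<tau> *\<^sub>R v)" by (rule norm_triangle_ineq4)
    also have "\<dots> \<le> R + T * norm v" using r \<tau> by (auto intro!: add_mono mult_right_mono)
    finally show "norm x \<le> R + T * norm v" .
  qed
  moreover have "norm (x, \<tau>) \<le> norm x + \<bar>\<tau>\<bar>" for x :: 'a and \<tau> :: real
    using norm_Pair_le[of x \<tau>] by simp
  ultimately have "norm (x, \<tau>) \<le> R + T * norm v + T"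
    if "indicator {c..c+1} (x \<bullet> u) * g (x + \<tau> *\<^sub>R v) \<noteq> 0" for x and \<tau> :: real
    using that by (smt (verit))
  moreover have "\<bar>indicator {c..c+1} (x \<bullet> u) * g (x + \<tau> *\<^sub>R v)\<bar> \<le> B" for x and \<tau> :: real
    using B[of "x + \<tau> *\<^sub>R v"] by (auto simp: indicator_def abs_mult)
  moreover have "(\<lambda>(x, \<tau>::real). indicator {c..c+1} (x \<bullet> u) * g (x + \<tau> *\<^sub>R v)) \<in> borel_measurable borel"
    unfolding borel_prod[symmetric] by measurable
  ultimately show ?thesis
    unfolding bounded_supported_def by (auto simp del: mult_eq_0_iff)
qed

text \<open>Translating by \<open>\<tau> v\<close> first in the space and then on the line leaves the weight
  \<open>\<integral> 1\<^bsub>[c, c+1]\<^esub>(r - \<tau>) d\<tau> = 1\<close>; no determinant is involved.\<close>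

lemma integral_slab_lines:
  fixes g :: "'a::euclidean_space \<Rightarrow> real"
  assumes g: "bounded_supported g" and uv: "u \<bullet> v = 1"
  shows "(\<integral>x. g x \<partial>lborel) =
    (\<integral>x. indicator {c..c+1} (x \<bullet> u) * (\<integral>\<tau>. g (x + \<tau> *\<^sub>R v) \<partial>lborel) \<partial>lborel)"
  and "integrable lborel (\<lambda>x. indicator {c..c+1} (x \<bullet> u) * (\<integral>\<tau>. g (x + \<tau> *\<^sub>R v) \<partial>lborel))"
proof -
  note bs = line_slab_bounded_supported[OF assms, of c]
  note [measurable] = bounded_supported_measurable[OF g]
  have vu: "v \<bullet> u = 1" using uv by (simp add: inner_commute)
  show "integrable lborel (\<lambda>x. indicator {c..c+1} (x \<bullet> u) * (\<integral>\<tau>. g (x + \<tau> *\<^sub>R v) \<partial>lborel))"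
    using bounded_supported_Fubini(2)[OF bs] by simp
  obtain B R where B: "\<And>x. \<bar>g x\<bar> \<le> B" and R: "\<And>x. g x \<noteq> 0 \<Longrightarrow> norm x \<le> R"
    using g by (auto simp: bounded_supported_def)
  have bs2: "bounded_supported (\<lambda>(x, \<tau>::real). indicator {c..c+1} (x \<bullet> u - \<tau>) * g x)"
  proof -
    have "norm (x, \<tau>) \<le> R + (R * norm u + \<bar>c\<bar> + 1)"
      if nz: "indicator {c..c+1} (x \<bullet> u - \<tau>) * g x \<noteq> 0" for x and \<tau> :: real
    proof -
      have c: "c \<le> x \<bullet> u - \<tau>" "x \<bullet> u - \<tau> \<le> c + 1" and r: "norm x \<le> R"
        using nz R[of x] by (auto simp: indicator_def split: if_splits)
      have "\<bar>x \<bullet> u\<bar> \<le> R * norm u"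
        using Cauchy_Schwarz_ineq2[of x u] mult_right_mono[OF r norm_ge_zero[of u]] by linarith
      then have "\<bar>\<tau>\<bar> \<le> R * norm u + \<bar>c\<bar> + 1" using c by linarith
      moreover have "norm (x, \<tau>) \<le> norm x + \<bar>\<tau>\<bar>"
        using norm_Pair_le[of x \<tau>] by simp
      ultimately show ?thesis using r by linarith
    qed
    moreover have "\<bar>indicator {c..c+1} (x \<bullet> u - \<tau>) * g x\<bar> \<le> B" for x and \<tau> :: real
      using B[of x] by (auto simp: indicator_def abs_mult)
    moreover have "(\<lambda>(x, \<tau>::real). indicator {c..c+1} (x \<bullet> u - \<tau>) * g x) \<in> borel_measurable borel"
      unfolding borel_prod[symmetric] by measurable
    ultimately show ?thesis
      unfolding bounded_supported_def by (auto simp del: mult_eq_0_iff)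
  qed
  have "(\<integral>x. indicator {c..c+1} (x \<bullet> u) * (\<integral>\<tau>. g (x + \<tau> *\<^sub>R v) \<partial>lborel) \<partial>lborel) =
     (\<integral>\<tau>. (\<integral>x. indicator {c..c+1} (x \<bullet> u) * g (x + \<tau> *\<^sub>R v) \<partial>lborel) \<partial>lborel)"
    using bounded_supported_Fubini(1)[OF bs] by simp
  also have "\<dots> = (\<integral>\<tau>. (\<integral>x. indicator {c..c+1} (x \<bullet> u - \<tau>) * g x \<partial>lborel) \<partial>lborel)"
  proof (rule Bochner_Integration.integral_cong[OF refl])
    fix \<tau> :: real
    have "(\<integral>x. indicator {c..c+1} (x \<bullet> u) * g (x + \<tau> *\<^sub>R v) \<partial>lborel) =
          (\<integral>x. (\<lambda>x. indicator {c..c+1} (x \<bullet> u - \<tau>) * g x) (x + \<tau> *\<^sub>R v) \<partial>lborel)"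
      using vu by (intro Bochner_Integration.integral_cong refl) (simp add: inner_add_left)
    also have "\<dots> = (\<integral>x. indicator {c..c+1} (x \<bullet> u - \<tau>) * g x \<partial>lborel)"
      by (rule lborel_integral_translation) measurable
    finally show "(\<integral>x. indicator {c..c+1} (x \<bullet> u) * g (x + \<tau> *\<^sub>R v) \<partial>lborel) =
      (\<integral>x. indicator {c..c+1} (x \<bullet> u - \<tau>) * g x \<partial>lborel)" .
  qed
  also have "\<dots> = (\<integral>x. (\<integral>\<tau>. indicator {c..c+1} (x \<bullet> u - \<tau>) * g x \<partial>lborel) \<partial>lborel)"
    using bounded_supported_Fubini(1)[OF bs2] by simp
  also have "\<dots> = (\<integral>x. g x \<partial>lborel)"
  proof (intro Bochner_Integration.integral_cong refl)
    fix x :: 'a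
    have "indicator {c..c+1} (x \<bullet> u - \<tau>) = (indicator {x \<bullet> u - c - 1..x \<bullet> u - c} \<tau> :: real)" for \<tau>
      by (auto simp: indicator_def)
    then show "(\<integral>\<tau>. indicator {c..c+1} (x \<bullet> u - \<tau>) * g x \<partial>lborel) = g x"
      by simp
  qed
  finally show "(\<integral>x. g x \<partial>lborel) =
    (\<integral>x. indicator {c..c+1} (x \<bullet> u) * (\<integral>\<tau>. g (x + \<tau> *\<^sub>R v) \<partial>lborel) \<partial>lborel)" by simp
qed


section \<open>The hyperplane measure as a slab integral\<close>

lemma slab_projection_bounded_supported:
  fixes f :: "'a::euclidean_space \<Rightarrow> real"
  assumes "bounded_supported f"
  shows "bounded_supported (\<lambda>y. indicator {c..c+H} (y \<bullet> u) * f (y - (y \<bullet> u - c) *\<^sub>R v))"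
proof -
  obtain B R where B: "\<And>x. \<bar>f x\<bar> \<le> B" and R: "\<And>x. f x \<noteq> 0 \<Longrightarrow> norm x \<le> R"
    and [measurable]: "f \<in> borel_measurable borel"
    using assms by (auto simp: bounded_supported_def)
  have "norm y \<le> R + H * norm v"
    if nz: "indicator {c..c+H} (y \<bullet> u) * f (y - (y \<bullet> u - c) *\<^sub>R v) \<noteq> 0" for y
  proof -
    have c: "c \<le> y \<bullet> u" "y \<bullet> u \<le> c + H" and r: "norm (y - (y \<bullet> u - c) *\<^sub>R v) \<le> R"
      using nz R[of "y - (y \<bullet> u - c) *\<^sub>R v"] by (auto simp: indicator_def split: if_splits)
    have "norm y = norm ((y - (y \<bullet> u - c) *\<^sub>R v) + (y \<bullet> u - c) *\<^sub>R v)" by simp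
    also have "\<dots> \<le> norm (y - (y \<bullet> u - c) *\<^sub>R v) + norm ((y \<bullet> u - c) *\<^sub>R v)" by (rule norm_triangle_ineq)
    also have "\<dots> \<le> R + H * norm v" using r c by (auto intro!: add_mono mult_right_mono)
    finally show ?thesis .
  qed
  moreover have "\<bar>indicator {c..c+H} (y \<bullet> u) * f (y - (y \<bullet> u - c) *\<^sub>R v)\<bar> \<le> B" for y
    using B[of "y - (y \<bullet> u - c) *\<^sub>R v"] by (auto simp: indicator_def abs_mult)
  ultimately show ?thesis
    unfolding bounded_supported_def by (auto simp del: mult_eq_0_iff)
qed

text \<open>Both sides spread the surface integral of f over the hyperplane along a transversal, up
  to height H and up to height 1. At height \<rho> the two projections differ by \<rho> (v' - v),
  which is parallel to the hyperplane, so a translation removes the difference.\<close>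

lemma integral_slab_projection:
  fixes f :: "'a::euclidean_space \<Rightarrow> real"
  assumes f: "bounded_supported f" and uv: "u \<bullet> v = 1" and uv': "u \<bullet> v' = 1" and H: "H \<ge> 0"
  shows "(\<integral>y. indicator {c..c+H} (y \<bullet> u) * f (y - (y \<bullet> u - c) *\<^sub>R v) \<partial>lborel) =
    H * (\<integral>y. indicator {c..c+1} (y \<bullet> u) * f (y - (y \<bullet> u - c) *\<^sub>R v') \<partial>lborel)" (is "_ = H * ?J")
proof -
  obtain B R where B: "\<And>x. \<bar>f x\<bar> \<le> B" and R: "\<And>x. f x \<noteq> 0 \<Longrightarrow> norm x \<le> R"
    and [measurable]: "f \<in> borel_measurable borel"
    using f by (auto simp: bounded_supported_def)
  have vu: "v \<bullet> u = 1" "v' \<bullet> u = 1" using uv uv' by (auto simp: inner_commute)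
  let ?F = "\<lambda>y \<rho>. indicator {c..c+1} (y \<bullet> u) * (indicator {0..H} \<rho> *
    f (y - (y \<bullet> u - c) *\<^sub>R v' + \<rho> *\<^sub>R (v' - v)))"
  have "norm (y, \<rho>) \<le> R + norm v' + H * norm (v' - v) + H" if nz: "?F y \<rho> \<noteq> 0" for y and \<rho> :: real
  proof -
    let ?p = "y - (y \<bullet> u - c) *\<^sub>R v' + \<rho> *\<^sub>R (v' - v)"
    have c: "c \<le> y \<bullet> u" "y \<bullet> u \<le> c + 1" "0 \<le> \<rho>" "\<rho> \<le> H" and r: "norm ?p \<le> R"
      using nz R[of ?p] by (auto simp: indicator_def split: if_splits)
    have "norm y = norm (?p + (y \<bullet> u - c) *\<^sub>R v' - \<rho> *\<^sub>R (v' - v))" by simp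
    also have "\<dots> \<le> norm ?p + norm ((y \<bullet> u - c) *\<^sub>R v') + norm (\<rho> *\<^sub>R (v' - v))"
      using norm_triangle_ineq4 norm_triangle_ineq order_trans add_right_mono by meson
    also have "\<dots> \<le> R + 1 * norm v' + H * norm (v' - v)"
      using r c by (auto intro!: add_mono mult_right_mono mult_left_le_one_le)
    finally show ?thesis using norm_Pair_le[of y \<rho>] c by auto
  qed
  moreover have "\<bar>?F y \<rho>\<bar> \<le> B" for y \<rho>
    using B[of "y - (y \<bullet> u - c) *\<^sub>R v' + \<rho> *\<^sub>R (v' - v)"] by (auto simp: indicator_def abs_mult)
  moreover have "(\<lambda>(y, \<rho>). ?F y \<rho>) \<in> borel_measurable borel"
    unfolding borel_prod[symmetric] by measurable
  ultimately have bs: "bounded_supported (\<lambda>(y, \<rho>). ?F y \<rho>)"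
    unfolding bounded_supported_def by (auto simp del: mult_eq_0_iff)
  have "(\<integral>y. indicator {c..c+H} (y \<bullet> u) * f (y - (y \<bullet> u - c) *\<^sub>R v) \<partial>lborel) =
    (\<integral>y. indicator {c..c+1} (y \<bullet> u) * (\<integral>\<tau>. indicator {c..c+H} ((y + \<tau> *\<^sub>R v') \<bullet> u) *
       f (y + \<tau> *\<^sub>R v' - ((y + \<tau> *\<^sub>R v') \<bullet> u - c) *\<^sub>R v) \<partial>lborel) \<partial>lborel)"
    by (rule integral_slab_lines(1)[OF slab_projection_bounded_supported[OF f] uv'])
  also have "\<dots> = (\<integral>y. (\<integral>\<rho>. ?F y \<rho> \<partial>lborel) \<partial>lborel)"
  proof (intro Bochner_Integration.integral_cong refl)
    fix y
    have "(\<integral>\<rho>. indicator {0..H} \<rho> * f (y - (y \<bullet> u - c) *\<^sub>R v' + \<rho> *\<^sub>R (v' - v)) \<partial>lborel) =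
      (\<integral>\<tau>. indicator {0..H} (\<tau> + (y \<bullet> u - c)) *
         f (y - (y \<bullet> u - c) *\<^sub>R v' + (\<tau> + (y \<bullet> u - c)) *\<^sub>R (v' - v)) \<partial>lborel)"
      by (rule lborel_integral_translation[symmetric]) measurable
    also have "\<dots> = (\<integral>\<tau>. indicator {c..c+H} ((y + \<tau> *\<^sub>R v') \<bullet> u) *
       f (y + \<tau> *\<^sub>R v' - ((y + \<tau> *\<^sub>R v') \<bullet> u - c) *\<^sub>R v) \<partial>lborel)"
    proof (intro Bochner_Integration.integral_cong refl arg_cong2[where f = "(*)"] arg_cong[where f = f])
      fix \<tau> :: real
      show "indicat_real {0..H} (\<tau> + (y \<bullet> u - c)) = indicat_real {c..c+H} ((y + \<tau> *\<^sub>R v') \<bullet> u)"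
        using vu by (auto simp: indicator_def inner_add_left)
      show "y - (y \<bullet> u - c) *\<^sub>R v' + (\<tau> + (y \<bullet> u - c)) *\<^sub>R (v' - v) =
        y + \<tau> *\<^sub>R v' - ((y + \<tau> *\<^sub>R v') \<bullet> u - c) *\<^sub>R v"
        using vu by (simp add: inner_add_left algebra_simps)
    qed
    finally show "indicator {c..c+1} (y \<bullet> u) * (\<integral>\<tau>. indicator {c..c+H} ((y + \<tau> *\<^sub>R v') \<bullet> u) *
       f (y + \<tau> *\<^sub>R v' - ((y + \<tau> *\<^sub>R v') \<bullet> u - c) *\<^sub>R v) \<partial>lborel) = (\<integral>\<rho>. ?F y \<rho> \<partial>lborel)"
      by simp
  qed
  also have "\<dots> = (\<integral>\<rho>. (\<integral>y. ?F y \<rho> \<partial>lborel) \<partial>lborel)"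
    using bounded_supported_Fubini(1)[OF bs] by simp
  also have "\<dots> = (\<integral>\<rho>. indicator {0..H} \<rho> * ?J \<partial>lborel)"
  proof (intro Bochner_Integration.integral_cong refl)
    fix \<rho> :: real
    have "?J = (\<integral>y. indicator {c..c+1} ((y + \<rho> *\<^sub>R (v' - v)) \<bullet> u) *
       f (y + \<rho> *\<^sub>R (v' - v) - ((y + \<rho> *\<^sub>R (v' - v)) \<bullet> u - c) *\<^sub>R v') \<partial>lborel)"
      by (rule lborel_integral_translation[symmetric]) measurable
    also have "\<dots> = (\<integral>y. indicator {c..c+1} (y \<bullet> u) *
       f (y - (y \<bullet> u - c) *\<^sub>R v' + \<rho> *\<^sub>R (v' - v)) \<partial>lborel)"
      using vu by (simp add: inner_add_left inner_diff_left algebra_simps)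
    finally show "(\<integral>y. ?F y \<rho> \<partial>lborel) = indicator {0..H} \<rho> * ?J"
      by (simp add: mult.left_commute[of "indicator {c..c+1} _"])
  qed
  also have "\<dots> = H * ?J" using H by simp
  finally show ?thesis .
qed

text \<open>The cylinder of Euclidean height 1 that defines the measure is the slab
  \<open>c \<le> y \<bullet> u \<le> c + norm u\<close>, so \<open>integral_slab_projection\<close>
  with \<open>H = norm u\<close> yields exactly the factor divided out on the left. The transversal
  \<open>v\<close> can be chosen to suit the problem.\<close>

lemma hyperplane_lborel_integral:
  fixes u :: "real ^ 'n::finite"
  assumes f: "bounded_supported (\<lambda>x. indicator F x * f x)" and uv: "u \<bullet> v = 1"
  shows "(LINT x:F|hyperplane_lborel u c. f x) / norm u =
    (\<integral>y. indicator {c..c+1} (y \<bullet> u) * (indicator F (y - (y \<bullet> u - c) *\<^sub>R v) *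
       f (y - (y \<bullet> u - c) *\<^sub>R v)) \<partial>lborel)"
proof -
  let ?g = "\<lambda>x. indicator F x * f x"
  note [measurable] = bounded_supported_measurable[OF f]
  have u: "norm u > 0" using uv by auto
  define S where "S = {y. 0 \<le> (y \<bullet> u - c) / norm u \<and> (y \<bullet> u - c) / norm u \<le> 1}"
  have [measurable]: "S \<in> sets borel" unfolding S_def by measurable
  have S: "indicator S y = (indicator {c..c+norm u} (y \<bullet> u) :: real)" for y
    using u by (auto simp: S_def indicator_def field_simps)
  have uu: "u \<bullet> ((1 / (norm u)\<^sup>2) *\<^sub>R u) = 1"
    using u by (simp add: dot_square_norm)
  have "(LINT x:F|hyperplane_lborel u c. f x) =
    (\<integral>y. ?g (y - ((y \<bullet> u - c) / (norm u)\<^sup>2) *\<^sub>R u) \<partial>restrict_space lborel S)"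
    unfolding hyperplane_lborel_def set_lebesgue_integral_def S_def[symmetric]
    by (subst integral_distr) (auto intro!: measurable_restrict_space1)
  also have "\<dots> = (\<integral>y. indicator {c..c+norm u} (y \<bullet> u) *
      ?g (y - (y \<bullet> u - c) *\<^sub>R ((1 / (norm u)\<^sup>2) *\<^sub>R u)) \<partial>lborel)"
    by (subst integral_restrict_space) (auto simp: S)
  also have "\<dots> = norm u * (\<integral>y. indicator {c..c+1} (y \<bullet> u) * ?g (y - (y \<bullet> u - c) *\<^sub>R v) \<partial>lborel)"
    by (rule integral_slab_projection[OF f uu uv]) simp
  finally show ?thesis using u by simp
qed

text \<open>On every line in direction \<open>v\<close> both slabs cut out a parameter interval of
  length 1. With the normals of two facets as u and u', this carries an integral from one facet to
  the other.\<close>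

lemma integral_slab_line_invariant:
  fixes K :: "'a::euclidean_space \<Rightarrow> real"
  assumes K: "bounded_supported (\<lambda>y. indicator {c..c+1} (y \<bullet> u) * K y)"
    and inv: "\<And>y \<tau>. K (y + \<tau> *\<^sub>R v) = K y"
    and uv: "u \<bullet> v = 1" "u' \<bullet> v = -1"
  shows "(\<integral>y. indicator {c..c+1} (y \<bullet> u) * K y \<partial>lborel) =
    (\<integral>y. indicator {c'..c'+1} (y \<bullet> u') * K y \<partial>lborel)"
proof -
  have vu: "v \<bullet> u = 1" using uv by (simp add: inner_commute)
  have inv': "K (y - \<tau> *\<^sub>R v) = K y" for y \<tau>
    using inv[of y "-\<tau>"] by simp
  have "(\<integral>y. indicator {c..c+1} (y \<bullet> u) * K y \<partial>lborel) = (\<integral>y. indicator {c'..c'+1} (y \<bullet> u') *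
    (\<integral>\<tau>. indicator {c..c+1} ((y + \<tau> *\<^sub>R (- v)) \<bullet> u) * K (y + \<tau> *\<^sub>R (- v)) \<partial>lborel) \<partial>lborel)"
    using uv by (intro integral_slab_lines(1)[OF K]) simp
  also have "\<dots> = (\<integral>y. indicator {c'..c'+1} (y \<bullet> u') * K y \<partial>lborel)"
  proof (intro Bochner_Integration.integral_cong refl)
    fix y
    have "indicator {c..c+1} ((y + \<tau> *\<^sub>R (- v)) \<bullet> u) =
        (indicator {y \<bullet> u - c - 1..y \<bullet> u - c} \<tau> :: real)" for \<tau>
      using vu by (auto simp: indicator_def inner_diff_left)
    then show "indicator {c'..c'+1} (y \<bullet> u') *
      (\<integral>\<tau>. indicator {c..c+1} ((y + \<tau> *\<^sub>R (- v)) \<bullet> u) * K (y + \<tau> *\<^sub>R (- v)) \<partial>lborel) =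
      indicator {c'..c'+1} (y \<bullet> u') * K y"
      using inv' by simp
  qed
  finally show ?thesis .
qed

text \<open>Boundary points are included: in a convex set with nonempty interior every point is a
  limit of interior points, so \<open>h x > 0\<close> would give a nonempty open set on which h is
  positive.\<close>

lemma integral_nonneg_eq_0_imp:
  fixes h :: "'a::euclidean_space \<Rightarrow> real"
  assumes R: "compact R" "convex R" "interior R \<noteq> {}" and h: "continuous_on R h"
    and nn: "\<And>x. x \<in> R \<Longrightarrow> h x \<ge> 0" and 0: "(LINT x:R|lborel. h x) = 0" and x: "x \<in> R"
  shows "h x = 0"
proof (rule ccontr)
  assume "h x \<noteq> 0"
  with nn[OF x] have pos: "h x > 0" by simp
  have "AE y in lborel. indicator R y *\<^sub>R h y = 0"
    using 0 borel_integrable_compact[OF R(1) h] nn unfolding set_lebesgue_integral_def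
    by (subst (asm) integral_nonneg_eq_0_iff_AE) (auto simp: indicator_def)
  moreover obtain e where e: "e > 0" "\<And>y. y \<in> R \<Longrightarrow> dist y x < e \<Longrightarrow> dist (h y) (h x) < h x"
    using h x pos unfolding continuous_on_iff by metis
  define U where "U = ball x e \<inter> interior R"
  have U: "y \<in> R \<and> h y > 0" if "y \<in> U" for y
    using that e(2)[of y] interior_subset by (fastforce simp: U_def dist_commute dist_real_def)
  ultimately have "AE y in lborel. y \<notin> U" by (fastforce simp: indicator_def elim!: eventually_mono)
  moreover have "open U" by (auto simp: U_def)
  ultimately have "U \<in> null_sets lborel"
    by (subst AE_iff_null_sets) auto
  then have "negligible U"
    by (simp add: negligible_iff_null_sets null_sets_completionI)
  moreover have "x \<in> closure (interior R)"
    using x convex_closure_interior[OF R(2,3)] closure_subset by blast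
  then obtain y where "y \<in> interior R" "dist y x < e"
    using e(1) unfolding closure_approachable by blast
  then have "U \<noteq> {}" by (auto simp: U_def dist_commute)
  ultimately show False using open_not_negligible \<open>open U\<close> by blast
qed

section \<open>The frustum\<close>

lemma integral_trapezoid:
  fixes \<phi> :: "real \<Rightarrow> real"
  assumes c: "convex_on UNIV \<phi>" and ab: "a \<le> b"
  shows "integral {a..b} \<phi> \<le> (b - a) / 2 * (\<phi> a + \<phi> b)"
proof (cases "a = b")
  case False
  with ab have ab: "a < b" by simp
  define m where "m = (\<phi> b - \<phi> a) / (b - a)"
  have cont: "continuous_on {a..b} \<phi>"
    by (rule continuous_on_subset[OF convex_on_continuous[OF open_UNIV c] subset_UNIV])
  have le: "\<phi> x \<le> m * (x - a) + \<phi> a" if "x \<in> {a..b}" for x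
    using convex_onD_Icc'[OF convex_on_subset[OF c subset_UNIV convex_real_interval(5)] that] by (simp add: m_def)
  have "((\<lambda>x. m * (x - a) + \<phi> a) has_integral
      (m * (b - a)\<^sup>2 / 2 + \<phi> a * (b - a)) - (m * (a - a)\<^sup>2 / 2 + \<phi> a * (a - a))) {a..b}"
    using ab by (intro fundamental_theorem_of_calculus)
      (auto intro!: derivative_eq_intros simp: has_real_derivative_iff_has_vector_derivative[symmetric])
  then have "integral {a..b} \<phi> \<le> m * (b - a)\<^sup>2 / 2 + \<phi> a * (b - a)"
    using le by (intro has_integral_le[OF integrable_integral[OF integrable_continuous_real[OF cont]]]) auto
  also have "\<dots> = (b - a) / 2 * (\<phi> a + \<phi> b)"
    using ab by (simp add: m_def power2_eq_square field_simps)
  finally show ?thesis .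
qed simp

text \<open>The term \<open>\<phi> a + \<phi> b - 2 \<phi> ((a + b) / 2)\<close> is kept to detect when \<open>\<phi>\<close> is not
  affine.\<close>

lemma integral_trapezoid_midpoint:
  fixes \<phi> :: "real \<Rightarrow> real"
  assumes c: "convex_on UNIV \<phi>" and ab: "a \<le> b"
  shows "2 * integral {a..b} \<phi> \<le>
    (b - a) * (\<phi> a + \<phi> b) - (b - a) / 2 * (\<phi> a + \<phi> b - 2 * \<phi> ((a + b) / 2))"
proof -
  have "continuous_on {a..b} \<phi>"
    by (rule continuous_on_subset[OF convex_on_continuous[OF open_UNIV c] subset_UNIV])
  then have "integral {a..(a+b)/2} \<phi> + integral {(a+b)/2..b} \<phi> = integral {a..b} \<phi>"
    using ab by (intro Henstock_Kurzweil_Integration.integral_combine integrable_continuous_real) auto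
  moreover have "integral {a..(a+b)/2} \<phi> \<le> ((a+b)/2 - a) / 2 * (\<phi> a + \<phi> ((a+b)/2))"
    "integral {(a+b)/2..b} \<phi> \<le> (b - (a+b)/2) / 2 * (\<phi> ((a+b)/2) + \<phi> b)"
    using ab by (intro integral_trapezoid[OF c]; simp)+
  ultimately show ?thesis by (simp add: field_simps)
qed

lemma bounded_supported_indicator:
  fixes h :: "'a::euclidean_space \<Rightarrow> real"
  assumes "compact S" "continuous_on S h"
  shows "bounded_supported (\<lambda>x. indicator S x * h x)"
proof -
  have "bounded (h ` S)" "bounded S"
    using assms by (auto intro: compact_imp_bounded compact_continuous_image)
  then obtain B R where "\<And>x. x \<in> S \<Longrightarrow> \<bar>h x\<bar> \<le> B" "\<And>x. x \<in> S \<Longrightarrow> norm x \<le> R" "B > 0"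
    unfolding bounded_pos by auto
  then have "\<forall>x. \<bar>indicator S x * h x\<bar> \<le> B" "\<forall>x. indicator S x * h x \<noteq> 0 \<longrightarrow> norm x \<le> R"
    by (auto simp: indicator_def)
  moreover have "(\<lambda>x. indicator S x *\<^sub>R h x) \<in> borel_measurable borel"
    using assms by (intro borel_measurable_continuous_on_indicator) (auto simp: borel_compact)
  ultimately show ?thesis
    unfolding bounded_supported_def by auto
qed

text \<open>The bound a < n, the Fano condition for this bundle, puts the apex (at height -n/a)
  below the bottom facet, so that s is positive on \<open>P\<close>.\<close>

locale proj_bundle =
  fixes k :: "'n::finite" and a :: int
  assumes a: "0 < a" "a < int CARD('n)"
begin

text \<open>The base coordinates are completed to barycentric ones: the index \<open>k\<close>, otherwise the
  fibre direction, stands for the ray \<open>a e\<^sub>k - \<Sum>i\<noteq>k. e\<^sub>i\<close> and its facet function \<open>y k\<close>, and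
  for the vertex \<open>0\<close> of the standard simplex.\<close>

definition U :: "'n \<Rightarrow> real ^ 'n" where
  "U j = (if j = k then of_int a *\<^sub>R axis k 1 - (\<Sum>i | i \<noteq> k. axis i 1) else axis j 1)"

definition W :: "'n \<Rightarrow> real ^ 'n" where
  "W j = (if j = k then 0 else axis j 1)"

definition y :: "'n \<Rightarrow> real ^ 'n \<Rightarrow> real" where
  "y j x = x \<bullet> U j + 1"

definition s :: "real \<Rightarrow> real" where
  "s t = real CARD('n) + real_of_int a * t"

abbreviation "P \<equiv> proj_bundle_polytope k a"

section \<open>Facet functions and barycentric coordinates of the slices\<close>

lemma inner_U: "x \<bullet> U j = (if j = k then of_int a * x $ k - (\<Sum>i | i \<noteq> k. x $ i) else x $ j)"
  by (simp add: U_def inner_diff_right inner_sum_right inner_axis)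

lemma U_inner: "U j \<bullet> x = (if j = k then of_int a * x $ k - (\<Sum>i | i \<noteq> k. x $ i) else x $ j)"
  by (simp add: inner_U[symmetric] inner_commute)

lemma W_nth: "W j $ i = (if i = j \<and> j \<noteq> k then 1 else 0)"
  by (simp add: W_def axis_def)

lemma W_k [simp]: "W j $ k = 0"
  by (auto simp: W_nth)

lemma U_W: "U l \<bullet> W j = (if j = k then 0 else if l = k then -1 else if l = j then 1 else 0)"
proof -
  have "(\<Sum>i | i \<noteq> k. W j $ i) = (\<Sum>i | i \<noteq> k. if i = j then (if j \<noteq> k then 1 else 0) else 0)"
    by (intro sum.cong) (auto simp: W_nth)
  then show ?thesis
    by (auto simp: U_inner W_nth)
qed

text \<open>\<open>W i - W j\<close> is an edge direction of the slices: it moves barycentric weight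
  from j to i and fixes the other weights. The index \<open>k\<close> is not exceptional here, which
  makes the n lateral facets interchangeable.\<close>

lemma U_W_diff:
  assumes "i \<noteq> j"
  shows "U l \<bullet> (W i - W j) = (if l = i then 1 else if l = j then -1 else 0)"
  using assms by (auto simp: inner_diff_right U_W)

lemma card_ne_k: "card {i. i \<noteq> k} = CARD('n) - 1"
proof -
  have "{i. i \<noteq> k} = UNIV - {k}" by auto
  then show ?thesis by (simp add: card_Diff_singleton)
qed

lemma card_ge_2: "CARD('n) \<ge> 2"
  using a by linarith

lemma sum_ne_k: "(\<Sum>j\<in>UNIV. g j) = g k + (\<Sum>j | j \<noteq> k. g j)" for g :: "'n \<Rightarrow> 'b::comm_monoid_add"
proof -
  have "UNIV - {k} = {j. j \<noteq> k}" by auto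
  then show ?thesis by (simp add: sum.remove[of UNIV k])
qed

text \<open>The base coordinates cancel between \<open>y k\<close> and the other terms. Hence the
  \<open>y j x / s (x $ k)\<close> are barycentric coordinates of x in its slice.\<close>

lemma sum_y: "(\<Sum>j\<in>UNIV. y j x) = s (x $ k)"
proof -
  have "(\<Sum>j | j \<noteq> k. y j x) = (\<Sum>j | j \<noteq> k. x $ j) + (real CARD('n) - 1)"
    using card_ge_2 by (simp add: y_def inner_U sum.distrib card_ne_k of_nat_diff)
  moreover have "y k x = of_int a * x $ k - (\<Sum>i | i \<noteq> k. x $ i) + 1"
    by (simp add: y_def inner_U)
  ultimately show ?thesis unfolding sum_ne_k s_def by simp
qed

lemma rays_eq: "proj_bundle_rays k a = range U \<union> {axis k 1, - axis k 1}"
proof -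
  have "range U = {U k} \<union> {U i | i. i \<noteq> k}" by auto
  also have "{U i | i. i \<noteq> k} = {axis i 1 | i. i \<noteq> k}" by (rule Collect_cong, rule iff_exI) (auto simp: U_def)
  finally show ?thesis
    unfolding proj_bundle_rays_def by (auto simp: U_def)
qed

lemma y_nonneg_iff: "0 \<le> y j x \<longleftrightarrow> -1 \<le> U j \<bullet> x"
  by (auto simp: y_def inner_commute[of x])

lemma P_iff: "x \<in> P \<longleftrightarrow> (\<forall>j. 0 \<le> y j x) \<and> -1 \<le> x $ k \<and> x $ k \<le> 1"
proof -
  have "x \<in> P \<longleftrightarrow> (\<forall>j. -1 \<le> U j \<bullet> x) \<and> -1 \<le> axis k 1 \<bullet> x \<and> -1 \<le> (- axis k 1) \<bullet> x"
    unfolding proj_bundle_polytope_def dual_polytope_def rays_eq by auto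
  then show ?thesis by (auto simp: y_nonneg_iff inner_axis')
qed

section \<open>Positivity of \<open>s\<close>; compactness and interior of \<open>P\<close>\<close>

lemma s_pos: "-1 \<le> t \<Longrightarrow> 0 < s t"
proof -
  assume "-1 \<le> t"
  then have "of_int a * t \<ge> of_int a * (-1 :: real)" using a by (intro mult_left_mono) auto
  moreover have "real_of_int a < real CARD('n)" using a by linarith
  ultimately show ?thesis by (simp add: s_def)
qed

lemma s_mono: "t \<le> t' \<Longrightarrow> s t \<le> s t'"
  using a by (simp add: s_def)

lemma y_line [simp]: "i \<noteq> j \<Longrightarrow> y l (x + \<tau> *\<^sub>R (W i - W j)) =
    y l x + (if l = i then \<tau> else if l = j then - \<tau> else 0)"
  using U_W_diff[of i j l] by (simp add: y_def inner_add_left inner_commute[of "W i - W j" "U l"])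

lemma continuous_y [continuous_intros]: "continuous_on S g \<Longrightarrow> continuous_on S (\<lambda>x. y j (g x))"
  unfolding y_def by (intro continuous_intros)

lemma continuous_s [continuous_intros]: "continuous_on S g \<Longrightarrow> continuous_on S (\<lambda>x. s (g x))"
  unfolding s_def by (intro continuous_intros)

lemma P_eq_INT: "P = (\<Inter>j. {x. U j \<bullet> x \<ge> -1}) \<inter> {x. x $ k \<ge> -1} \<inter> {x. x $ k \<le> 1}"
  by (auto simp: P_iff y_nonneg_iff)

lemma convex_P: "convex P"
proof -
  have "convex {x :: real^'n. x $ k \<ge> -1}" "convex {x :: real^'n. x $ k \<le> 1}"
    using convex_halfspace_ge[of "-1" "axis k (1::real)"] convex_halfspace_le[of "axis k (1::real)" 1]
    by (simp_all add: inner_axis')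
  then show ?thesis
    unfolding P_eq_INT by (intro convex_Int convex_INT convex_halfspace_ge) auto
qed

lemma closed_P: "closed P"
  unfolding P_eq_INT
  by (intro closed_Int closed_INT ballI closed_Collect_le continuous_intros)

lemma bounded_P: "bounded P"
proof -
  have "\<bar>x $ i\<bar> \<le> s 1 + 1" if "x \<in> P" for x i
  proof (cases "i = k")
    case True
    then show ?thesis using that s_pos[of 1] by (auto simp: P_iff)
  next
    case False
    have "y i x \<le> (\<Sum>j\<in>UNIV. y j x)"
      using that by (intro member_le_sum) (auto simp: P_iff)
    also have "\<dots> \<le> s 1" using that by (auto simp: sum_y P_iff intro: s_mono)
    finally have "x $ i + 1 \<le> s 1" using False by (simp add: y_def inner_U)
    moreover have "0 \<le> y i x" using that by (simp add: P_iff)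
    then have "0 \<le> x $ i + 1" using False by (simp add: y_def inner_U)
    ultimately show ?thesis using s_pos[of 1] by auto
  qed
  then have "- (s 1 + 1) \<le> x $ i \<and> x $ i \<le> s 1 + 1" if "x \<in> P" for x i
    using that by (simp only: abs_le_iff minus_le_iff)
  then have "P \<subseteq> cbox (\<chi> i. - (s 1 + 1)) (\<chi> i. s 1 + 1)"
    by (auto simp: mem_box_cart)
  then show ?thesis by (rule bounded_subset[OF bounded_cbox])
qed

lemma compact_P: "compact P"
  using closed_P bounded_P compact_eq_bounded_closed by blast

lemma open_P_subset: "open {x. (\<forall>j. 0 < y j x) \<and> -1 < x $ k \<and> x $ k < 1}"
proof -
  have "{x. (\<forall>j. 0 < y j x) \<and> -1 < x $ k \<and> x $ k < 1} =
    (\<Inter>j. {x. 0 < y j x}) \<inter> {x. -1 < x $ k} \<inter> {x. x $ k < 1}" by auto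
  then show ?thesis
    by (auto intro!: open_Int open_INT open_Collect_less continuous_intros)
qed

lemma interior_P_I:
  assumes "\<And>j. 0 < y j x" "-1 < x $ k" "x $ k < 1"
  shows "x \<in> interior P"
  by (rule interiorI[OF open_P_subset]) (use assms in \<open>auto simp: P_iff less_imp_le\<close>)

lemma zero_interior_P: "0 \<in> interior P"
  by (rule interior_P_I) (auto simp: y_def)

lemma zero_in_P: "0 \<in> P"
  using zero_interior_P interior_subset by blast

end

section \<open>Lateral facets\<close>

context proj_bundle begin

definition face :: "real ^ 'n \<Rightarrow> (real ^ 'n) set" where
  "face u = P \<inter> {x. x \<bullet> u = -1}"

definition face_integral :: "real ^ 'n \<Rightarrow> (real ^ 'n \<Rightarrow> real) \<Rightarrow> real" where
  "face_integral u f = (LINT x:face u|hyperplane_lborel u (-1). f x) / norm u"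

lemma face_subset: "face u \<subseteq> P"
  by (auto simp: face_def)

lemma compact_face: "compact (face u)"
  unfolding face_def by (intro compact_Int_closed compact_P closed_Collect_eq continuous_intros)

lemma bounded_supported_face:
  "continuous_on P f \<Longrightarrow> bounded_supported (\<lambda>x. indicator (face u) x * f x)"
  by (intro bounded_supported_indicator compact_face continuous_on_subset[OF _ face_subset])

lemma face_integral_eq:
  assumes "continuous_on P f" "u \<bullet> v = 1"
  shows "face_integral u f = (\<integral>x. indicator {-1..0} (x \<bullet> u) *
    (indicator (face u) (x - (x \<bullet> u + 1) *\<^sub>R v) * f (x - (x \<bullet> u + 1) *\<^sub>R v)) \<partial>lborel)"
  unfolding face_integral_def
  using hyperplane_lborel_integral[OF bounded_supported_face[OF assms(1)] assms(2), of "-1"] by simp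

lemma bounded_supported_face_slab:
  assumes "continuous_on P f"
  shows "bounded_supported (\<lambda>x. indicator {-1..0} (x \<bullet> u) *
    (indicator (face u) (x - (x \<bullet> u + 1) *\<^sub>R v) * f (x - (x \<bullet> u + 1) *\<^sub>R v)))"
  using slab_projection_bounded_supported[OF bounded_supported_face[OF assms, of u], of "-1" 1 u v] by simp

lemma face_integral_add:
  assumes "continuous_on P f" "continuous_on P g" "u \<bullet> v = 1"
  shows "face_integral u (\<lambda>x. f x + g x) = face_integral u f + face_integral u g"
proof -
  note i = bounded_supported_integrable[OF bounded_supported_face_slab]
  show ?thesis
    using assms by (simp add: face_integral_eq[OF _ assms(3)] continuous_on_add distrib_left
        i flip: Bochner_Integration.integral_add)
qed

lemma face_integral_cmult:
  "face_integral u (\<lambda>x. c * f x) = c * face_integral u f"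
  by (simp add: face_integral_def)

lemma face_integral_sum:
  assumes "finite J" "\<And>j. j \<in> J \<Longrightarrow> continuous_on P (f j)" "u \<bullet> v = 1"
  shows "face_integral u (\<lambda>x. \<Sum>j\<in>J. f j x) = (\<Sum>j\<in>J. face_integral u (f j))"
  using assms(1,2)
proof (induction J rule: finite_induct)
  case empty
  show ?case by (simp add: face_integral_def)
next
  case (insert j J)
  then show ?case by (simp add: face_integral_add[OF _ _ assms(3)] continuous_on_sum)
qed

lemma face_integral_cong: "(\<And>x. x \<in> face u \<Longrightarrow> f x = g x) \<Longrightarrow> face_integral u f = face_integral u g"
  unfolding face_integral_def set_lebesgue_integral_def
  by (intro arg_cong2[where f = "(/)"] Bochner_Integration.integral_cong refl) (auto simp: indicator_def)

lemma face_integral_nonneg: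
  "(\<And>x. x \<in> face u \<Longrightarrow> f x \<ge> 0) \<Longrightarrow> face_integral u f \<ge> 0"
  unfolding face_integral_def set_lebesgue_integral_def
  by (intro divide_nonneg_nonneg Bochner_Integration.integral_nonneg) (auto simp: indicator_def)

lemma mem_face_U: "x \<in> face (U i) \<longleftrightarrow> x \<in> P \<and> y i x = 0"
  by (auto simp: face_def y_def)

lemma W_line: "i \<noteq> j \<Longrightarrow> U i \<bullet> (W i - W j) = 1" "i \<noteq> j \<Longrightarrow> U j \<bullet> (W i - W j) = -1"
  by (auto simp: U_W_diff)

text \<open>The deviation of \<open>f\<close> from being affine on the edge-direction line through a point of a
  lateral facet.\<close>

definition defect :: "(real ^ 'n \<Rightarrow> real) \<Rightarrow> 'n \<Rightarrow> 'n \<Rightarrow> real ^ 'n \<Rightarrow> real" where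
  "defect f i j x = y j x / (2 * s (x $ k)) *
     (f x + f (x + y j x *\<^sub>R (W i - W j)) - 2 * f (x + (y j x / 2) *\<^sub>R (W i - W j)))"

lemma convex_on_line:
  fixes f :: "'a::real_vector \<Rightarrow> real"
  assumes "convex_on UNIV f" shows "convex_on UNIV (\<lambda>\<tau>. f (p + \<tau> *\<^sub>R v))"
proof (rule convex_onI)
  fix t x z :: real
  assume t: "0 < t" "t < 1"
  have "p + ((1 - t) *\<^sub>R x + t *\<^sub>R z) *\<^sub>R v = (1 - t) *\<^sub>R (p + x *\<^sub>R v) + t *\<^sub>R (p + z *\<^sub>R v)"
    by (simp add: algebra_simps)
  then show "f (p + ((1 - t) *\<^sub>R x + t *\<^sub>R z) *\<^sub>R v) \<le> (1 - t) * f (p + x *\<^sub>R v) + t * f (p + z *\<^sub>R v)"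
    using convex_onD[OF assms, of t "p + x *\<^sub>R v" "p + z *\<^sub>R v"] t by simp
qed auto

lemma defect_nonneg:
  assumes "convex_on UNIV f" "x \<in> P"
  shows "defect f i j x \<ge> 0"
proof -
  have "f ((1 - 1/2) *\<^sub>R x + (1/2) *\<^sub>R (x + y j x *\<^sub>R (W i - W j))) \<le>
      (1 - 1/2) * f x + (1/2) * f (x + y j x *\<^sub>R (W i - W j))"
    by (rule convex_onD[OF assms(1)]) auto
  moreover have "(1 - 1/2) *\<^sub>R x + (1/2) *\<^sub>R (x + y j x *\<^sub>R (W i - W j)) = x + (y j x / 2) *\<^sub>R (W i - W j)"
    by (simp add: vec_eq_iff field_simps)
  moreover have "s (x $ k) > 0" "y j x \<ge> 0" using assms(2) by (auto simp: P_iff s_pos)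
  ultimately show ?thesis unfolding defect_def by (intro mult_nonneg_nonneg) auto
qed

lemma s_nonzero: "x \<in> P \<Longrightarrow> s (x $ k) \<noteq> 0"
  using s_pos[of "x $ k"] by (auto simp: P_iff)

lemma continuous_compose:
  "continuous_on UNIV f \<Longrightarrow> continuous_on S g \<Longrightarrow> continuous_on S (\<lambda>x. f (g x))"
  using continuous_on_compose2[of UNIV f S g] by auto

lemma continuous_defect:
  assumes "continuous_on UNIV f" shows "continuous_on P (defect f i j)"
  unfolding defect_def
  by (intro continuous_intros continuous_compose[OF assms]) (auto simp: s_nonzero)

text \<open>\<open>q x\<close> is where the line through x meets \<open>y i = 0\<close>. From there
  \<open>y i = \<tau>\<close> and \<open>y j = y j (q x) - \<tau>\<close>, while the other facet
  functions and the height are constant. So \<open>P\<close> cuts out the parameters from 0 to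
  \<open>y j (q x)\<close> if \<open>q x\<close> lies on the facet, and nothing otherwise.\<close>

lemma lateral_line:
  fixes F :: "real ^ 'n \<Rightarrow> real"
  assumes F: "continuous_on P F" and ij: "i \<noteq> j"
  defines "v \<equiv> W i - W j"
  defines "q \<equiv> \<lambda>x. x - (x \<bullet> U i + 1) *\<^sub>R v"
  shows "(\<integral>\<tau>. indicator P (x + \<tau> *\<^sub>R v) * F (x + \<tau> *\<^sub>R v) \<partial>lborel) =
    indicator (face (U i)) (q x) * (LINT \<tau>:{0..y j (q x)}|lborel. F (q x + \<tau> *\<^sub>R v))"
proof -
  have vk: "v $ k = 0" by (simp add: v_def)
  have y_v: "y l (x + \<tau> *\<^sub>R v) = y l x + (if l = i then \<tau> else if l = j then - \<tau> else 0)" for l x \<tau>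
    using ij by (simp add: v_def)
  have y_v': "y l (x - \<tau> *\<^sub>R v) = y l x - (if l = i then \<tau> else if l = j then - \<tau> else 0)" for l x \<tau>
    using y_v[of l x "- \<tau>"] by simp
  have yq: "y i (q x) = 0" by (simp add: q_def y_v') (simp add: y_def)
  have inP: "q x + \<tau> *\<^sub>R v \<in> P \<longleftrightarrow> q x \<in> face (U i) \<and> \<tau> \<in> {0..y j (q x)}" for \<tau>
  proof
    assume *: "q x + \<tau> *\<^sub>R v \<in> P"
    then have pos: "0 \<le> y l (q x) + (if l = i then \<tau> else if l = j then - \<tau> else 0)" for l
      by (simp add: P_iff y_v)
    have "0 \<le> \<tau>" "\<tau> \<le> y j (q x)" using pos[of i] pos[of j] yq ij by auto
    moreover have "0 \<le> y l (q x)" for l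
      using pos[of l] yq \<open>0 \<le> \<tau>\<close> by (auto split: if_splits)
    ultimately show "q x \<in> face (U i) \<and> \<tau> \<in> {0..y j (q x)}"
      using * yq vk by (auto simp: mem_face_U P_iff)
  next
    assume "q x \<in> face (U i) \<and> \<tau> \<in> {0..y j (q x)}"
    then show "q x + \<tau> *\<^sub>R v \<in> P"
      using yq vk by (auto simp: mem_face_U P_iff y_v)
  qed
  let ?g = "\<lambda>x. indicator P x * F x"
  have [measurable]: "?g \<in> borel_measurable borel"
    by (rule bounded_supported_measurable[OF bounded_supported_indicator[OF compact_P F]])
  have "(\<integral>\<tau>. ?g (x + \<tau> *\<^sub>R v) \<partial>lborel) = (\<integral>\<tau>. ?g (q x + (\<tau> + (x \<bullet> U i + 1)) *\<^sub>R v) \<partial>lborel)"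
    by (intro Bochner_Integration.integral_cong refl) (simp add: q_def algebra_simps)
  also have "\<dots> = (\<integral>\<tau>. ?g (q x + \<tau> *\<^sub>R v) \<partial>lborel)"
    by (rule lborel_integral_translation[of "\<lambda>\<tau>. ?g (q x + \<tau> *\<^sub>R v)"])
       (rule measurable_compose[of _ _ borel ?g], measurable)
  also have "\<dots> = indicator (face (U i)) (q x) * (LINT \<tau>:{0..y j (q x)}|lborel. F (q x + \<tau> *\<^sub>R v))"
    unfolding set_lebesgue_integral_def
    by (subst Bochner_Integration.integral_mult_right_zero[symmetric])
       (intro Bochner_Integration.integral_cong refl, auto simp: indicator_def inP)
  finally show ?thesis .
qed

text \<open>On each segment of \<open>lateral_line\<close> the height is constant and
  \<open>y i - y j\<close> equals \<open>2 * \<tau> - y j q\<close>, odd about the midpoint. This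
  replaces a change of variables by the symmetries of the slice.\<close>

lemma integral_y_swap:
  assumes ij: "i \<noteq> j" and g: "continuous_on {-1..1} g"
  shows "(LINT x:P|lborel. y i x * g (x $ k)) = (LINT x:P|lborel. y j x * g (x $ k))"
proof -
  define v where "v = W i - W j"
  have vk: "v $ k = 0" by (simp add: v_def)
  have uv: "U i \<bullet> v = 1" using W_line[OF ij] by (simp add: v_def)
  let ?F = "\<lambda>x. (y i x - y j x) * g (x $ k)"
  have cg: "continuous_on P (\<lambda>x. g (x $ k))"
    by (rule continuous_on_compose2[OF g]) (auto simp: P_iff intro!: continuous_intros)
  have cF: "continuous_on P ?F"
    by (intro continuous_intros cg)
  have "(\<integral>\<tau>. indicator P (x + \<tau> *\<^sub>R v) * ?F (x + \<tau> *\<^sub>R v) \<partial>lborel) = 0" for x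
  proof -
    define q where "q = x - (x \<bullet> U i + 1) *\<^sub>R v"
    have "(LINT \<tau>:{0..y j q}|lborel. ?F (q + \<tau> *\<^sub>R v)) = 0" if q: "q \<in> face (U i)"
    proof -
      have yq: "y i q = 0" "0 \<le> y j q" using q by (simp_all add: mem_face_U P_iff)
      have "?F (q + \<tau> *\<^sub>R v) = (2 * \<tau> - y j q) * g (q $ k)" for \<tau>
        using ij yq vk by (simp add: v_def)
      then have "(LINT \<tau>:{0..y j q}|lborel. ?F (q + \<tau> *\<^sub>R v)) =
          (LINT \<tau>:{0..y j q}|lborel. (2 * \<tau> - y j q) * g (q $ k))"
        by (simp only:)
      also have "(LINT \<tau>:{0..y j q}|lborel. (2 * \<tau> - y j q) * g (q $ k)) =
          integral {0..y j q} (\<lambda>\<tau>. (2 * \<tau> - y j q) * g (q $ k))"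
        by (intro set_borel_integral_eq_integral(2), unfold set_integrable_def)
           (intro borel_integrable_compact continuous_intros compact_Icc)
      also have "integral {0..y j q} (\<lambda>\<tau>. (2 * \<tau> - y j q) * g (q $ k)) = 0"
      proof -
        have "((\<lambda>\<tau>. (2 * \<tau> - y j q) * g (q $ k)) has_integral
          ((y j q)\<^sup>2 - y j q * y j q) * g (q $ k) - (0\<^sup>2 - y j q * 0) * g (q $ k)) {0..y j q}"
        using yq by (intro fundamental_theorem_of_calculus)
          (auto intro!: derivative_eq_intros simp flip: has_real_derivative_iff_has_vector_derivative)
        from integral_unique[OF this] show ?thesis unfolding power2_eq_square by simp
      qed
      finally show ?thesis .
    qed
    then show ?thesis
      using lateral_line[OF cF ij, of x] unfolding v_def[symmetric] q_def[symmetric]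
      by (auto simp: indicator_def)
  qed
  then have "(\<integral>x. indicator P x * ?F x \<partial>lborel) = 0"
    using integral_slab_lines(1)[OF bounded_supported_indicator[OF compact_P cF] uv, of 0] by simp
  moreover have "(LINT x:P|lborel. y i x * g (x $ k) - y j x * g (x $ k)) =
    (LINT x:P|lborel. y i x * g (x $ k)) - (LINT x:P|lborel. y j x * g (x $ k))"
    by (intro set_integral_diff(2), unfold set_integrable_def)
       (intro borel_integrable_compact compact_P continuous_intros cg)+
  ultimately show ?thesis by (simp add: set_lebesgue_integral_def left_diff_distrib)
qed

text \<open>Integrate the trapezoid rule over the lines in the direction joining two vertices of the
  base simplex.\<close>

lemma lateral_pair:
  assumes f: "convex_on UNIV f" and ij: "i \<noteq> j"
  shows "2 * (LINT x:P|lborel. f x / s (x $ k)) \<le>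
    face_integral (U i) (\<lambda>x. y j x / s (x $ k) * f x) + face_integral (U j) (\<lambda>x. y i x / s (x $ k) * f x)
    - face_integral (U i) (defect f i j)"
proof -
  define v where "v = W i - W j"
  have vk: "v $ k = 0" by (simp add: v_def)
  have uv: "U i \<bullet> v = 1" "U j \<bullet> v = -1" using W_line[OF ij] by (auto simp: v_def)
  then have uv': "U j \<bullet> (- v) = 1" by simp
  have y_v: "y l (x + \<tau> *\<^sub>R v) = y l x + (if l = i then \<tau> else if l = j then - \<tau> else 0)" for l x \<tau>
    using ij by (simp add: v_def)
  have y_v': "y l (x - \<tau> *\<^sub>R v) = y l x - (if l = i then \<tau> else if l = j then - \<tau> else 0)" for l x \<tau>
    using y_v[of l x "- \<tau>"] by simp
  have cf: "continuous_on UNIV f" by (rule convex_on_continuous[OF open_UNIV f])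
  have cP: "continuous_on P (\<lambda>x. f x / s (x $ k))"
    by (intro continuous_intros continuous_compose[OF cf]) (auto simp: s_nonzero)
  define p where "p x = x - (x \<bullet> U i + 1) *\<^sub>R v" for x
  \<comment> \<open>\<open>e x\<close> is the value of f at the far end of the segment starting at
    the facet point x, and \<open>B\<close> is the bound of
    \<open>integral_trapezoid_midpoint\<close> divided by s, which is constant on the
    segment.\<close>
  define e where "e x = f (x + y j x *\<^sub>R v)" for x
  define B where "B x = y j x / s (x $ k) * f x + y j x / s (x $ k) * e x - defect f i j x" for x
  have ce: "continuous_on P (\<lambda>x. y j x / s (x $ k) * e x)" "continuous_on P (\<lambda>x. y j x / s (x $ k) * f x)"
      "continuous_on P (\<lambda>x. y i x / s (x $ k) * f x)"
    unfolding e_def by (intro continuous_intros continuous_compose[OF cf]; auto simp: s_nonzero)+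
  have cB: "continuous_on P B"
    unfolding B_def by (intro continuous_on_add continuous_on_diff ce continuous_defect cf)
  have line: "2 * (\<integral>\<tau>. indicator P (x + \<tau> *\<^sub>R v) * (f (x + \<tau> *\<^sub>R v) / s ((x + \<tau> *\<^sub>R v) $ k)) \<partial>lborel)
      \<le> indicator (face (U i)) (p x) * B (p x)" for x
  proof -
    define q where "q = p x"
    have eq: "(\<integral>\<tau>. indicator P (x + \<tau> *\<^sub>R v) * (f (x + \<tau> *\<^sub>R v) / s ((x + \<tau> *\<^sub>R v) $ k)) \<partial>lborel) =
       indicator (face (U i)) q * ((LINT \<tau>:{0..y j q}|lborel. f (q + \<tau> *\<^sub>R v)) / s (q $ k))"
      using lateral_line[OF cP ij, of x] vk by (simp add: q_def p_def v_def)
    show ?thesis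
    proof (cases "q \<in> face (U i)")
      case False
      then show ?thesis using eq by (simp add: q_def)
    next
      case True
      then have pos: "y j q \<ge> 0" "s (q $ k) > 0" by (auto simp: mem_face_U P_iff s_pos)
      have "set_integrable lborel {0..y j q} (\<lambda>\<tau>. f (q + \<tau> *\<^sub>R v))"
        unfolding set_integrable_def
        by (intro borel_integrable_compact continuous_intros continuous_compose[OF cf]) auto
      then have "(LINT \<tau>:{0..y j q}|lborel. f (q + \<tau> *\<^sub>R v)) = integral {0..y j q} (\<lambda>\<tau>. f (q + \<tau> *\<^sub>R v))"
        by (rule set_borel_integral_eq_integral(2))
      moreover have "s (q $ k) * B q = y j q * (f q + e q) - y j q / 2 * (f q + e q - 2 * f (q + (y j q / 2) *\<^sub>R v))"
      proof -
        have "s (q $ k) * B q = (s (q $ k) / s (q $ k)) * (y j q * (f q + e q) - y j q / 2 * (f q + e q - 2 * f (q + (y j q / 2) *\<^sub>R v)))"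
          by (simp add: B_def defect_def v_def[symmetric] e_def[symmetric] algebra_simps diff_divide_distrib add_divide_distrib)
        then show ?thesis using pos(2) by simp
      qed
      moreover note integral_trapezoid_midpoint[OF convex_on_line[OF f, of q v] pos(1)]
      ultimately have "2 * (LINT \<tau>:{0..y j q}|lborel. f (q + \<tau> *\<^sub>R v)) \<le> s (q $ k) * B q"
        by (simp add: e_def)
      then have "2 * ((LINT \<tau>:{0..y j q}|lborel. f (q + \<tau> *\<^sub>R v)) / s (q $ k)) \<le> B q"
        using pos(2) by (simp add: field_simps)
      then show ?thesis using eq True by (simp add: q_def)
    qed
  qed
  let ?g = "\<lambda>x. indicator P x * (f x / s (x $ k))"
  have bg: "bounded_supported ?g" by (rule bounded_supported_indicator[OF compact_P cP])
  have "2 * (LINT x:P|lborel. f x / s (x $ k)) = 2 * (\<integral>x. ?g x \<partial>lborel)"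
    by (simp add: set_lebesgue_integral_def)
  also have "\<dots> = 2 * (\<integral>x. indicator {-1..-1+1} (x \<bullet> U i) * (\<integral>\<tau>. ?g (x + \<tau> *\<^sub>R v) \<partial>lborel) \<partial>lborel)"
    using integral_slab_lines(1)[OF bg uv(1), of "-1"] by simp
  also have "\<dots> = (\<integral>x. indicator {-1..0} (x \<bullet> U i) * (2 * (\<integral>\<tau>. ?g (x + \<tau> *\<^sub>R v) \<partial>lborel)) \<partial>lborel)"
    by (subst Bochner_Integration.integral_mult_right_zero[symmetric]) (simp add: mult_ac)
  also have "\<dots> \<le> (\<integral>x. indicator {-1..0} (x \<bullet> U i) * (indicator (face (U i)) (p x) * B (p x)) \<partial>lborel)"
  proof (rule integral_mono)
    show "integrable lborel (\<lambda>x. indicator {-1..0} (x \<bullet> U i) * (2 * (\<integral>\<tau>. ?g (x + \<tau> *\<^sub>R v) \<partial>lborel)))"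
      using integrable_mult_right[OF integral_slab_lines(2)[OF bg uv(1), of "-1"], of 2] by (simp add: mult_ac)
    show "integrable lborel (\<lambda>x. indicator {-1..0} (x \<bullet> U i) * (indicator (face (U i)) (p x) * B (p x)))"
      unfolding p_def by (rule bounded_supported_integrable[OF bounded_supported_face_slab[OF cB]])
  qed (use line in \<open>auto simp: indicator_def\<close>)
  also have "\<dots> = face_integral (U i) B"
    unfolding p_def by (rule face_integral_eq[OF cB uv(1), symmetric])
  also have "\<dots> = face_integral (U i) (\<lambda>x. y j x / s (x $ k) * f x) +
      face_integral (U i) (\<lambda>x. y j x / s (x $ k) * e x) - face_integral (U i) (defect f i j)"
  proof -
    have "face_integral (U i) (\<lambda>x. y j x / s (x $ k) * f x) + face_integral (U i) (\<lambda>x. y j x / s (x $ k) * e x)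
      = face_integral (U i) (\<lambda>x. B x + defect f i j x)"
      unfolding face_integral_add[OF ce(2,1) uv(1), symmetric] by (simp add: B_def)
    also have "\<dots> = face_integral (U i) B + face_integral (U i) (defect f i j)"
      by (rule face_integral_add[OF cB continuous_defect[OF cf] uv(1)])
    finally show ?thesis by simp
  qed
  also have "face_integral (U i) (\<lambda>x. y j x / s (x $ k) * e x) =
      (\<integral>x. indicator {-1..0} (x \<bullet> U i) * (indicator (face (U i)) (p x) * (y j (p x) / s (p x $ k) * e (p x))) \<partial>lborel)"
    unfolding p_def by (rule face_integral_eq[OF ce(1) uv(1)])
  \<comment> \<open>\<open>p\<close> is constant along \<open>v\<close>, so the slab of
    \<open>U i\<close> may be exchanged for that of \<open>U j\<close>; the far-end values can then
    be read as values on the facet of \<open>U j\<close>.\<close>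
  also have "\<dots> = (\<integral>x. indicator {-1..0} (x \<bullet> U j) *
      (indicator (face (U i)) (p x) * (y j (p x) / s (p x $ k) * e (p x))) \<partial>lborel)"
  proof -
    have "bounded_supported (\<lambda>x. indicator {-1..-1+1} (x \<bullet> U i) *
       (indicator (face (U i)) (p x) * (y j (p x) / s (p x $ k) * e (p x))))"
      using bounded_supported_face_slab[OF ce(1)] unfolding p_def by simp
    moreover have "p (x + \<tau> *\<^sub>R v) = p x" for x \<tau>
      using uv by (simp add: p_def inner_add_left inner_commute[of v] algebra_simps)
    ultimately show ?thesis
      using integral_slab_line_invariant[where c = "-1" and c' = "-1" and u = "U i" and u' = "U j" and v = v
        and K = "\<lambda>x. indicator (face (U i)) (p x) * (y j (p x) / s (p x $ k) * e (p x))"] uv by simp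
  qed
  also have "\<dots> = face_integral (U j) (\<lambda>x. y i x / s (x $ k) * f x)"
    unfolding face_integral_eq[OF ce(3) uv']
  proof (intro Bochner_Integration.integral_cong refl arg_cong2[where f = "(*)"])
    fix x
    \<comment> \<open>\<open>p x\<close> and \<open>?r\<close> are the two ends of one segment;
      \<open>y j (p x)\<close> and \<open>y i ?r\<close> both give its length in the parameter
      \<tau>.\<close>
    let ?r = "x - (x \<bullet> U j + 1) *\<^sub>R (- v)"
    have r: "?r = x + y j x *\<^sub>R v" and px: "p x = x - y i x *\<^sub>R v" by (simp_all add: p_def y_def)
    have "y j (p x) = y i x + y j x" using ij by (simp add: px y_v')
    then have yi: "y i ?r = y j (p x)" and rp: "?r = p x + y j (p x) *\<^sub>R v"
      unfolding r using ij by (simp_all add: y_v px algebra_simps)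
    have l: "y l (p x) = y l ?r" if "l \<noteq> i" "l \<noteq> j" for l
      unfolding rp y_v using that by simp
    have 0: "y i (p x) = 0" "y j ?r = 0"
      unfolding r px y_v y_v' using ij by simp_all
    show "indicat_real (face (U i)) (p x) = indicat_real (face (U j)) ?r"
    proof -
      have "(\<forall>l. 0 \<le> y l (p x)) \<longleftrightarrow> (\<forall>l. 0 \<le> y l ?r)"
      proof (intro iffI allI)
        fix l' assume *: "\<forall>l. 0 \<le> y l (p x)"
        show "0 \<le> y l' ?r"
          using * l[of l'] 0(2) yi by (metis order_refl)
      next
        fix l' assume *: "\<forall>l. 0 \<le> y l ?r"
        show "0 \<le> y l' (p x)"
          using * l[of l'] 0(1) yi by (metis order_refl)
      qed
      moreover have "?r $ k = p x $ k" unfolding rp using vk by simp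
      ultimately have "p x \<in> face (U i) \<longleftrightarrow> ?r \<in> face (U j)"
        unfolding mem_face_U P_iff 0 by simp
      then show ?thesis by (simp add: indicator_def)
    qed
    show "e (p x) = f ?r" unfolding e_def rp ..
    have "p x $ k = ?r $ k" unfolding rp using vk by simp
    then show "y j (p x) / s (p x $ k) = y i ?r / s (?r $ k)" unfolding yi by simp
  qed
  finally show ?thesis by simp
qed

end

section \<open>Lines through the apex\<close>

context proj_bundle begin

lemma exists_other: "\<exists>j. j \<noteq> (i :: 'n)"
proof (rule ccontr)
  assume "\<not> ?thesis"
  then have "UNIV = {i}" by auto
  then have "CARD('n) = 1" by (metis card_1_singleton_iff One_nat_def)
  then show False using card_ge_2 by simp
qed

lemma sum_pairs_swap:
  fixes g :: "'n \<Rightarrow> 'n \<Rightarrow> real"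
  shows "(\<Sum>i\<in>UNIV. \<Sum>j\<in>UNIV - {i}. g j i) = (\<Sum>i\<in>UNIV. \<Sum>j\<in>UNIV - {i}. g i j)"
proof -
  have *: "(\<Sum>i\<in>UNIV. \<Sum>j\<in>UNIV - {i}. h i j) = (\<Sum>i\<in>UNIV. \<Sum>j\<in>UNIV. if i = j then 0 else h i j)"
    for h :: "'n \<Rightarrow> 'n \<Rightarrow> real"
    by (intro sum.cong refl sum.mono_neutral_cong_left) auto
  show ?thesis
    unfolding * by (subst sum.swap) (intro sum.cong refl, auto)
qed

lemma sum_y_face:
  assumes "x \<in> face (U i)" shows "(\<Sum>j\<in>UNIV - {i}. y j x / s (x $ k) * f x) = f x"
proof -
  have "(\<Sum>j\<in>UNIV - {i}. y j x) = s (x $ k)"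
    using sum_y[of x] assms by (simp add: sum.remove[of UNIV i "\<lambda>j. y j x"] mem_face_U)
  moreover have "s (x $ k) \<noteq> 0" using assms s_nonzero by (simp add: mem_face_U)
  ultimately show ?thesis
    by (simp flip: sum_distrib_right sum_divide_distrib)
qed

text \<open>Summing \<open>lateral_pair\<close> over the n (n - 1) ordered pairs collects each facet
  integral twice: on the facet of \<open>U i\<close> the weights \<open>y j / s\<close> with j
  \<noteq> i add up to 1, because \<open>y i = 0\<close> there.\<close>

lemma lateral_total:
  assumes f: "convex_on UNIV f"
  shows "real CARD('n) * (real CARD('n) - 1) * (LINT x:P|lborel. f x / s (x $ k)) \<le>
    (\<Sum>i\<in>UNIV. face_integral (U i) f) - (\<Sum>i\<in>UNIV. \<Sum>j\<in>UNIV - {i}. face_integral (U i) (defect f i j)) / 2"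
proof -
  let ?I = "LINT x:P|lborel. f x / s (x $ k)" and ?D = "\<lambda>i j. face_integral (U i) (defect f i j)"
  let ?A = "\<lambda>i j. face_integral (U i) (\<lambda>x. y j x / s (x $ k) * f x)"
  have cf: "continuous_on UNIV f" by (rule convex_on_continuous[OF open_UNIV f])
  have A: "(\<Sum>j\<in>UNIV - {i}. ?A i j) = face_integral (U i) f" for i
  proof -
    obtain l where l: "l \<noteq> i" using exists_other by blast
    have "(\<Sum>j\<in>UNIV - {i}. ?A i j) = face_integral (U i) (\<lambda>x. \<Sum>j\<in>UNIV - {i}. y j x / s (x $ k) * f x)"
      using W_line(1)[of i l] l
      by (intro face_integral_sum[symmetric] continuous_intros continuous_compose[OF cf]) (auto simp: s_nonzero)
    also have "\<dots> = face_integral (U i) f"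
      by (rule face_integral_cong) (rule sum_y_face)
    finally show ?thesis .
  qed
  have swap: "(\<Sum>i\<in>UNIV. \<Sum>j\<in>UNIV - {i}. ?A j i) = (\<Sum>i\<in>UNIV. \<Sum>j\<in>UNIV - {i}. ?A i j)"
    by (rule sum_pairs_swap)
  have "(\<Sum>i\<in>UNIV. \<Sum>j\<in>UNIV - {i :: 'n}. 2 * ?I) \<le> (\<Sum>i\<in>UNIV. \<Sum>j\<in>UNIV - {i}. ?A i j + ?A j i - ?D i j)"
    by (intro sum_mono lateral_pair[OF f]) auto
  moreover have "(\<Sum>i\<in>UNIV. \<Sum>j\<in>UNIV - {i :: 'n}. 2 * ?I) = 2 * (real CARD('n) * (real CARD('n) - 1) * ?I)"
    using card_ge_2 by (simp add: card_Diff_singleton of_nat_diff)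
  moreover have "(\<Sum>i\<in>UNIV. \<Sum>j\<in>UNIV - {i}. ?A i j + ?A j i - ?D i j) =
      (\<Sum>i\<in>UNIV. face_integral (U i) f) + (\<Sum>i\<in>UNIV. face_integral (U i) f)
      - (\<Sum>i\<in>UNIV. \<Sum>j\<in>UNIV - {i}. ?D i j)"
    by (simp only: sum.distrib sum_subtractf swap A)
  ultimately show ?thesis by linarith
qed

section \<open>Coordinates adapted to the lines through the apex\<close>

definition \<Psi> :: "real ^ 'n \<Rightarrow> real \<Rightarrow> real ^ 'n" where
  "\<Psi> z t = (\<chi> i. if i = k then t else s t * z $ i - 1)"

definition b :: "'n \<Rightarrow> real ^ 'n \<Rightarrow> real" where
  "b i z = (if i = k then 1 - (\<Sum>i | i \<noteq> k. z $ i) else z $ i)"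

text \<open>The standard simplex, with barycentric coordinates \<open>b\<close>, times [0, 1] in the
  coordinate \<open>k\<close>. That factor has length 1, so integrals of functions of
  \<open>\<Psi> z t\<close> over \<open>Z\<close> are integrals over the simplex.\<close>

definition Z :: "(real ^ 'n) set" where
  "Z = {z. (\<forall>i. 0 \<le> b i z) \<and> 0 \<le> z $ k \<and> z $ k \<le> 1}"

lemma \<Psi>_k [simp]: "\<Psi> z t $ k = t"
  by (simp add: \<Psi>_def)

lemma y_\<Psi>: "y i (\<Psi> z t) = s t * b i z"
proof (cases "i = k")
  case True
  have "(\<Sum>j | j \<noteq> k. \<Psi> z t $ j) = s t * (\<Sum>j | j \<noteq> k. z $ j) - (real CARD('n) - 1)"
    using card_ge_2 by (simp add: \<Psi>_def sum_subtractf card_ne_k of_nat_diff flip: sum_distrib_left)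
  then show ?thesis using True
    by (simp add: y_def inner_U b_def s_def algebra_simps)
next
  case False
  then show ?thesis by (simp add: y_def inner_U b_def \<Psi>_def)
qed

lemma \<Psi>_mem_P:
  assumes "-1 \<le> t" "t \<le> 1" "0 \<le> z $ k" "z $ k \<le> 1"
  shows "\<Psi> z t \<in> P \<longleftrightarrow> z \<in> Z"
  using assms s_pos[of t] by (simp add: P_iff y_\<Psi> Z_def zero_le_mult_iff)

lemma sum_b: "(\<Sum>i\<in>UNIV. b i z) = 1"
  unfolding sum_ne_k by (simp add: b_def)

lemma continuous_b [continuous_intros]: "continuous_on S g \<Longrightarrow> continuous_on S (\<lambda>x. b j (g x))"
  unfolding b_def by (cases "j = k") (auto intro!: continuous_intros)

lemma continuous_\<Psi> [continuous_intros]: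
  "continuous_on S g \<Longrightarrow> continuous_on S h \<Longrightarrow> continuous_on S (\<lambda>x. \<Psi> (g x) (h x))"
  unfolding \<Psi>_def
proof (rule continuous_on_vec_lambda)
  fix i assume "continuous_on S g" "continuous_on S h"
  then show "continuous_on S (\<lambda>x. if i = k then h x else s (h x) * g x $ i - 1)"
    by (cases "i = k") (auto intro!: continuous_intros)
qed

lemma Z_bounds: "z \<in> Z \<Longrightarrow> 0 \<le> z $ i \<and> z $ i \<le> 1"
proof (cases "i = k")
  case False
  assume z: "z \<in> Z"
  have "b i z \<le> (\<Sum>i\<in>UNIV. b i z)"
    using z by (intro member_le_sum) (auto simp: Z_def)
  then have "b i z \<le> 1" "0 \<le> b i z" using z by (auto simp: sum_b Z_def)
  then show ?thesis using False by (simp add: b_def)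
qed (auto simp: Z_def)

lemma compact_Z: "compact Z"
proof -
  have "Z \<subseteq> cbox 0 1" using Z_bounds by (auto simp: mem_box_cart)
  then have "bounded Z" by (rule bounded_subset[OF bounded_cbox])
  moreover have "Z = (\<Inter>i. {z. 0 \<le> b i z}) \<inter> {z. 0 \<le> z $ k} \<inter> {z. z $ k \<le> 1}" by (auto simp: Z_def)
  then have "closed Z"
    by (simp only:) (intro closed_Int closed_INT ballI closed_Collect_le continuous_intros)
  ultimately show ?thesis using compact_eq_bounded_closed by blast
qed

lemma b_affine: "b i ((1 - r) *\<^sub>R z + r *\<^sub>R z') = (1 - r) * b i z + r * b i z'"
  by (simp add: b_def sum.distrib flip: sum_distrib_left) (simp add: algebra_simps)

lemma convex_Z: "convex Z"
  unfolding convex_alt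
proof (intro ballI allI impI)
  fix z z' and r :: real assume *: "z \<in> Z" "z' \<in> Z" "0 \<le> r \<and> r \<le> 1"
  then have "(1 - r) * z $ k + r * z' $ k \<le> (1 - r) * 1 + r * 1"
    by (intro add_mono mult_left_mono) (auto simp: Z_def)
  then show "(1 - r) *\<^sub>R z + r *\<^sub>R z' \<in> Z"
    using * by (simp add: Z_def b_affine)
qed

definition center :: "real ^ 'n" where "center = (\<chi> i. 1 / real CARD('n))"

lemma b_center: "b i center = 1 / real CARD('n)"
  using card_ge_2 by (simp add: b_def center_def card_ne_k of_nat_diff field_simps)

lemma center_interior: "center \<in> interior Z"
proof (rule interiorI)
  show "open ((\<Inter>i. {z. 0 < b i z}) \<inter> {z. 0 < z $ k} \<inter> {z. z $ k < 1})"
    by (intro open_Int open_INT ballI open_Collect_less continuous_intros) auto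
  show "center \<in> (\<Inter>i. {z. 0 < b i z}) \<inter> {z. 0 < z $ k} \<inter> {z. z $ k < 1}"
    using card_ge_2 by (simp add: b_center) (simp add: center_def)
qed (auto simp: Z_def less_imp_le)

lemma slice_scaling:
  fixes h :: "real ^ 'n \<Rightarrow> real"
  assumes [measurable]: "h \<in> borel_measurable borel" and c: "c > 0"
  shows "(\<integral>x. h x \<partial>lborel) =
    c ^ (CARD('n) - 1) * (\<integral>z. h (\<chi> i. if i = k then z $ k else c * z $ i - 1) \<partial>lborel)"
proof -
  define d where "d j = (if j = axis k 1 then 1 else c)" for j :: "real ^ 'n"
  define t :: "real ^ 'n" where "t = (\<chi> i. if i = k then 0 else -1)"
  define T where "T = (\<lambda>x. t + (\<Sum>j\<in>Basis. (d j * (x \<bullet> j)) *\<^sub>R j))"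
  have Basis: "(Basis :: (real ^ 'n) set) = (\<lambda>i. axis i 1) ` UNIV"
    by (auto simp: Basis_vec_def)
  have inj: "inj (\<lambda>i. axis i (1 :: real) :: real ^ 'n)"
    by (auto simp: inj_on_def axis_eq_axis)
  have "(\<Prod>j\<in>Basis. \<bar>d j\<bar>) = (\<Prod>i\<in>UNIV. if i = k then 1 else c)"
    unfolding Basis using c by (subst prod.reindex[OF inj]) (auto simp: d_def axis_eq_axis intro!: prod.cong)
  also have "\<dots> = (\<Prod>i\<in>UNIV - {k}. c)"
    by (intro prod.mono_neutral_cong_right) auto
  also have "\<dots> = c ^ (CARD('n) - 1)" by (simp add: card_Diff_singleton)
  finally have pr: "(\<Prod>j\<in>Basis. \<bar>d j\<bar>) = c ^ (CARD('n) - 1)" .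
  have T: "T x = (\<chi> i. if i = k then x $ k else c * x $ i - 1)" for x
  proof -
    have "(\<Sum>j\<in>Basis. (d j * (x \<bullet> j)) *\<^sub>R j) = (\<Sum>i\<in>UNIV. (d (axis i 1) * x $ i) *\<^sub>R axis i 1)"
      unfolding Basis by (subst sum.reindex[OF inj]) (simp add: inner_axis)
    then have "(\<Sum>j\<in>Basis. (d j * (x \<bullet> j)) *\<^sub>R j) $ l = d (axis l 1) * x $ l" for l
      by (simp add: axis_def if_distrib cong: if_cong)
    then show ?thesis
      unfolding vec_eq_iff[of "T x"] by (simp add: T_def t_def d_def axis_eq_axis)
  qed
  have [measurable]: "T \<in> borel_measurable borel" unfolding T_def by measurable
  have "(\<integral>x. h x \<partial>lborel) = (\<integral>x. h x \<partial>density (distr lborel borel T) (\<lambda>_. (\<Prod>j\<in>Basis. \<bar>d j\<bar>)))"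
    unfolding T_def using c by (subst lborel_affine_euclidean[of d t]) (auto simp: d_def)
  also have "\<dots> = c ^ (CARD('n) - 1) * (\<integral>z. h (T z) \<partial>lborel)"
    unfolding pr using c by (subst integral_density) (auto simp: integral_distr)
  finally show ?thesis unfolding T .
qed

lemma axis_inner: "x \<bullet> axis k 1 = (x :: real ^ 'n) $ k" "axis k 1 \<bullet> x = x $ k"
  by (simp_all add: inner_axis inner_axis')

text \<open>Integration over the frustum \<open>P\<close> along the lines through its apex, which are the
  lines \<open>t \<mapsto> \<Psi> z t\<close>. The redundant coordinate \<open>z $ k \<in> [0, 1]\<close> avoids a space of
  lower dimension.\<close>

lemma slice_integral:
  assumes F: "continuous_on P F" and t: "-1 \<le> t" "t \<le> 1"
  shows "(\<integral>x. indicator {0..1} (x $ k) * (indicator P (x + (t - x $ k) *\<^sub>R axis k 1) *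
      F (x + (t - x $ k) *\<^sub>R axis k 1)) \<partial>lborel) =
    s t ^ (CARD('n) - 1) * (LINT z:Z|lborel. F (\<Psi> z t))"
proof -
  let ?g = "\<lambda>x. indicator P x * F x"
  note bF = bounded_supported_indicator[OF compact_P F]
  have [measurable]: "?g \<in> borel_measurable borel" by (rule bounded_supported_measurable[OF bF])
  have "(\<integral>x. indicator {0..1} (x $ k) * ?g (x + (t - x $ k) *\<^sub>R axis k 1) \<partial>lborel) =
    s t ^ (CARD('n) - 1) * (\<integral>z. (\<lambda>x. indicator {0..1} (x $ k) * ?g (x + (t - x $ k) *\<^sub>R axis k 1))
      (\<chi> i. if i = k then z $ k else s t * z $ i - 1) \<partial>lborel)"
    using t by (intro slice_scaling s_pos) measurable
  also have "(\<integral>z. (\<lambda>x. indicator {0..1} (x $ k) * ?g (x + (t - x $ k) *\<^sub>R axis k 1))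
      (\<chi> i. if i = k then z $ k else s t * z $ i - 1) \<partial>lborel) = (LINT z:Z|lborel. F (\<Psi> z t))"
    unfolding set_lebesgue_integral_def
  proof (intro Bochner_Integration.integral_cong refl)
    fix z :: "real ^ 'n"
    let ?x = "\<chi> i. if i = k then z $ k else s t * z $ i - 1"
    have \<Psi>: "?x + (t - ?x $ k) *\<^sub>R axis k 1 = \<Psi> z t"
      by (simp add: vec_eq_iff \<Psi>_def axis_def)
    have "indicator {0..1} (z $ k) * indicator P (\<Psi> z t) = (indicator Z z :: real)"
      using \<Psi>_mem_P[OF t, of z] Z_bounds[of z k] by (auto simp: indicator_def)
    then show "indicator {0..1} (?x $ k) * ?g (?x + (t - ?x $ k) *\<^sub>R axis k 1) = indicator Z z *\<^sub>R F (\<Psi> z t)"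
      unfolding \<Psi> by (simp flip: mult.assoc)
  qed
  finally show ?thesis .
qed

text \<open>Vertical lines over the slab \<open>0 \<le> x $ k \<le> 1\<close> cover \<open>P\<close>
  with total weight 1. Exchanging the integrals fixes the height t and leaves a slice with one free
  coordinate, which \<open>slice_integral\<close> rescales to \<open>Z\<close>; a second exchange
  puts the apex lines inside.\<close>

lemma radial_integral:
  assumes F: "continuous_on P F"
  shows "(LINT x:P|lborel. F x) =
    (LINT z:Z|lborel. (LINT t:{-1..1}|lborel. s t ^ (CARD('n) - 1) * F (\<Psi> z t)))"
proof -
  let ?g = "\<lambda>x. indicator P x * F x" and ?e = "axis k (1::real)"
  note bF = bounded_supported_indicator[OF compact_P F]
  have [measurable]: "?g \<in> borel_measurable borel" by (rule bounded_supported_measurable[OF bF])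
  obtain B R where B: "\<And>x. \<bar>?g x\<bar> \<le> B" and R: "\<And>x. ?g x \<noteq> 0 \<Longrightarrow> norm x \<le> R"
    using bF by (auto simp: bounded_supported_def)
  let ?G = "\<lambda>x t. indicator {0..1} (x $ k) * ?g (x + (t - x $ k) *\<^sub>R ?e)"
  have zero: "?G x t = 0" if "t \<notin> {-1..1}" for x t
    using that by (auto simp: P_iff)
  have "norm (x, t) \<le> R + 3" if "?G x t \<noteq> 0" for x t
  proof -
    have t: "\<bar>t\<bar> \<le> 1" using zero[of t x] that by (auto simp: abs_le_iff) 
    have x: "0 \<le> x $ k" "x $ k \<le> 1" using that by (auto simp: indicator_def split: if_splits)
    have r: "norm (x + (t - x $ k) *\<^sub>R ?e) \<le> R"
      using that by (intro R) simp
    have "norm x = norm ((x + (t - x $ k) *\<^sub>R ?e) - (t - x $ k) *\<^sub>R ?e)" by simp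
    also have "\<dots> \<le> norm (x + (t - x $ k) *\<^sub>R ?e) + norm ((t - x $ k) *\<^sub>R ?e)" by (rule norm_triangle_ineq4)
    also have "\<dots> \<le> R + 2" using r t x by (simp add: norm_axis_1)
    finally show ?thesis using norm_Pair_le[of x t] t by simp
  qed
  moreover have "0 \<le> B" using B[of 0] abs_ge_zero order_trans by blast
  then have "\<bar>?G x t\<bar> \<le> B" for x t
    using B[of "x + (t - x $ k) *\<^sub>R ?e"] by (auto simp: indicator_def abs_mult)
  moreover have "(\<lambda>(x, t). ?G x t) \<in> borel_measurable borel"
  proof -
    have "(\<lambda>p. ?g (fst p + (snd p - fst p \<bullet> ?e) *\<^sub>R ?e)) \<in> borel_measurable (borel \<Otimes>\<^sub>M borel)"
      by (rule measurable_compose[of _ _ borel ?g]) measurable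
    moreover have "(\<lambda>p. indicat_real {0..1} (fst p \<bullet> ?e)) \<in> borel_measurable (borel \<Otimes>\<^sub>M borel)"
      by measurable
    ultimately show ?thesis
      unfolding borel_prod[symmetric] case_prod_beta axis_inner by (rule borel_measurable_times[rotated])
  qed
  ultimately have bG: "bounded_supported (\<lambda>(x, t). ?G x t)"
    unfolding bounded_supported_def by (auto simp del: mult_eq_0_iff)
  let ?m = "CARD('n) - 1"
  have bH: "bounded_supported (\<lambda>p. indicator (Z \<times> {-1..1}) p * (s (snd p) ^ ?m * F (\<Psi> (fst p) (snd p))))"
  proof (intro bounded_supported_indicator compact_Times compact_Z compact_Icc continuous_intros)
    show "continuous_on (Z \<times> {-1..1}) (\<lambda>p. F (\<Psi> (fst p) (snd p)))"
      by (rule continuous_on_compose2[OF F]) (use \<Psi>_mem_P in \<open>auto simp: Z_def intro!: continuous_intros\<close>)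
  qed
  have "(LINT x:P|lborel. F x) = (\<integral>x. ?g x \<partial>lborel)"
    by (simp add: set_lebesgue_integral_def)
  also have "\<dots> = (\<integral>x. indicator {0..1} (x $ k) * (\<integral>t. ?g (x + t *\<^sub>R ?e) \<partial>lborel) \<partial>lborel)"
    using integral_slab_lines(1)[OF bF, of ?e ?e 0] by (simp add: axis_inner)
  also have "\<dots> = (\<integral>x. (\<integral>t. ?G x t \<partial>lborel) \<partial>lborel)"
  proof (intro Bochner_Integration.integral_cong refl)
    fix x :: "real ^ 'n"
    have "(\<integral>t. ?g (x + t *\<^sub>R ?e) \<partial>lborel) = (\<integral>t. ?g (x + (t + (- (x $ k))) *\<^sub>R ?e) \<partial>lborel)"
      by (rule lborel_integral_translation[symmetric]) measurable
    then show "indicator {0..1} (x $ k) * (\<integral>t. ?g (x + t *\<^sub>R ?e) \<partial>lborel) = (\<integral>t. ?G x t \<partial>lborel)" by simp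
  qed
  also have "\<dots> = (\<integral>t. (\<integral>x. ?G x t \<partial>lborel) \<partial>lborel)"
    using bounded_supported_Fubini(1)[OF bG] by simp
  also have "\<dots> = (\<integral>t. (\<integral>z. indicator (Z \<times> {-1..1}) (z, t) * (s t ^ ?m * F (\<Psi> z t)) \<partial>lborel) \<partial>lborel)"
  proof (rule Bochner_Integration.integral_cong[OF refl])
    fix t :: real
    show "(\<integral>x. ?G x t \<partial>lborel) = (\<integral>z. indicator (Z \<times> {-1..1}) (z, t) * (s t ^ ?m * F (\<Psi> z t)) \<partial>lborel)"
    proof (cases "t \<in> {-1..1}")
      case True
      then have "(\<integral>x. ?G x t \<partial>lborel) = s t ^ ?m * (LINT z:Z|lborel. F (\<Psi> z t))"
        using slice_integral[OF F, of t] by simp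
      also have "\<dots> = (\<integral>z. s t ^ ?m * (indicator Z z *\<^sub>R F (\<Psi> z t)) \<partial>lborel)"
        unfolding set_lebesgue_integral_def by (rule Bochner_Integration.integral_mult_right_zero[symmetric])
      also have "\<dots> = (\<integral>z. indicator (Z \<times> {-1..1}) (z, t) * (s t ^ ?m * F (\<Psi> z t)) \<partial>lborel)"
        using True by (intro Bochner_Integration.integral_cong refl) (simp add: indicator_def)
      finally show ?thesis .
    next
      case False
      then have "?G x t = 0" for x by (rule zero)
      moreover have "indicator (Z \<times> {-1..1}) (z, t) = (0 :: real)" for z using False by simp
      ultimately show ?thesis by (simp only: mult_zero_left)
    qed
  qed
  also have "\<dots> = (\<integral>z. (\<integral>t. indicator (Z \<times> {-1..1}) (z, t) * (s t ^ ?m * F (\<Psi> z t)) \<partial>lborel) \<partial>lborel)"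
    using bounded_supported_Fubini(1)[OF bH] by simp
  also have "\<dots> = (LINT z:Z|lborel. (LINT t:{-1..1}|lborel. s t ^ (CARD('n) - 1) * F (\<Psi> z t)))"
    unfolding set_lebesgue_integral_def
    by (intro Bochner_Integration.integral_cong refl) (auto simp: indicator_def)
  finally show ?thesis .
qed

lemma radial_integrable:
  assumes F: "continuous_on P F"
  shows "integrable lborel (\<lambda>z. indicator Z z * (LINT t:{-1..1}|lborel. s t ^ (CARD('n) - 1) * F (\<Psi> z t)))"
proof -
  let ?m = "CARD('n) - 1"
  have "bounded_supported (\<lambda>p. indicator (Z \<times> {-1..1}) p * (s (snd p) ^ ?m * F (\<Psi> (fst p) (snd p))))"
  proof (intro bounded_supported_indicator compact_Times compact_Z compact_Icc continuous_intros)
    show "continuous_on (Z \<times> {-1..1}) (\<lambda>p. F (\<Psi> (fst p) (snd p)))"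
      by (rule continuous_on_compose2[OF F]) (use \<Psi>_mem_P in \<open>auto simp: Z_def intro!: continuous_intros\<close>)
  qed
  from bounded_supported_Fubini(2)[OF this]
  have "integrable lborel (\<lambda>z. \<integral>t. indicator (Z \<times> {-1..1}) (z, t) * (s t ^ ?m * F (\<Psi> z t)) \<partial>lborel)" by simp
  moreover have "(\<integral>t. indicator (Z \<times> {-1..1}) (z, t) * (s t ^ ?m * F (\<Psi> z t)) \<partial>lborel) =
      indicator Z z * (LINT t:{-1..1}|lborel. s t ^ ?m * F (\<Psi> z t))" for z
    unfolding set_lebesgue_integral_def by (auto simp: indicator_def intro!: Bochner_Integration.integral_cong)
  ultimately show ?thesis by simp
qed

lemma face_integral_end:
  assumes F: "continuous_on P F" and \<epsilon>: "\<epsilon> = 1 \<or> \<epsilon> = -1"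
  shows "face_integral (- \<epsilon> *\<^sub>R axis k 1) F = s \<epsilon> ^ (CARD('n) - 1) * (LINT z:Z|lborel. F (\<Psi> z \<epsilon>))"
proof -
  let ?e = "axis k (1::real)" and ?u = "- \<epsilon> *\<^sub>R axis k (1::real)"
  let ?g = "\<lambda>x. indicator P x * F x"
  let ?K = "\<lambda>x. indicator (face ?u) (x + (\<epsilon> - x $ k) *\<^sub>R ?e) * F (x + (\<epsilon> - x $ k) *\<^sub>R ?e)"
  have \<epsilon>\<epsilon>: "\<epsilon> * \<epsilon> = 1" using \<epsilon> by auto
  have uv: "?u \<bullet> ?u = 1" using \<epsilon>\<epsilon> by (simp add: axis_inner)
  have p: "x - (x \<bullet> ?u + 1) *\<^sub>R ?u = x + (\<epsilon> - x $ k) *\<^sub>R ?e" for x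
    using \<epsilon> by (auto simp: axis_inner algebra_simps)
  have face: "x + (\<epsilon> - x $ k) *\<^sub>R ?e \<in> face ?u \<longleftrightarrow> x + (\<epsilon> - x $ k) *\<^sub>R ?e \<in> P" for x
    using \<epsilon>\<epsilon> by (auto simp: face_def axis_inner)
  have K: "?K x = ?g (x + (\<epsilon> - x $ k) *\<^sub>R ?e)" for x
    using face by (simp add: indicator_def)
  have "face_integral ?u F = (\<integral>x. indicator {-1..0} (x \<bullet> ?u) * ?K x \<partial>lborel)"
    using face_integral_eq[OF F uv] unfolding p .
  also have "\<dots> = (\<integral>x. indicator {0..1} (x $ k) * ?K x \<partial>lborel)"
  proof (cases "\<epsilon> = 1")
    case True
    then have "indicator {-1..0} (x \<bullet> ?u) = (indicator {0..1} (x $ k) :: real)" for x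
      by (auto simp: indicator_def axis_inner)
    then show ?thesis by simp
  next
    case False
    then have \<epsilon>: "\<epsilon> = -1" using \<epsilon> by simp
    \<comment> \<open>The slab of this normal is \<open>-1 \<le> x $ k \<le> 0\<close>. The
      integrand depends only on the projection to height \<epsilon>, so the slab can be moved to
      \<open>0 \<le> x $ k \<le> 1\<close>, as \<open>slice_integral\<close> requires.\<close>
    have bs: "bounded_supported (\<lambda>x. indicator {-1..-1+1} (x \<bullet> ?e) * ?K x)"
      using bounded_supported_face_slab[OF F, of ?u ?u] unfolding p by (simp add: \<epsilon>)
    have "(\<integral>x. indicator {-1..-1+1} (x \<bullet> ?e) * ?K x \<partial>lborel) =
      (\<integral>x. indicator {-1..-1+1} (x \<bullet> (- ?e)) * ?K x \<partial>lborel)"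
      by (rule integral_slab_line_invariant[OF bs, of ?e]) (simp_all add: axis_inner algebra_simps)
    moreover have "indicator {-1..0} (- (x $ k)) = (indicator {0..1} (x $ k) :: real)" for x :: "real ^ 'n"
      by (auto simp: indicator_def)
    ultimately show ?thesis by (simp add: \<epsilon> axis_inner)
  qed
  also have "\<dots> = s \<epsilon> ^ (CARD('n) - 1) * (LINT z:Z|lborel. F (\<Psi> z \<epsilon>))"
    unfolding K using slice_integral[OF F, of \<epsilon>] \<epsilon> by auto
  finally show ?thesis .
qed

end

section \<open>The one-dimensional functional\<close>

lemma convex_on_three_points:
  fixes \<phi> :: "real \<Rightarrow> real"
  assumes c: "convex_on UNIV \<phi>" and uvw: "u \<le> v" "v \<le> w"
  shows "(w - u) * \<phi> v \<le> (w - v) * \<phi> u + (v - u) * \<phi> w"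
proof (cases "u = w")
  case False
  with uvw have uw: "u < w" by simp
  define r where "r = (v - u) / (w - u)"
  have r: "0 \<le> r" "r \<le> 1" "(w - u) * r = v - u" "(w - u) * (1 - r) = w - v"
    using uvw uw by (auto simp: r_def field_simps)
  have "v = (1 - r) * u + r * w" using r(3) by algebra
  then have "\<phi> v \<le> (1 - r) * \<phi> u + r * \<phi> w"
    using convex_onD[OF c, of r u w] r by simp
  then have "(w - u) * \<phi> v \<le> (w - u) * ((1 - r) * \<phi> u + r * \<phi> w)"
    using uw by (intro mult_left_mono) auto
  also have "\<dots> = ((w - u) * (1 - r)) * \<phi> u + ((w - u) * r) * \<phi> w" by (simp add: algebra_simps)
  finally show ?thesis unfolding r .
qed (use uvw in auto)

text \<open>Equality in the chord inequality at the interior point p makes \<phi> affine on [u, w],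
  and a nonnegative affine function with an interior zero vanishes. Concretely, convexity between
  \<tau> and one end, inserted into \<open>col\<close>, bounds a positive combination of \<phi> u
  and \<phi> w by 0.\<close>

lemma convex_on_zero_segment:
  fixes \<phi> :: "real \<Rightarrow> real"
  assumes c: "convex_on UNIV \<phi>" and nn: "\<And>x. \<phi> x \<ge> 0"
    and col: "(w - u) * \<phi> p = (w - p) * \<phi> u + (p - u) * \<phi> w" and up: "u < p" "p < w"
    and \<tau>: "u < \<tau>" "\<tau> < w" "\<phi> \<tau> = 0"
  shows "\<phi> u = 0" "\<phi> w = 0"
proof -
  have "\<phi> u = 0 \<and> \<phi> w = 0"
  proof (cases "\<tau> \<le> p")
    case True
    have "(w - \<tau>) * \<phi> p \<le> (p - \<tau>) * \<phi> w"
      using convex_on_three_points[OF c True, of w] up \<tau> by simp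
    then have "(w - u) * ((w - \<tau>) * \<phi> p) \<le> (w - u) * ((p - \<tau>) * \<phi> w)"
      using up by (intro mult_left_mono) auto
    moreover have "(w - u) * ((w - \<tau>) * \<phi> p) = (w - \<tau>) * ((w - p) * \<phi> u + (p - u) * \<phi> w)"
      unfolding col[symmetric] by simp
    ultimately have "(w - \<tau>) * (w - p) * \<phi> u + (\<tau> - u) * (w - p) * \<phi> w \<le> 0"
      by (simp add: algebra_simps)
    moreover have "0 \<le> (w - \<tau>) * (w - p) * \<phi> u" "0 \<le> (\<tau> - u) * (w - p) * \<phi> w"
      using up \<tau> nn by auto
    ultimately have "(w - \<tau>) * (w - p) * \<phi> u = 0" "(\<tau> - u) * (w - p) * \<phi> w = 0" by linarith+
    then show ?thesis using up \<tau> by simp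
  next
    case False
    then have "p \<le> \<tau>" by simp
    then have "(\<tau> - u) * \<phi> p \<le> (\<tau> - p) * \<phi> u"
      using convex_on_three_points[OF c, of u p \<tau>] up \<tau> by simp
    then have "(w - u) * ((\<tau> - u) * \<phi> p) \<le> (w - u) * ((\<tau> - p) * \<phi> u)"
      using up by (intro mult_left_mono) auto
    moreover have "(w - u) * ((\<tau> - u) * \<phi> p) = (\<tau> - u) * ((w - p) * \<phi> u + (p - u) * \<phi> w)"
      unfolding col[symmetric] by simp
    ultimately have "(p - u) * (w - \<tau>) * \<phi> u + (\<tau> - u) * (p - u) * \<phi> w \<le> 0"
      by (simp add: algebra_simps)
    moreover have "0 \<le> (p - u) * (w - \<tau>) * \<phi> u" "0 \<le> (\<tau> - u) * (p - u) * \<phi> w"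
      using up \<tau> nn by auto
    ultimately have "(p - u) * (w - \<tau>) * \<phi> u = 0" "(\<tau> - u) * (p - u) * \<phi> w = 0" by linarith+
    then show ?thesis using up \<tau> by simp
  qed
  then show "\<phi> u = 0" "\<phi> w = 0" by auto
qed

lemma has_integral_real_derivative:
  fixes F G :: "real \<Rightarrow> real"
  assumes "a \<le> b" "\<And>t. (F has_real_derivative G t) (at t within {a..b})"
  shows "(G has_integral F b - F a) {a..b}"
  using assms
  by (intro fundamental_theorem_of_calculus) (auto simp flip: has_real_derivative_iff_has_vector_derivative)

text \<open>\<open>\<theta>(x) = \<alpha> x\<^sub>k + \<beta>\<close> is going to be the potential of the extremal vector field.\<close>

locale extremal_bundle = proj_bundle k a for k :: "'n::finite" and a :: int +
  fixes \<alpha> \<beta> :: real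
  assumes moment_0: "((\<lambda>t. (\<alpha> * t + \<beta>) * s t ^ (CARD('n) - 1)) has_integral 0) {-1..1}"
    and moment_1: "((\<lambda>t. t * (1 - (\<alpha> * t + \<beta>)) * s t ^ (CARD('n) - 1)) has_integral 0) {-1..1}"
    and \<alpha>_pos: "\<alpha> > 0"
    and left_pos: "real CARD('n) * (real CARD('n) - 1) > (real CARD('n) - \<alpha> + \<beta>) * s (-1)"
    and right_neg: "real CARD('n) * (real CARD('n) - 1) < (real CARD('n) + \<alpha> + \<beta>) * s 1"
    and right_gt_1: "\<alpha> + \<beta> > 1"
begin

text \<open>\<open>q / s\<close> is the density left when the trapezoid term n (n - 1) / s is set
  against n + \<theta>. The assumptions \<open>left_pos\<close> and \<open>right_neg\<close> say
  that q is positive at -1 and negative at 1.\<close>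

definition q :: "real \<Rightarrow> real" where
  "q t = real CARD('n) * (real CARD('n) - 1) - (real CARD('n) + \<alpha> * t + \<beta>) * s t"

definition m :: nat where "m = CARD('n) - 1"

lemma m_pos: "m > 0" "real m = real CARD('n) - 1" "s t ^ m = s t * s t ^ (m - 1)"
proof -
  show "m > 0" "real m = real CARD('n) - 1" using card_ge_2 by (simp_all add: m_def of_nat_diff)
  then show "s t ^ m = s t * s t ^ (m - 1)" using power_Suc[of "s t" "m - 1"] by simp
qed

text \<open>\<open>q\<close> is a quadratic with leading coefficient - \<alpha> a; the last term is
  its exact deviation from the chord.\<close>

lemma q_concave: "(w - u) * q v = (w - v) * q u + (v - u) * q w + \<alpha> * of_int a * ((w - v) * (v - u) * (w - u))"
  unfolding q_def s_def by algebra

text \<open>By concavity \<open>q\<close> lies above its chord from -1 to a root, and beyond the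
  root below the same line prolonged; since q (-1) > 0 this fixes both signs.\<close>

lemma q_root: "\<exists>p. -1 < p \<and> p < 1 \<and> (\<forall>t\<in>{-1..p}. 0 \<le> q t) \<and> (\<forall>t\<in>{p..1}. q t \<le> 0)"
proof -
  have l: "q (-1) > 0" and r: "q 1 < 0" using left_pos right_neg by (auto simp: q_def)
  have "\<exists>p\<ge>-1. p \<le> 1 \<and> q p = 0"
    using l r by (intro IVT2') (auto simp: q_def s_def intro!: continuous_intros)
  then obtain p where p: "-1 \<le> p" "p \<le> 1" "q p = 0" by blast
  with l r have p': "-1 < p" "p < 1" by (auto simp: order_le_less)
  have "0 \<le> q t" if "t \<in> {-1..p}" for t
  proof -
    have "0 \<le> (p - t) * q (-1) + \<alpha> * of_int a * ((p - t) * (t - (-1)) * (p - (-1)))"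
      using that l p' \<alpha>_pos a by (intro add_nonneg_nonneg mult_nonneg_nonneg) auto
    then have "0 \<le> (p - (-1)) * q t" using q_concave[of p "-1" t] p by simp
    then show ?thesis using p' by (simp add: zero_le_mult_iff)
  qed
  moreover have "q t \<le> 0" if "t \<in> {p..1}" for t
  proof -
    have "0 \<le> (t - p) * q (-1) + \<alpha> * of_int a * ((t - p) * (p - (-1)) * (t - (-1)))"
      using that l p' \<alpha>_pos a by (intro add_nonneg_nonneg mult_nonneg_nonneg) auto
    then have "(p - (-1)) * q t \<le> 0" using q_concave[of t "-1" p] p by simp
    then show ?thesis using p' by (simp add: mult_le_0_iff)
  qed
  ultimately show ?thesis using p' by blast
qed

definition p :: real where
  "p = (SOME p. -1 < p \<and> p < 1 \<and> (\<forall>t\<in>{-1..p}. 0 \<le> q t) \<and> (\<forall>t\<in>{p..1}. q t \<le> 0))"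

lemma p: "-1 < p" "p < 1" "t \<in> {-1..p} \<Longrightarrow> 0 \<le> q t" "t \<in> {p..1} \<Longrightarrow> q t \<le> 0"
  using someI_ex[OF q_root] unfolding p_def[symmetric] by auto

section \<open>Moments of the density and the one-dimensional inequality\<close>

lemma s_power_deriv: "((\<lambda>t. s t ^ m) has_real_derivative (real CARD('n) - 1) * s t ^ (m - 1) * of_int a) (at t within A)"
proof -
  have "(s has_real_derivative of_int a) (at t within A)"
    unfolding s_def by (auto intro!: derivative_eq_intros)
  then show ?thesis
    using DERIV_power[of s "of_int a" t A m] m_pos(2) by (simp add: mult_ac)
qed

text \<open>Together with \<open>density_moment_1\<close> this says that the density and the point
  masses \<open>s 1 ^ m\<close> at 1 and \<open>s (-1) ^ m\<close> at -1 annihilate 1 and t.\<close>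

lemma density_moment_0: "((\<lambda>t. q t * s t ^ (m - 1)) has_integral - (s 1 ^ m + s (-1) ^ m)) {-1..1}"
proof -
  have "((\<lambda>t. real CARD('n) * s t ^ m - real CARD('n) * (real CARD('n) - 1) * s t ^ (m - 1))
      has_integral (1 * s 1 ^ m - (-1) * s (-1) ^ m)) {-1..1}"
  proof (rule has_integral_real_derivative[where F = "\<lambda>t. t * s t ^ m"])
    fix t :: real
    \<comment> \<open>Since a t = s - n, the derivative of t s^m is a combination of s^m and
      s^(m-1). Its negative is the part of the density without \<theta>, and \<open>moment_0\<close>
      accounts for the rest.\<close>
    have "real CARD('n) * s t ^ m - real CARD('n) * (real CARD('n) - 1) * s t ^ (m - 1) =
      1 * s t ^ m + (real CARD('n) - 1) * s t ^ (m - 1) * of_int a * t"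
    proof -
      define r where "r = s t ^ (m - 1)"
      have "of_int a * t = s t - real CARD('n)" by (simp add: s_def)
      then show ?thesis unfolding m_pos(3) r_def[symmetric] by algebra
    qed
    then show "((\<lambda>t. t * s t ^ m) has_real_derivative
        real CARD('n) * s t ^ m - real CARD('n) * (real CARD('n) - 1) * s t ^ (m - 1)) (at t within {-1..1})"
      using DERIV_mult[OF DERIV_ident s_power_deriv] by simp
  qed simp
  from has_integral_add[OF has_integral_neg[OF this] has_integral_neg[OF moment_0[folded m_def]]]
  show ?thesis
    by (rule has_integral_eq_rhs[OF has_integral_eq[rotated]])
       (auto simp: q_def m_pos(3) algebra_simps)
qed

lemma density_moment_1: "((\<lambda>t. q t * s t ^ (m - 1) * t) has_integral - (s 1 ^ m - s (-1) ^ m)) {-1..1}"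
proof -
  have "((\<lambda>t. (real CARD('n) + 1) * (t * s t ^ m) - real CARD('n) * (real CARD('n) - 1) * (t * s t ^ (m - 1)))
      has_integral (1\<^sup>2 * s 1 ^ m - (-1)\<^sup>2 * s (-1) ^ m)) {-1..1}"
  proof (rule has_integral_real_derivative[where F = "\<lambda>t. t\<^sup>2 * s t ^ m"])
    fix t :: real
    \<comment> \<open>The coefficient is now n + 1 instead of n; the surplus t s^m is what turns -
      \<theta> into the 1 - \<theta> of \<open>moment_1\<close>.\<close>
    have "(real CARD('n) + 1) * (t * s t ^ m) - real CARD('n) * (real CARD('n) - 1) * (t * s t ^ (m - 1)) =
      2 * t * s t ^ m + (real CARD('n) - 1) * s t ^ (m - 1) * of_int a * t\<^sup>2"
    proof -
      define r where "r = s t ^ (m - 1)"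
      have "of_int a * t = s t - real CARD('n)" by (simp add: s_def)
      then show ?thesis unfolding m_pos(3) r_def[symmetric] by algebra
    qed
    moreover have "((\<lambda>t. t\<^sup>2) has_real_derivative 2 * t) (at t within {-1..1})"
      by (auto intro!: derivative_eq_intros)
    ultimately show "((\<lambda>t. t\<^sup>2 * s t ^ m) has_real_derivative
        (real CARD('n) + 1) * (t * s t ^ m) - real CARD('n) * (real CARD('n) - 1) * (t * s t ^ (m - 1)))
        (at t within {-1..1})"
      using DERIV_mult[OF _ s_power_deriv, of "\<lambda>t. t\<^sup>2" "2 * t" t "{-1..1}"] by simp
  qed simp
  from has_integral_add[OF has_integral_neg[OF this] moment_1[folded m_def]]
  show ?thesis
    by (rule has_integral_eq_rhs[OF has_integral_eq[rotated]])
       (auto simp: q_def m_pos(3) algebra_simps)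
qed

text \<open>Twice the deviation of \<phi> at \<open>p\<close> from the chord over [-1, 1]. It is the
  counterpart of \<open>defect\<close> on the lines through the apex: if it is 0, a convex \<phi> is
  affine on [-1, 1].\<close>

definition gap :: "(real \<Rightarrow> real) \<Rightarrow> real" where
  "gap \<phi> = (1 - p) * \<phi> (-1) + (1 + p) * \<phi> 1 - 2 * \<phi> p"

lemma gap_nonneg: "convex_on UNIV \<phi> \<Longrightarrow> gap \<phi> \<ge> 0"
  using convex_on_three_points[of \<phi> "-1" p 1] p(1,2) by (simp add: gap_def add.commute[of 1 p])

text \<open>Besides the positive point masses at \<open>\<plusminus>1\<close>, the density \<open>q s\<^sup>m\<^sup>-\<^sup>1\<close> is nonnegative left of
  \<open>p\<close> and nonpositive right of it. So subtracting the chord of \<open>\<phi>\<close> over \<open>[p, 1]\<close>, which the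
  functional annihilates, makes every contribution nonnegative.\<close>

lemma one_dim_functional:
  assumes \<phi>: "convex_on UNIV \<phi>"
  shows "s (-1) ^ m * gap \<phi> / (1 - p) \<le>
    s 1 ^ m * \<phi> 1 + s (-1) ^ m * \<phi> (-1) + integral {-1..1} (\<lambda>t. q t * s t ^ (m - 1) * \<phi> t)"
proof -
  define B where "B = (\<phi> 1 - \<phi> p) / (1 - p)"
  define A where "A = \<phi> 1 - B"
  have cont: "continuous_on {-1..1} (\<lambda>t. q t * s t ^ (m - 1) * \<phi> t)"
    unfolding q_def using continuous_on_subset[OF convex_on_continuous[OF open_UNIV \<phi>] subset_UNIV]
    by (intro continuous_intros) auto
  have ch: "(1 - p) * (\<phi> t - (A + B * t)) = (1 - p) * \<phi> t - (1 - t) * \<phi> p - (t - p) * \<phi> 1" for t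
  proof -
    have "(1 - p) * B = \<phi> 1 - \<phi> p" using p(1,2) by (simp add: B_def)
    then show ?thesis unfolding A_def by algebra
  qed
  note p12 = p(1,2)
  have nn: "0 \<le> q t * s t ^ (m - 1) * (\<phi> t - (A + B * t))" if t: "t \<in> {-1..1}" for t
  proof (cases "t \<le> p")
    case True
    have "0 \<le> (1 - p) * (\<phi> t - (A + B * t))"
      using convex_on_three_points[OF \<phi> True, of 1] p(1,2) unfolding ch by (simp add: algebra_simps)
    then have "0 \<le> \<phi> t - (A + B * t)" using p12 by (simp add: zero_le_mult_iff)
    then show ?thesis
      using p(3)[of t] t True s_pos[of t] by (intro mult_nonneg_nonneg) auto
  next
    case False
    then have tp: "p \<le> t" by simp
    have "(1 - p) * (\<phi> t - (A + B * t)) \<le> 0"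
      using convex_on_three_points[OF \<phi> tp, of 1] t unfolding ch by simp
    then have "\<phi> t - (A + B * t) \<le> 0" using p12 by (simp add: mult_le_0_iff)
    moreover have "q t * s t ^ (m - 1) \<le> 0"
      using p(4)[of t] t tp s_pos[of t] by (intro mult_nonpos_nonneg) auto
    ultimately show ?thesis by (rule mult_nonpos_nonpos[rotated])
  qed
  have "((\<lambda>t. q t * s t ^ (m - 1) * \<phi> t - (A * (q t * s t ^ (m - 1)) + B * (q t * s t ^ (m - 1) * t)))
    has_integral integral {-1..1} (\<lambda>t. q t * s t ^ (m - 1) * \<phi> t) -
      (A * - (s 1 ^ m + s (-1) ^ m) + B * - (s 1 ^ m - s (-1) ^ m))) {-1..1}"
    by (intro has_integral_diff has_integral_add has_integral_mult_right density_moment_0 density_moment_1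
      integrable_integral integrable_continuous_real cont)
  then have "0 \<le> integral {-1..1} (\<lambda>t. q t * s t ^ (m - 1) * \<phi> t) -
      (A * - (s 1 ^ m + s (-1) ^ m) + B * - (s 1 ^ m - s (-1) ^ m))"
    by (rule has_integral_nonneg) (use nn in \<open>simp add: algebra_simps\<close>)
  also have "\<dots> = integral {-1..1} (\<lambda>t. q t * s t ^ (m - 1) * \<phi> t) + s 1 ^ m * (A + B) + s (-1) ^ m * (A - B)"
    by (simp add: algebra_simps)
  also have "A + B = \<phi> 1" by (simp add: A_def)
  \<comment> \<open>At -1 the prolonged chord lies below \<phi> by
    \<open>gap \<phi> / (1 - p)\<close>; weighted with \<open>s (-1) ^ m\<close>, this surplus is
    the left side of the claim.\<close>
  also have "A - B = \<phi> (-1) - gap \<phi> / (1 - p)"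
  proof -
    have "(1 - p) * (\<phi> (-1) - (A - B)) = gap \<phi>"
      using ch[of "-1"] by (simp add: gap_def algebra_simps)
    then show ?thesis using p(1,2) by (simp add: field_simps)
  qed
  finally show ?thesis by (simp add: algebra_simps)
qed

section \<open>Lower bound for the K-functional\<close>

lemma \<Psi>_line: "\<Psi> z t = \<Psi> z 0 + t *\<^sub>R (\<chi> i. if i = k then 1 else of_int a * z $ i)"
  by (simp add: vec_eq_iff \<Psi>_def s_def algebra_simps)

lemma convex_\<Psi>: "convex_on UNIV f \<Longrightarrow> convex_on UNIV (\<lambda>t. f (\<Psi> z t))"
proof -
  have "(\<lambda>t. f (\<Psi> z t)) = (\<lambda>t. f (\<Psi> z 0 + t *\<^sub>R (\<chi> i. if i = k then 1 else of_int a * z $ i)))"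
    by (rule ext, rule arg_cong[where f = f], rule \<Psi>_line)
  then show "convex_on UNIV f \<Longrightarrow> ?thesis" by (simp only: convex_on_line)
qed

text \<open>\<open>K_functional\<close> with facets, normals and potential written out;
  \<open>K_functional_P\<close> identifies the two once these are determined.\<close>

definition K :: "(real ^ 'n \<Rightarrow> real) \<Rightarrow> real" where
  "K f = (\<Sum>i\<in>UNIV. face_integral (U i) f) + face_integral (axis k 1) f + face_integral (- axis k 1) f
    - (LINT x:P|lborel. (real CARD('n) + (\<alpha> * x $ k + \<beta>)) * f x)"

lemma set_integrable_P:
  fixes f :: "real ^ 'n \<Rightarrow> real"
  shows "continuous_on P f \<Longrightarrow> set_integrable lborel P f"
  unfolding set_integrable_def by (intro borel_integrable_compact compact_P)

lemma set_integrable_Z: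
  fixes f :: "real ^ 'n \<Rightarrow> real"
  shows "continuous_on Z f \<Longrightarrow> set_integrable lborel Z f"
  unfolding set_integrable_def by (intro borel_integrable_compact compact_Z)

text \<open>By \<open>lateral_total\<close> the lateral facets leave the integral of (q / s) f over
  \<open>P\<close>. The weight s^m of \<open>radial_integral\<close> turns this into the density q
  s^(m-1) on each apex line, and the two end facets supply the point masses of
  \<open>one_dim_functional\<close>.\<close>

lemma K_lower_bound:
  assumes f: "convex_on UNIV f"
  shows "K f \<ge> (\<Sum>i\<in>UNIV. \<Sum>j\<in>UNIV - {i}. face_integral (U i) (defect f i j)) / 2
    + s (-1) ^ m / (1 - p) * (LINT z:Z|lborel. gap (\<lambda>t. f (\<Psi> z t)))"
proof -
  have cf: "continuous_on UNIV f" by (rule convex_on_continuous[OF open_UNIV f])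
  have cfP: "continuous_on P f" by (rule continuous_on_subset[OF cf subset_UNIV])
  let ?F = "\<lambda>x. q (x $ k) / s (x $ k) * f x"
  have cF: "continuous_on P ?F"
    unfolding q_def by (intro continuous_intros cfP) (auto simp: s_nonzero)
  have c\<Psi>: "continuous_on Z (\<lambda>z. f (\<Psi> z t))" for t
    by (intro continuous_compose[OF cf] continuous_intros)
  note iZ = set_integrable_Z[OF c\<Psi>]
  let ?R = "\<lambda>z. integral {-1..1} (\<lambda>t. q t * s t ^ (m - 1) * f (\<Psi> z t))"
  have R: "(LINT t:{-1..1}|lborel. s t ^ m * ?F (\<Psi> z t)) = ?R z" for z
  proof -
    have "(LINT t:{-1..1}|lborel. s t ^ m * ?F (\<Psi> z t)) =
      (LINT t:{-1..1}|lborel. q t * s t ^ (m - 1) * f (\<Psi> z t))"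
    proof (rule set_lebesgue_integral_cong)
      show "\<forall>t. t \<in> {-1..1} \<longrightarrow> s t ^ m * ?F (\<Psi> z t) = q t * s t ^ (m - 1) * f (\<Psi> z t)"
        using s_pos by (fastforce simp: m_pos(3))
    qed simp
    also have "\<dots> = ?R z"
      unfolding q_def
      by (intro set_borel_integral_eq_integral(2), unfold set_integrable_def)
         (intro borel_integrable_compact continuous_intros continuous_compose[OF cf] compact_Icc)
    finally show ?thesis .
  qed
  have iR: "set_integrable lborel Z ?R"
    using radial_integrable[OF cF, folded m_def] unfolding R set_integrable_def by simp
  have eq: "(LINT x:P|lborel. ?F x) = (LINT z:Z|lborel. ?R z)"
    using radial_integral[OF cF, folded m_def] unfolding R .
  have "(LINT x:P|lborel. ?F x) = (LINT x:P|lborel. real CARD('n) * (real CARD('n) - 1) * (f x / s (x $ k))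
      - (real CARD('n) + (\<alpha> * x $ k + \<beta>)) * f x)"
  proof (rule set_lebesgue_integral_cong)
    show "\<forall>x. x \<in> P \<longrightarrow> ?F x = real CARD('n) * (real CARD('n) - 1) * (f x / s (x $ k))
      - (real CARD('n) + (\<alpha> * x $ k + \<beta>)) * f x"
      using s_nonzero by (simp add: q_def field_simps)
  qed (use closed_P in simp)
  also have "\<dots> = real CARD('n) * (real CARD('n) - 1) * (LINT x:P|lborel. f x / s (x $ k))
    - (LINT x:P|lborel. (real CARD('n) + (\<alpha> * x $ k + \<beta>)) * f x)"
    unfolding set_integral_mult_right[symmetric]
    by (intro set_integral_diff(2) set_integrable_P continuous_intros cfP) (auto simp: s_nonzero)
  finally have "K f \<ge> (\<Sum>i\<in>UNIV. \<Sum>j\<in>UNIV - {i}. face_integral (U i) (defect f i j)) / 2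
      + face_integral (axis k 1) f + face_integral (- axis k 1) f + (LINT z:Z|lborel. ?R z)"
    using lateral_total[OF f] eq unfolding K_def by linarith
  moreover have "face_integral (axis k 1) f = (LINT z:Z|lborel. s (-1) ^ m * f (\<Psi> z (-1)))"
    "face_integral (- axis k 1) f = (LINT z:Z|lborel. s 1 ^ m * f (\<Psi> z 1))"
    using face_integral_end[OF cfP, of "-1", folded m_def] face_integral_end[OF cfP, of 1, folded m_def] by simp_all
  moreover have "(LINT z:Z|lborel. s (-1) ^ m / (1 - p) * gap (\<lambda>t. f (\<Psi> z t))) \<le>
    (LINT z:Z|lborel. s 1 ^ m * f (\<Psi> z 1) + s (-1) ^ m * f (\<Psi> z (-1)) + ?R z)"
  proof (rule set_integral_mono)
    show "set_integrable lborel Z (\<lambda>z. s (-1) ^ m / (1 - p) * gap (\<lambda>t. f (\<Psi> z t)))"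
      unfolding gap_def by (intro set_integrable_Z continuous_intros c\<Psi>)
    show "set_integrable lborel Z (\<lambda>z. s 1 ^ m * f (\<Psi> z 1) + s (-1) ^ m * f (\<Psi> z (-1)) + ?R z)"
      by (intro set_integral_add iR set_integrable_Z continuous_intros c\<Psi>)
    show "s (-1) ^ m / (1 - p) * gap (\<lambda>t. f (\<Psi> z t)) \<le>
       s 1 ^ m * f (\<Psi> z 1) + s (-1) ^ m * f (\<Psi> z (-1)) + ?R z" for z
      using one_dim_functional[OF convex_\<Psi>[OF f, of z]] by simp
  qed
  moreover have "(LINT z:Z|lborel. s 1 ^ m * f (\<Psi> z 1) + s (-1) ^ m * f (\<Psi> z (-1)) + ?R z) =
    (LINT z:Z|lborel. s 1 ^ m * f (\<Psi> z 1)) + (LINT z:Z|lborel. s (-1) ^ m * f (\<Psi> z (-1))) + (LINT z:Z|lborel. ?R z)"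
  proof -
    have "set_integrable lborel Z (\<lambda>z. s 1 ^ m * f (\<Psi> z 1))" "set_integrable lborel Z (\<lambda>z. s (-1) ^ m * f (\<Psi> z (-1)))"
      by (intro set_integrable_Z continuous_intros c\<Psi>)+
    then show ?thesis
      by (simp only: set_integral_add(2)[OF set_integral_add(1) iR] set_integral_add(2))
  qed
  moreover have "(LINT z:Z|lborel. s (-1) ^ m / (1 - p) * gap (\<lambda>t. f (\<Psi> z t))) =
    s (-1) ^ m / (1 - p) * (LINT z:Z|lborel. gap (\<lambda>t. f (\<Psi> z t)))"
    by (rule set_integral_mult_right)
  ultimately show ?thesis by linarith
qed

end

section \<open>The equality case\<close>

context proj_bundle begin

text \<open>The facet is a null set in space, so \<open>integral_nonneg_eq_0_imp\<close> is applied
  to the solid \<open>R\<close> swept out by the facet along \<open>v\<close>, with the defect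
  extended constantly in that direction.\<close>

lemma face_defect_eq_0:
  assumes f: "convex_on UNIV f" and ij: "i \<noteq> j" and 0: "face_integral (U i) (defect f i j) = 0"
    and x: "x \<in> face (U i)"
  shows "defect f i j x = 0"
proof -
  define v where "v = W i - W j"
  have vk: "v $ k = 0" by (simp add: v_def)
  have uv: "U i \<bullet> v = 1" using W_line[OF ij] by (simp add: v_def)
  have vu: "v \<bullet> U i = 1" using uv by (simp add: inner_commute)
  have y_v: "y l (x + \<tau> *\<^sub>R v) = y l x + (if l = i then \<tau> else if l = j then - \<tau> else 0)" for l x \<tau>
    using ij by (simp add: v_def)
  have cd: "continuous_on P (defect f i j)"
    by (rule continuous_defect[OF convex_on_continuous[OF open_UNIV f]])
  define pr where "pr x = x - (x \<bullet> U i + 1) *\<^sub>R v" for x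
  define R where "R = {x. -1 \<le> x \<bullet> U i \<and> x \<bullet> U i \<le> 0 \<and> pr x \<in> face (U i)}"
  have R_eq: "R = (\<lambda>(x, \<tau>). x + \<tau> *\<^sub>R v) ` (face (U i) \<times> {0..1})"
  proof (intro set_eqI iffI)
    fix x assume "x \<in> R"
    then show "x \<in> (\<lambda>(x, \<tau>). x + \<tau> *\<^sub>R v) ` (face (U i) \<times> {0..1})"
      by (intro image_eqI[of _ _ "(pr x, x \<bullet> U i + 1)"]) (auto simp: R_def pr_def)
  next
    fix x assume "x \<in> (\<lambda>(x, \<tau>). x + \<tau> *\<^sub>R v) ` (face (U i) \<times> {0..1})"
    then obtain z \<tau> where z: "z \<in> face (U i)" "0 \<le> \<tau>" "\<tau> \<le> 1" "x = z + \<tau> *\<^sub>R v" by auto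
    then have "x \<bullet> U i = \<tau> - 1" using vu by (simp add: inner_add_left face_def)
    then show "x \<in> R" using z by (simp add: R_def pr_def)
  qed
  have lin: "linear (\<lambda>(x :: real ^ 'n, \<tau> :: real). x + \<tau> *\<^sub>R v)"
    by (auto simp: linear_iff algebra_simps)
  have "convex (face (U i))"
    unfolding face_def using convex_hyperplane[of "U i" "-1"]
    by (intro convex_Int convex_P) (simp add: inner_commute)
  then have "convex R" unfolding R_eq by (intro convex_linear_image lin convex_Times) auto
  moreover have "compact R"
    unfolding R_eq case_prod_beta
    by (intro compact_continuous_image compact_Times compact_face continuous_intros) auto
  \<comment> \<open>This point has \<open>x \<bullet> U i = -1/2\<close> and projects to -v, in the
    relative interior of the facet: there \<open>y j\<close> is 2 and the remaining facet functions
    are 1.\<close>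
  moreover have "- (1/2) *\<^sub>R v \<in> interior R"
  proof (rule interiorI)
    let ?S = "{x. -1 < x \<bullet> U i} \<inter> {x. x \<bullet> U i < 0} \<inter> (\<Inter>l\<in>UNIV-{i}. {x. 0 < y l (pr x)})
        \<inter> {x. -1 < x $ k} \<inter> {x. x $ k < 1}"
    show "open ?S"
      unfolding pr_def by (intro open_Int open_INT ballI open_Collect_less continuous_intros) auto
    have "(- (1/2) *\<^sub>R v) \<bullet> U i = - (1/2)" using vu by simp
    then have "pr (- (1/2) *\<^sub>R v) = 0 + (-1) *\<^sub>R v"
      unfolding pr_def by (simp add: vec_eq_iff)
    then have "y l (pr (- (1/2) *\<^sub>R v)) = y l 0 + (if l = i then -1 else if l = j then - (-1) else 0)" for l
      by (simp only: y_v)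
    moreover have "y l 0 = 1" for l by (simp add: y_def)
    ultimately show "- (1/2) *\<^sub>R v \<in> ?S" using vu vk by auto
    show "?S \<subseteq> R"
    proof
      fix x assume x: "x \<in> ?S"
      have "y i (pr x) = 0" using vu by (simp add: pr_def y_def inner_diff_left)
      moreover have "\<forall>l\<in>UNIV-{i}. 0 < y l (pr x)" using x by blast
      then have "0 \<le> y l (pr x)" if "l \<noteq> i" for l using that by (simp add: less_imp_le)
      moreover have "pr x $ k = x $ k" using vk by (simp add: pr_def)
      moreover have "-1 < x $ k" "x $ k < 1" using x by auto
      ultimately have "pr x \<in> face (U i)" unfolding mem_face_U P_iff by (metis less_imp_le order_refl)
      then show "x \<in> R" using x by (simp add: R_def)
    qed
  qed
  moreover have "continuous_on R (\<lambda>x. defect f i j (pr x))"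
  proof (rule continuous_on_compose2[OF cd])
    show "continuous_on R pr" unfolding pr_def by (intro continuous_intros)
    show "pr ` R \<subseteq> P" using face_subset by (auto simp: R_def)
  qed
  moreover have "0 \<le> defect f i j (pr x)" if "x \<in> R" for x
    using that face_subset by (intro defect_nonneg[OF f]) (auto simp: R_def)
  moreover have "(LINT x:R|lborel. defect f i j (pr x)) = 0"
  proof -
    have "(LINT x:R|lborel. defect f i j (pr x)) = (\<integral>x. indicator {-1..0} (x \<bullet> U i) *
      (indicator (face (U i)) (pr x) * defect f i j (pr x)) \<partial>lborel)"
      unfolding set_lebesgue_integral_def
      by (intro Bochner_Integration.integral_cong refl) (auto simp: R_def indicator_def)
    then show ?thesis
      using face_integral_eq[OF cd uv] 0 unfolding pr_def by simp
  qed
  moreover have "pr x = x" "x \<in> R" using x by (auto simp: R_def pr_def face_def)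
  ultimately show ?thesis
    using integral_nonneg_eq_0_imp[of R "\<lambda>x. defect f i j (pr x)" x] by auto
qed

definition vert :: "'n \<Rightarrow> real ^ 'n" where "vert j = \<Psi> (W j) 0"

lemma b_W: "b i (W j) = (if i = j then 1 else 0)"
  by (auto simp: b_def W_nth)

lemma y_vert: "y i (vert j) = (if i = j then s 0 else 0)"
  by (simp add: vert_def y_\<Psi> b_W)

lemma y_eqI:
  assumes "x $ k = x' $ k" "\<And>i. i \<noteq> k \<Longrightarrow> y i x = y i x'" shows "x = x'"
  unfolding vec_eq_iff
proof
  fix i show "x $ i = x' $ i" using assms(1) assms(2)[of i] by (cases "i = k") (auto simp: y_def inner_U)
qed

text \<open>Move the barycentric weight of a point in the slice \<open>t = 0\<close> to a single vertex, one
  coordinate at a time.\<close>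

lemma zero_at_vertices:
  assumes h: "convex_on UNIV h" and nn: "\<And>x. h x \<ge> 0"
    and mid: "\<And>i j x. i \<noteq> j \<Longrightarrow> x \<in> face (U i) \<Longrightarrow> y j x > 0 \<Longrightarrow>
      h x + h (x + y j x *\<^sub>R (W i - W j)) = 2 * h (x + (y j x / 2) *\<^sub>R (W i - W j))"
    and "x \<in> P" "x $ k = 0" "h x = 0" "y j x > 0"
  shows "h (vert j) = 0"
  using assms(4-7)
proof (induction "card {l. y l x > 0}" arbitrary: x rule: less_induct)
  case less
  show ?case
  proof (cases "\<exists>l. l \<noteq> j \<and> y l x > 0")
    case False
    then have *: "y l x = 0" if "l \<noteq> j" for l
      using less.prems(1) that unfolding P_iff by (metis order_le_less)
    have "(\<Sum>l\<in>UNIV. y l x) = y j x + (\<Sum>l\<in>UNIV - {j}. y l x)" by (simp add: sum.remove)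
    also have "(\<Sum>l\<in>UNIV - {j}. y l x) = 0" by (intro sum.neutral) (simp add: *)
    finally have "y j x = s 0" using less.prems(2) by (simp add: sum_y)
    then have "x = vert j" using * less.prems(2)
      by (intro y_eqI) (auto simp: y_vert vert_def[symmetric], simp add: vert_def)
    then show ?thesis using less.prems by simp
  next
    case True
    then obtain l where l: "l \<noteq> j" "y l x > 0" by blast
    define v where "v = W j - W l"
    have vk: "v $ k = 0" by (simp add: v_def)
    have y_v: "y i (x + \<tau> *\<^sub>R v) = y i x + (if i = j then \<tau> else if i = l then - \<tau> else 0)" for i x \<tau>
      using l by (simp add: v_def)
    \<comment> \<open>\<open>e\<close> and \<open>e + L *\<^sub>R v\<close> are the ends of the
      chord of \<open>P\<close> through x, where \<open>y j\<close> and \<open>y l\<close> vanish,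
      and x sits strictly between at the parameter \<open>y j x\<close>. At the second end the
      weight of l is gone, so fewer coordinates are positive.\<close>
    define e where "e = x + (- y j x) *\<^sub>R v"
    have ye: "y j e = 0" "y l e = y j x + y l x" "\<And>i. i \<noteq> j \<Longrightarrow> i \<noteq> l \<Longrightarrow> y i e = y i x"
      unfolding e_def y_v using l by auto
    have ek: "e $ k = x $ k" by (simp add: e_def vk)
    have "0 \<le> y i e" for i
      using less.prems(1) ye l(2) less.prems(4) unfolding P_iff
      by (cases "i = j"; cases "i = l") auto
    then have e: "e \<in> face (U j)"
      using ye(1) ek less.prems(1) by (simp add: mem_face_U P_iff)
    define L where "L = y l e"
    let ?\<phi> = "\<lambda>\<tau>. h (e + \<tau> *\<^sub>R v)"
    have L: "L = y j x + y l x" by (simp add: L_def ye)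
    have "h e + h (e + L *\<^sub>R v) = 2 * h (e + (L / 2) *\<^sub>R v)"
      using mid[of j l e] l e ye less.prems(4) unfolding v_def L_def by simp
    then have "2 * ?\<phi> (L / 2) = ?\<phi> 0 + ?\<phi> L" by simp
    moreover have "(L - 0) * ?\<phi> (L / 2) = L / 2 * (2 * ?\<phi> (L / 2))" "L - L / 2 = L / 2" by simp_all
    ultimately have col: "(L - 0) * ?\<phi> (L / 2) = (L - L / 2) * ?\<phi> 0 + (L / 2 - 0) * ?\<phi> L"
      by (simp only: diff_zero distrib_left)
    have "?\<phi> (y j x) = 0" using less.prems(3) by (simp add: e_def)
    from convex_on_zero_segment(2)[OF convex_on_line[OF h] nn col _ _ _ _ this]
    have zero: "h (e + L *\<^sub>R v) = 0"
      using l less.prems(4) L by auto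
    let ?x = "e + L *\<^sub>R v"
    have x: "?x = x + y l x *\<^sub>R v" unfolding e_def L by (simp add: algebra_simps)
    have yx: "y j ?x = y j x + y l x" "y l ?x = 0" "\<And>i. i \<noteq> j \<Longrightarrow> i \<noteq> l \<Longrightarrow> y i ?x = y i x"
      unfolding x y_v using l by auto
    have "0 \<le> y i ?x" for i
      using less.prems(1) yx l(2) less.prems(4) unfolding P_iff
      by (cases "i = j"; cases "i = l") auto
    then have "?x \<in> P" using less.prems(1) vk unfolding x by (simp add: P_iff)
    moreover have "card {i. y i ?x > 0} < card {i. y i x > 0}"
    proof (rule psubset_card_mono)
      have "y i x > 0" if "y i ?x > 0" for i
        using that yx less.prems(4) by (cases "i = j"; cases "i = l") auto
      moreover have "l \<notin> {i. y i ?x > 0}" using yx(2) by simp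
      ultimately show "{i. y i ?x > 0} \<subset> {i. y i x > 0}" using l(2) by blast
    qed simp
    moreover have "?x $ k = 0" using less.prems(2) vk unfolding x by simp
    moreover have "y j ?x > 0" using yx(1) l less.prems(4) by simp
    ultimately show ?thesis using less.hyps zero by blast
  qed
qed

lemma sum_vert:
  assumes "x \<in> P" "x $ k = 0"
  shows "x = (\<Sum>j\<in>UNIV. (y j x / s 0) *\<^sub>R vert j)"
  unfolding vec_eq_iff
proof
  fix i
  have s0: "s 0 \<noteq> 0" using s_pos[of 0] by simp
  show "x $ i = (\<Sum>j\<in>UNIV. (y j x / s 0) *\<^sub>R vert j) $ i"
  proof (cases "i = k")
    case True
    then show ?thesis using assms by (simp add: vert_def)
  next
    case False
    have "vert j $ i = (if j = i then s 0 else 0) - 1" for j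
      using False by (auto simp: vert_def \<Psi>_def W_nth)
    then have "(\<Sum>j\<in>UNIV. (y j x / s 0) *\<^sub>R vert j) $ i =
      (\<Sum>j\<in>UNIV. (if j = i then y j x else 0) - y j x / s 0)"
      using s0 by (auto intro!: sum.cong simp: right_diff_distrib)
    also have "\<dots> = y i x - (\<Sum>j\<in>UNIV. y j x) / s 0"
      by (simp add: sum_subtractf sum_divide_distrib)
    also have "(\<Sum>j\<in>UNIV. y j x) / s 0 = 1" using assms(2) s0 by (simp add: sum_y)
    also have "y i x - 1 = x $ i" using False by (simp add: y_def inner_U)
    finally show ?thesis by simp
  qed
qed

lemma P_is_\<Psi>: "x \<in> P \<Longrightarrow> \<exists>z\<in>Z. x = \<Psi> z (x $ k)"
proof -
  assume x: "x \<in> P"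
  define z where "z = (\<chi> i. if i = k then 0 else y i x / s (x $ k))"
  have "s (x $ k) > 0" using x s_pos[of "x $ k"] by (simp add: P_iff)
  then have s: "s (x $ k) \<noteq> 0" "s (x $ k) > 0" by simp_all
  have eq: "x = \<Psi> z (x $ k)"
    using s by (auto simp: vec_eq_iff \<Psi>_def z_def y_def inner_U)
  moreover have "z \<in> Z"
    using \<Psi>_mem_P[of "x $ k" z] x eq by (simp add: P_iff z_def)
  ultimately show ?thesis by blast
qed

end

context extremal_bundle begin

section \<open>Nonnegativity and vanishing of \<open>K\<close>\<close>

lemma convex_on_affine_fun:
  fixes g :: "real ^ 'n \<Rightarrow> real"
  assumes "affine_fun g" shows "convex_on UNIV g"
proof -
  obtain c d where g: "g = (\<lambda>x. c \<bullet> x + d)" using assms by (auto simp: affine_fun_def)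
  show ?thesis
    unfolding g by (rule convex_onI) (auto simp: inner_add_right algebra_simps)
qed

lemma affine_fun_uminus:
  fixes g :: "real ^ 'n \<Rightarrow> real"
  assumes "affine_fun g" shows "affine_fun (\<lambda>x. - g x)"
proof -
  obtain c d where "g = (\<lambda>x. c \<bullet> x + d)" using assms by (auto simp: affine_fun_def)
  then show ?thesis
    unfolding affine_fun_def by (intro exI[of _ "-c"] exI[of _ "-d"]) simp
qed

lemma K_cong: "(\<And>x. x \<in> P \<Longrightarrow> f x = g x) \<Longrightarrow> K f = K g"
  unfolding K_def using face_subset closed_P
  by (intro arg_cong2[where f = "(-)"] arg_cong2[where f = "(+)"] sum.cong face_integral_cong
      set_lebesgue_integral_cong) auto

lemma K_uminus: "K (\<lambda>x. - f x) = - K f"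
proof -
  have "face_integral u (\<lambda>x. - f x) = - face_integral u f" for u
    using face_integral_cmult[of u "-1" f] by simp
  moreover have "(LINT x:P|lborel. (real CARD('n) + (\<alpha> * x $ k + \<beta>)) * - f x) =
      - (LINT x:P|lborel. (real CARD('n) + (\<alpha> * x $ k + \<beta>)) * f x)"
    using set_integral_mult_right[of lborel P "-1"] by simp
  ultimately show ?thesis unfolding K_def by (simp only: sum_negf)
qed

lemma K_bound_nonneg:
  assumes f: "convex_on UNIV f"
  shows "0 \<le> face_integral (U i) (defect f i j)" "0 \<le> (LINT z:Z|lborel. gap (\<lambda>t. f (\<Psi> z t)))"
proof -
  show "0 \<le> face_integral (U i) (defect f i j)"
    using face_subset by (intro face_integral_nonneg defect_nonneg[OF f]) blast
  show "0 \<le> (LINT z:Z|lborel. gap (\<lambda>t. f (\<Psi> z t)))"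
    unfolding set_lebesgue_integral_def
    by (intro Bochner_Integration.integral_nonneg) (simp add: indicator_def gap_nonneg[OF convex_\<Psi>[OF f]])
qed

lemma gap_factor_pos: "s (-1) ^ m / (1 - p) > 0"
  using p(1,2) s_pos[of "-1"] by simp

lemma K_nonneg:
  assumes f: "convex_on UNIV f" shows "K f \<ge> 0"
proof -
  have "0 \<le> (\<Sum>i\<in>UNIV. \<Sum>j\<in>UNIV - {i}. face_integral (U i) (defect f i j))"
    by (intro sum_nonneg K_bound_nonneg f)
  moreover have "0 \<le> s (-1) ^ m / (1 - p) * (LINT z:Z|lborel. gap (\<lambda>t. f (\<Psi> z t)))"
    using gap_factor_pos by (intro mult_nonneg_nonneg K_bound_nonneg f) simp
  ultimately show ?thesis using K_lower_bound[OF f] by linarith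
qed

text \<open>Both g and - g are convex, so nonnegativity of \<open>K\<close> applies to each.\<close>

lemma K_affine:
  assumes "affine_fun g" shows "K g = 0"
proof -
  show ?thesis
    using K_nonneg[OF convex_on_affine_fun[OF assms]]
      K_nonneg[OF convex_on_affine_fun[OF affine_fun_uminus[OF assms]]] K_uminus[of g] by linarith
qed

lemma K_eq_0_imp:
  assumes f: "convex_on UNIV f" and 0: "K f = 0"
  shows "i \<noteq> j \<Longrightarrow> x \<in> face (U i) \<Longrightarrow> defect f i j x = 0"
    and "z \<in> Z \<Longrightarrow> gap (\<lambda>t. f (\<Psi> z t)) = 0"
proof -
  let ?D = "\<lambda>i j. face_integral (U i) (defect f i j)"
  let ?G = "LINT z:Z|lborel. gap (\<lambda>t. f (\<Psi> z t))"
  have D: "0 \<le> (\<Sum>i\<in>UNIV. \<Sum>j\<in>UNIV - {i}. ?D i j)"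
    by (intro sum_nonneg K_bound_nonneg f)
  moreover have G: "0 \<le> s (-1) ^ m / (1 - p) * ?G"
    using gap_factor_pos by (intro mult_nonneg_nonneg K_bound_nonneg f) simp
  ultimately have D0: "(\<Sum>i\<in>UNIV. \<Sum>j\<in>UNIV - {i}. ?D i j) = 0" and "s (-1) ^ m / (1 - p) * ?G = 0"
    using K_lower_bound[OF f] 0 by linarith+
  then have G0: "?G = 0" using gap_factor_pos unfolding mult_eq_0_iff by linarith
  have "\<forall>i\<in>UNIV. (\<Sum>j\<in>UNIV - {i}. ?D i j) = 0"
    using D0 by (subst (asm) sum_nonneg_eq_0_iff) (auto intro: sum_nonneg K_bound_nonneg f)
  then have "\<forall>j\<in>UNIV - {i}. ?D i j = 0" for i
    by (subst (asm) sum_nonneg_eq_0_iff) (auto intro: K_bound_nonneg f)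
  then show "i \<noteq> j \<Longrightarrow> x \<in> face (U i) \<Longrightarrow> defect f i j x = 0"
    using face_defect_eq_0[OF f] by auto
  show "z \<in> Z \<Longrightarrow> gap (\<lambda>t. f (\<Psi> z t)) = 0"
  proof (rule integral_nonneg_eq_0_imp[OF compact_Z convex_Z _ _ _ G0])
    show "interior Z \<noteq> {}" using center_interior by blast
    show "continuous_on Z (\<lambda>z. gap (\<lambda>t. f (\<Psi> z t)))"
      unfolding gap_def
      by (intro continuous_intros continuous_compose[OF convex_on_continuous[OF open_UNIV f]])
    show "0 \<le> gap (\<lambda>t. f (\<Psi> z t))" for z by (rule gap_nonneg[OF convex_\<Psi>[OF f]])
  qed
qed

text \<open>The affine g contributes nothing to \<open>defect\<close> or \<open>gap\<close>, so h =
  f - g inherits the equalities of f and is nonnegative with h 0 = 0, the setting of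
  \<open>convex_on_zero_segment\<close>.\<close>

lemma K_eq_0_imp_affine:
  assumes f: "convex_on UNIV f" and K: "K f = 0"
    and g: "affine_fun g" "\<And>x. g x \<le> f x" "g 0 = f 0" and x: "x \<in> P"
  shows "f x = g x"
proof -
  obtain c d where gd: "g = (\<lambda>x. c \<bullet> x + d)" using g(1) by (auto simp: affine_fun_def)
  define h where "h x = f x - g x" for x
  have h: "convex_on UNIV h"
    unfolding h_def using convex_on_add[OF f convex_on_affine_fun[OF affine_fun_uminus[OF g(1)]]] by simp
  have nn: "h x \<ge> 0" for x using g(2) by (simp add: h_def)
  have mid: "h x + h (x + y j x *\<^sub>R (W i - W j)) = 2 * h (x + (y j x / 2) *\<^sub>R (W i - W j))"
    if "i \<noteq> j" "x \<in> face (U i)" "y j x > 0" for i j x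
  proof -
    have "s (x $ k) \<noteq> 0" using that s_nonzero by (simp add: mem_face_U)
    then have "f x + f (x + y j x *\<^sub>R (W i - W j)) = 2 * f (x + (y j x / 2) *\<^sub>R (W i - W j))"
      using K_eq_0_imp(1)[OF f K that(1,2)] that(3) by (simp add: defect_def)
    moreover have "g x + g (x + y j x *\<^sub>R (W i - W j)) = 2 * g (x + (y j x / 2) *\<^sub>R (W i - W j))"
      by (simp add: gd inner_add_right)
    ultimately show ?thesis by (simp add: h_def)
  qed
  have "h 0 = 0" using g(3) by (simp add: h_def)
  then have vert: "h (vert j) = 0" for j
    using zero_at_vertices[OF h nn mid zero_in_P] by (simp add: y_def)
  have slice: "h x = 0" if x: "x \<in> P" "x $ k = 0" for x
  proof -
    have s0: "s 0 > 0" using s_pos[of 0] by simp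
    \<comment> \<open>Jensen's inequality with the barycentric coordinates of x in the slice of
      height 0.\<close>
    have "h (\<Sum>j\<in>UNIV. (y j x / s 0) *\<^sub>R vert j) \<le> (\<Sum>j\<in>UNIV. (y j x / s 0) * h (vert j))"
    proof (rule convex_on_sum[OF _ _ h])
      show "(\<Sum>j\<in>UNIV. y j x / s 0) = 1"
        using s0 x by (simp add: sum_y flip: sum_divide_distrib)
    qed (use x s0 in \<open>auto simp: P_iff\<close>)
    then have "h x \<le> 0" using sum_vert[OF x] vert by simp
    then show ?thesis using nn[of x] by simp
  qed
  obtain z where z: "z \<in> Z" "x = \<Psi> z (x $ k)" using P_is_\<Psi>[OF x] by blast
  let ?\<phi> = "\<lambda>t. h (\<Psi> z t)"
  have c\<phi>: "convex_on UNIV ?\<phi>" by (rule convex_\<Psi>[OF h])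
  have "\<Psi> z 0 \<in> P" using \<Psi>_mem_P[of 0 z] z(1) by (simp add: Z_def)
  then have 0: "?\<phi> 0 = 0" using slice by simp
  have "gap (\<lambda>t. g (\<Psi> z t)) = 0"
  proof -
    define G0 where "G0 = g (\<Psi> z 0)"
    have "g (\<Psi> z t) = G0 + t * (c \<bullet> (\<chi> i. if i = k then 1 else of_int a * z $ i))" for t
      unfolding G0_def by (subst \<Psi>_line[of z t]) (simp add: gd inner_add_right)
    then show ?thesis by (simp only: gap_def) (simp add: algebra_simps)
  qed
  then have "gap ?\<phi> = 0"
    using K_eq_0_imp(2)[OF f K z(1)] by (simp add: gap_def h_def algebra_simps)
  then have col: "(1 - (-1)) * ?\<phi> p = (1 - p) * ?\<phi> (-1) + (p - (-1)) * ?\<phi> 1"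
    by (simp add: gap_def add.commute)
  \<comment> \<open>Height 0 is interior to [-1, 1], so the zero found in the slice reaches both
    ends of the apex line.\<close>
  have ends: "?\<phi> (-1) = 0" "?\<phi> 1 = 0"
    using convex_on_zero_segment[OF c\<phi> nn col p(1,2) _ _ 0] by auto
  have "(1 - (-1)) * ?\<phi> (x $ k) \<le> 0"
    using convex_on_three_points[OF c\<phi>, of "-1" "x $ k" 1] x ends by (simp add: P_iff)
  then have "h x \<le> 0" using z(2) by simp
  then show ?thesis using nn[of x] by (simp add: h_def)
qed

end

section \<open>Facets and the Fano property\<close>

context proj_bundle begin

abbreviation "rays \<equiv> proj_bundle_rays k a"

section \<open>Primitive ray generators\<close>

lemma finite_rays: "finite rays"
  unfolding rays_eq by simp

lemma U_nth: "U j $ i = (if j = k then if i = k then of_int a else -1 else if i = j then 1 else 0)"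
proof -
  have "(\<Sum>l | l \<noteq> k. axis l (1 :: real) $ i) = (if i = k then 0 else 1)"
    by (simp add: axis_def)
  then show ?thesis by (simp add: U_def) (simp add: axis_def)
qed

lemma rays_int: "u \<in> rays \<Longrightarrow> u \<in> int_lattice"
  unfolding rays_eq int_lattice_def by (auto simp: U_nth axis_def)

text \<open>Such an entry makes the ray primitive, and in \<open>inward_normal_face\<close> it shows
  that a lattice vector proportional to the ray is an integer multiple of it.\<close>

lemma rays_unit: "u \<in> rays \<Longrightarrow> \<exists>i. u $ i = 1 \<or> u $ i = -1"
proof -
  obtain l where "l \<noteq> k" using exists_other by blast
  then have "U j $ (if j = k then l else j) = 1 \<or> U j $ (if j = k then l else j) = -1" for j
    by (simp add: U_nth)
  then have "\<exists>i. U j $ i = 1 \<or> U j $ i = -1" for j by blast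
  moreover have "axis k 1 $ k = (1::real)" by simp
  ultimately show "u \<in> rays \<Longrightarrow> ?thesis"
    unfolding rays_eq by (elim UnE rangeE insertE) (auto intro: exI[of _ k])
qed

lemma rays_primitive: "u \<in> rays \<Longrightarrow> primitive_vector u"
proof -
  assume u: "u \<in> rays"
  obtain i where i: "u $ i = 1 \<or> u $ i = -1" using rays_unit[OF u] by blast
  have "\<bar>c\<bar> = 1" if w: "w \<in> int_lattice" "u = of_int c *\<^sub>R w" for c :: int and w
  proof -
    obtain d where "w $ i = of_int d" using w(1) by (auto simp: int_lattice_def Ints_def)
    then have "of_int (c * d) = u $ i" using w(2) by simp
    then have "real_of_int (c * d) = of_int 1 \<or> real_of_int (c * d) = of_int (-1)" using i by simp
    then have "c * d = 1 \<or> c * d = -1" by (simp only: of_int_eq_iff)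
    then show ?thesis using zmult_eq_1_iff[of c d] zmult_eq_1_iff[of c "-d"] by auto
  qed
  moreover have "u \<noteq> 0" using i by auto
  ultimately show ?thesis using rays_int[OF u] unfolding primitive_vector_def by blast
qed

text \<open>A point cut off by the facet of \<open>u\<close> alone; for \<open>u = \<plusminus>e\<^sub>k\<close> take the apex of the frustum or
  its mirror image.\<close>

lemma ray_witness:
  assumes u: "u \<in> rays"
  shows "\<exists>x. x \<bullet> u < -1 \<and> (\<forall>u'\<in>rays. u' \<noteq> u \<longrightarrow> -1 \<le> x \<bullet> u')"
proof -
  consider "u \<in> range U" | "u \<in> {axis k 1, - axis k 1}" using u unfolding rays_eq by blast
  then show ?thesis
  proof cases
    assume "u \<in> range U"
    then obtain i where i: "u = U i" by blast
    obtain j where j: "j \<noteq> i" using exists_other by blast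
    define x where "x = (-2) *\<^sub>R (W i - W j)"
    have "x \<bullet> U l = (if l = i then -2 else if l = j then 2 else 0)" for l
      using U_W_diff[of i j l] j by (simp add: x_def inner_commute[of _ "U l"])
    moreover have "x $ k = 0" by (simp add: x_def)
    ultimately show ?thesis
      unfolding i by (intro exI[of _ x]) (auto simp: rays_eq axis_inner)
  next
    assume "u \<in> {axis k 1, - axis k 1}"
    then have "u = 1 *\<^sub>R axis k 1 \<or> u = (-1) *\<^sub>R axis k 1" by simp
    then obtain \<epsilon> :: real where \<epsilon>: "\<epsilon> = 1 \<or> \<epsilon> = -1" "u = \<epsilon> *\<^sub>R axis k 1" by blast
    define T where "T = real CARD('n) / of_int a"
    have a': "0 < real_of_int a" "real_of_int a < real CARD('n)" using a by linarith+
    then have T: "T > 1" "of_int a * T = real CARD('n)" by (simp_all add: T_def)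
    define x where "x = (\<chi> i. if i = k then - \<epsilon> * T else - \<epsilon>)"
    have "x \<bullet> U l = - \<epsilon>" for l
      using T(2) card_ge_2 by (simp add: inner_U x_def card_ne_k of_nat_diff algebra_simps)
    moreover have "x $ k = - \<epsilon> * T" by (simp add: x_def)
    ultimately show ?thesis
      using \<epsilon> T(1) unfolding \<epsilon>(2) by (intro exI[of _ x]) (auto simp: rays_eq axis_inner)
  qed
qed

section \<open>Facets and their inward normals\<close>

lemma mem_P_rays: "x \<in> P \<longleftrightarrow> (\<forall>u\<in>rays. -1 \<le> x \<bullet> u)"
  unfolding proj_bundle_polytope_def dual_polytope_def by (simp add: inner_commute)

lemma affine_hull_P: "affine hull P = UNIV"
  using zero_interior_P affine_hull_nonempty_interior by blast

text \<open>By \<open>ray_witness\<close>, dropping any half-space enlarges the polytope, so the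
  description by rays is irredundant and every half-space contributes a facet.\<close>

lemma facets_P: "{F. F facet_of P} = face ` rays"
proof -
  define H where "H u = {x. - u \<bullet> x \<le> (1::real)}" for u :: "real ^ 'n"
  have H: "x \<in> H u \<longleftrightarrow> -1 \<le> x \<bullet> u" for x u by (auto simp: H_def inner_commute)
  have inj: "u = u'" if H_eq: "u \<in> rays" "u' \<in> rays" "H u = H u'" for u u'
  proof (rule ccontr)
    assume ne: "u \<noteq> u'"
    obtain x where x: "x \<bullet> u < -1" "\<forall>u'\<in>rays. u' \<noteq> u \<longrightarrow> -1 \<le> x \<bullet> u'"
      using ray_witness[OF H_eq(1)] by blast
    then have "-1 \<le> x \<bullet> u'" using H_eq(2) ne by auto
    with x have "x \<notin> H u" "x \<in> H u'" by (simp_all add: H)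
    then show False using H_eq(3) by simp
  qed
  \<comment> \<open>\<open>facet_of_polyhedron_explicit\<close> takes the normal as a function of
    the half-space, so \<open>A\<close> inverts \<open>H\<close>; the sign adapts to its form
    \<open>A h \<bullet> x \<le> 1\<close>.\<close>
  define A where "A h = - (THE u. u \<in> rays \<and> h = H u)" for h
  have A: "A (H u) = - u" if "u \<in> rays" for u
  proof -
    have "(THE u'. u' \<in> rays \<and> H u = H u') = u"
    proof (rule the_equality)
      show "u \<in> rays \<and> H u = H u" using that by simp
      show "w = u" if "w \<in> rays \<and> H u = H w" for w
        using inj[of u w] \<open>u \<in> rays\<close> that by simp
    qed
    then show ?thesis by (simp add: A_def)
  qed
  have facet: "F facet_of P \<longleftrightarrow> (\<exists>h. h \<in> H ` rays \<and> F = P \<inter> {x. A h \<bullet> x = 1})" for F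
  proof (rule facet_of_polyhedron_explicit)
    show "finite (H ` rays)" using finite_rays by simp
    show "P = affine hull P \<inter> \<Inter> (H ` rays)"
      unfolding affine_hull_P by (auto simp: mem_P_rays H)
    show "A h \<noteq> 0 \<and> h = {x. A h \<bullet> x \<le> 1}" if h: "h \<in> H ` rays" for h
    proof -
      obtain u where u: "u \<in> rays" "h = H u" using h by blast
      then have "u \<noteq> 0" using rays_primitive by (auto simp: primitive_vector_def)
      then show ?thesis using A[OF u(1)] unfolding u(2) by (simp add: H_def)
    qed
    show "P \<subset> affine hull P \<inter> \<Inter> F'" if F': "F' \<subset> H ` rays" for F'
    proof -
      obtain u where u: "u \<in> rays" "H u \<notin> F'" using F' by blast
      obtain x where x: "x \<bullet> u < -1" "\<forall>u'\<in>rays. u' \<noteq> u \<longrightarrow> -1 \<le> x \<bullet> u'"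
        using ray_witness[OF u(1)] by blast
      have "x \<in> h" if h: "h \<in> F'" for h
      proof -
        obtain u' where u': "u' \<in> rays" "h = H u'" using F' h by blast
        then have "u' \<noteq> u" using u(2) h by blast
        then show ?thesis using x(2) u' H by simp
      qed
      moreover have "x \<notin> P" using x(1) u(1) by (auto simp: mem_P_rays not_le)
      moreover have "P \<subseteq> \<Inter> (H ` rays)" by (auto simp: mem_P_rays H)
      then have "P \<subseteq> \<Inter> F'" using F' by blast
      ultimately show ?thesis unfolding affine_hull_P by blast
    qed
  qed
  have eq: "P \<inter> {x. A (H u) \<bullet> x = 1} = face u" if "u \<in> rays" for u
    using A[OF that] by (auto simp: face_def inner_commute)
  show ?thesis
  proof (intro set_eqI iffI)
    fix F assume "F \<in> {F. F facet_of P}"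
    then obtain u where "u \<in> rays" "F = P \<inter> {x. A (H u) \<bullet> x = 1}" using facet by auto
    then show "F \<in> face ` rays" using eq by blast
  next
    fix F assume "F \<in> face ` rays"
    then obtain u where u: "u \<in> rays" "F = face u" by blast
    then have "F = P \<inter> {x. A (H u) \<bullet> x = 1}" using eq by simp
    then show "F \<in> {F. F facet_of P}" using facet[of F] u(1) by blast
  qed
qed

text \<open>\<open>x\<close> is the foot of the perpendicular from 0 and \<open>d\<close> the part
  of u' orthogonal to u. Adding d stays in the hyperplane, so \<open>d \<bullet> u' = 0\<close> and
  d = 0; evaluating at x gives the factor.\<close>

lemma hyperplane_eq_imp:
  fixes u u' :: "real ^ 'n"
  assumes "{x. x \<bullet> u = -1} = {x. x \<bullet> u' = c}" "u \<noteq> 0"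
  shows "u' = - c *\<^sub>R u"
proof -
  have uu: "u \<bullet> u \<noteq> 0" using assms(2) by simp
  define x where "x = (- 1 / (u \<bullet> u)) *\<^sub>R u"
  define d where "d = u' - ((u' \<bullet> u) / (u \<bullet> u)) *\<^sub>R u"
  have x: "x \<bullet> u = -1" and du: "d \<bullet> u = 0" using uu by (simp_all add: x_def d_def inner_diff_left)
  moreover have "z \<bullet> u' = c" if "z \<bullet> u = -1" for z using assms(1) that by blast
  moreover have "(x + d) \<bullet> u = -1" using x du by (simp add: inner_add_left)
  ultimately have "x \<bullet> u' = c" "(x + d) \<bullet> u' = c" by blast+
  then have "d \<bullet> u' = 0" by (simp add: inner_add_left)
  moreover have "d \<bullet> d = d \<bullet> u' - ((u' \<bullet> u) / (u \<bullet> u)) * (d \<bullet> u)"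
    by (subst (2) d_def) (simp only: inner_diff_right inner_scaleR_right)
  ultimately have "d \<bullet> d = 0" using du by simp
  then have u': "u' = ((u' \<bullet> u) / (u \<bullet> u)) *\<^sub>R u" by (simp add: d_def)
  have "x \<bullet> u' = ((u' \<bullet> u) / (u \<bullet> u)) * (x \<bullet> u)" by (subst u') (rule inner_scaleR_right)
  then have "(u' \<bullet> u) / (u \<bullet> u) = - c" using x \<open>x \<bullet> u' = c\<close> by simp
  with u' show ?thesis by simp
qed

text \<open>For uniqueness: the facet has dimension n - 1, so its affine hull is the hyperplane of
  any admissible u', and u' = - c u. Here - c \<ge> 0 because 0 lies in \<open>P\<close>, it is an
  integer by \<open>rays_unit\<close>, and primitivity of u' makes it 1.\<close>

lemma inward_normal_face:
  assumes u: "u \<in> rays" shows "inward_normal P (face u) = u"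
  unfolding inward_normal_def
proof (rule the_equality)
  have "\<forall>x\<in>P. -1 \<le> x \<bullet> u" using u by (simp add: mem_P_rays)
  then show "primitive_vector u \<and> (\<exists>c. face u = P \<inter> {x. x \<bullet> u = c} \<and> (\<forall>x\<in>P. c \<le> x \<bullet> u))"
    using rays_primitive[OF u] by (auto simp: face_def)
next
  fix u' assume "primitive_vector u' \<and> (\<exists>c. face u = P \<inter> {x. x \<bullet> u' = c} \<and> (\<forall>x\<in>P. c \<le> x \<bullet> u'))"
  then obtain c where u': "primitive_vector u'" and c: "face u = P \<inter> {x. x \<bullet> u' = c}" "\<And>x. x \<in> P \<Longrightarrow> c \<le> x \<bullet> u'"
    by blast
  have nz: "u \<noteq> 0" "u' \<noteq> 0" using rays_primitive[OF u] u' by (auto simp: primitive_vector_def)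
  have hyp: "{x. x \<bullet> w = d} = {x. w \<bullet> x = d}" for w :: "real ^ 'n" and d by (simp add: inner_commute)
  have "face u facet_of P" using facets_P u by blast
  moreover have "aff_dim P = int CARD('n)"
    using affine_hull_P aff_dim_eq_full[of P] by simp
  ultimately have dim: "aff_dim (face u) = int CARD('n) - 1" by (simp add: facet_of_def)
  have hull: "affine hull face u = {x. x \<bullet> w = d}" if "w \<noteq> 0" "face u \<subseteq> {x. x \<bullet> w = d}" for w d
  proof (rule affine_dim_equal)
    show "affine (affine hull face u)" by (rule affine_affine_hull)
    show "affine {x. x \<bullet> w = d}" unfolding hyp by (rule affine_hyperplane)
    show "affine hull face u \<subseteq> {x. x \<bullet> w = d}"
      using that(2) unfolding hyp by (intro hull_minimal affine_hyperplane)
    show "affine hull face u \<noteq> {}" using dim card_ge_2 by auto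
    show "aff_dim (affine hull face u) = aff_dim {x. x \<bullet> w = d}"
      unfolding hyp using that(1) dim by (simp add: aff_dim_hyperplane)
  qed
  have "{x. x \<bullet> u = -1} = {x. x \<bullet> u' = c}"
    using hull[OF nz(1), of "-1"] hull[OF nz(2), of c] c(1) by (auto simp: face_def)
  then have eq: "u' = - c *\<^sub>R u" using hyperplane_eq_imp nz(1) by blast
  have "c \<le> 0" using c(2)[OF zero_in_P] by simp
  obtain i where i: "u $ i = 1 \<or> u $ i = -1" using rays_unit[OF u] by blast
  have "u' $ i \<in> \<int>" using u' by (auto simp: primitive_vector_def int_lattice_def)
  then have "- c \<in> \<int>" using i unfolding eq by auto
  then obtain d where d: "- c = of_int d" by (auto simp: Ints_def)
  have "\<bar>d\<bar> = 1"
    using u' rays_int[OF u] eq unfolding d primitive_vector_def by blast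
  then have "- c = 1" using d \<open>c \<le> 0\<close> by linarith
  then show "u' = u" using eq by simp
qed

lemma inj_face: "inj_on face rays"
  by (rule inj_on_inverseI[where g = "inward_normal P"]) (rule inward_normal_face)

lemma inj_U: "inj U"
proof (rule injI)
  fix i j assume eq: "U i = U j"
  show "i = j"
  proof (rule ccontr)
    assume "i \<noteq> j"
    then show False using W_line[of i j] eq by simp
  qed
qed

lemma U_ne_axis: "U j \<noteq> c *\<^sub>R axis k 1"
proof
  assume eq: "U j = c *\<^sub>R axis k 1"
  obtain l where "l \<noteq> j" using exists_other by blast
  then have "U j \<bullet> (W j - W l) = 1" by (rule W_line(1)[OF not_sym])
  then show False unfolding eq by (simp add: axis_inner)
qed

lemma sum_rays: "(\<Sum>u\<in>rays. g u) = (\<Sum>i\<in>UNIV. g (U i)) + g (axis k 1) + g (- axis k 1)" for g :: "_ \<Rightarrow> real"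
proof -
  have "axis k 1 \<noteq> (- axis k 1 :: real ^ 'n)" by (simp add: vec_eq_iff axis_def)
  moreover have "range U \<inter> {axis k 1, - axis k 1} = {}"
    using U_ne_axis[of _ 1, THEN not_sym] U_ne_axis[of _ "-1", THEN not_sym] by auto
  ultimately show ?thesis
    unfolding rays_eq by (subst sum.union_disjoint) (simp_all add: sum.reindex[OF inj_U])
qed

lemma boundary_integral_P: "boundary_integral P f =
    (\<Sum>i\<in>UNIV. face_integral (U i) f) + face_integral (axis k 1) f + face_integral (- axis k 1) f"
proof -
  have "boundary_integral P f = (\<Sum>u\<in>rays. face_integral u f)"
    unfolding boundary_integral_def facets_P sum.reindex[OF inj_face]
    by (intro sum.cong refl) (simp add: face_integral_def inward_normal_face)
  then show ?thesis by (simp add: sum_rays)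
qed

section \<open>Vertices, dual polytope and the Delzant condition\<close>

definition ends :: "(real ^ 'n) set" where
  "ends = (\<lambda>(j, \<epsilon>). \<Psi> (W j) \<epsilon>) ` (UNIV \<times> {1, -1})"

lemma W_mem_Z: "W j \<in> Z"
  by (simp add: Z_def b_W)

lemma ends_subset: "ends \<subseteq> P"
  using \<Psi>_mem_P W_mem_Z by (auto simp: ends_def)

lemma P_eq_hull: "P = convex hull ends"
proof
  show "convex hull ends \<subseteq> P" by (intro hull_minimal ends_subset convex_P)
  show "P \<subseteq> convex hull ends"
  proof
    fix x assume x: "x \<in> P"
    obtain z where z: "z \<in> Z" "x = \<Psi> z (x $ k)" using P_is_\<Psi>[OF x] by blast
    define t where "t = x $ k"
    have t: "-1 \<le> t" "t \<le> 1" using x by (auto simp: t_def P_iff)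
    have "\<Psi> (W j) t \<in> convex hull ends" for j
    proof -
      have "\<Psi> (W j) t = ((1 - t) / 2) *\<^sub>R \<Psi> (W j) (-1) + ((1 + t) / 2) *\<^sub>R \<Psi> (W j) 1"
        by (auto simp: vec_eq_iff \<Psi>_def s_def field_simps)
      moreover have "\<Psi> (W j) (-1) \<in> convex hull ends" "\<Psi> (W j) 1 \<in> convex hull ends"
        by (auto intro!: hull_inc simp: ends_def)
      ultimately show ?thesis
        using t by (simp only:) (intro convexD[OF convex_convex_hull], auto simp: field_simps)
    qed
    then have "(\<Sum>j\<in>UNIV. b j z *\<^sub>R \<Psi> (W j) t) \<in> convex hull ends"
      using z(1) by (intro convex_sum) (auto simp: sum_b Z_def)
    moreover have "(\<Sum>j\<in>UNIV. b j z *\<^sub>R \<Psi> (W j) t) = x"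
      unfolding vec_eq_iff
    proof
      fix i
      show "(\<Sum>j\<in>UNIV. b j z *\<^sub>R \<Psi> (W j) t) $ i = x $ i"
      proof (cases "i = k")
        case True
        then show ?thesis by (simp add: sum_b t_def flip: sum_distrib_right)
      next
        case False
        have *: "\<Psi> (W j) t $ i = s t * (if j = i then 1 else 0) - 1" for j
          using False by (auto simp: \<Psi>_def W_nth)
        have "(\<Sum>j\<in>UNIV. b j z *\<^sub>R \<Psi> (W j) t) $ i =
            (\<Sum>j\<in>UNIV. b j z * (s t * (if j = i then 1 else 0) - 1))"
          by (simp add: *)
        also have "\<dots> = (\<Sum>j\<in>UNIV. (if j = i then s t * b j z else 0) - b j z)"
          by (intro sum.cong) (auto simp: algebra_simps)
        also have "\<dots> = s t * b i z - 1" by (simp add: sum_subtractf sum_b)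
        also have "\<dots> = x $ i" using False by (subst z(2)) (simp add: \<Psi>_def t_def b_def)
        finally show ?thesis .
      qed
    qed
    ultimately show "x \<in> convex hull ends" by simp
  qed
qed

lemma lattice_polytope_P: "lattice_polytope P"
  unfolding lattice_polytope_def
proof (intro exI conjI)
  show "finite ends" by (simp add: ends_def)
  show "ends \<subseteq> int_lattice"
    by (auto simp: ends_def int_lattice_def \<Psi>_def W_nth s_def intro!: Ints_diff Ints_add Ints_mult)
  show "P = convex hull ends" by (rule P_eq_hull)
qed

lemma dual_P: "dual_polytope P = convex hull rays"
proof
  show "convex hull rays \<subseteq> dual_polytope P"
  proof (rule hull_minimal)
    show "rays \<subseteq> dual_polytope P" by (auto simp: dual_polytope_def mem_P_rays)
    have "dual_polytope P = (\<Inter>x\<in>P. {y. -1 \<le> x \<bullet> y})" by (auto simp: dual_polytope_def)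
    then show "convex (dual_polytope P)" by (simp add: convex_INT convex_halfspace_ge)
  qed
  show "dual_polytope P \<subseteq> convex hull rays"
  proof
    fix w assume w: "w \<in> dual_polytope P"
    show "w \<in> convex hull rays"
    proof (rule ccontr)
      assume "w \<notin> convex hull rays"
      then obtain c d where cd: "c \<bullet> w < d" "\<And>x. x \<in> convex hull rays \<Longrightarrow> d < c \<bullet> x"
        using separating_hyperplane_closed_point[of "convex hull rays" w]
          compact_imp_closed[OF finite_imp_compact_convex_hull[OF finite_rays]] by auto
      \<comment> \<open>0 is the midpoint of two opposite rays, so d < 0 and c can be rescaled to a
        point of \<open>P\<close> whose product with w is below -1.\<close>
      have "(1/2) *\<^sub>R axis k 1 + (1/2) *\<^sub>R (- axis k 1) \<in> convex hull rays"
        by (intro convexD[OF convex_convex_hull] hull_inc) (auto simp: rays_eq)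
      then have "d < 0" using cd(2)[of 0] by simp
      define e where "e = (- 1 / d) *\<^sub>R c"
      have "-1 \<le> e \<bullet> u" if "u \<in> rays" for u
        using cd(2)[OF hull_inc[OF that]] \<open>d < 0\<close> by (simp add: e_def field_simps)
      then have "e \<in> P" by (simp add: mem_P_rays)
      moreover have "e \<bullet> w < -1" using cd(1) \<open>d < 0\<close> by (simp add: e_def field_simps)
      ultimately show False using w by (auto simp: dual_polytope_def)
    qed
  qed
qed

lemma facet_normals:
  assumes \<epsilon>: "\<epsilon> = 1 \<or> \<epsilon> = -1"
  shows "inward_normal P ` {F. F facet_of P \<and> \<Psi> (W j) \<epsilon> \<in> F} = insert (- \<epsilon> *\<^sub>R axis k 1) (U ` (UNIV - {j}))"
proof -
  let ?v = "\<Psi> (W j) \<epsilon>"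
  have v: "?v \<in> P" using ends_subset \<epsilon> by (auto simp: ends_def)
  have "inward_normal P ` {F. F facet_of P \<and> ?v \<in> F} = {u \<in> rays. ?v \<in> face u}"
  proof -
    have "{F. F facet_of P \<and> ?v \<in> F} = face ` {u \<in> rays. ?v \<in> face u}"
    proof -
      have "F facet_of P \<longleftrightarrow> F \<in> face ` rays" for F using facets_P by blast
      then show ?thesis by auto
    qed
    then show ?thesis by (simp add: image_image inward_normal_face)
  qed
  also have "\<dots> = insert (- \<epsilon> *\<^sub>R axis k 1) (U ` (UNIV - {j}))"
  proof -
    have "s \<epsilon> \<noteq> 0" using s_pos[of \<epsilon>] \<epsilon> by auto
    then have "?v \<in> face (U i) \<longleftrightarrow> i \<noteq> j" for i
      using v by (simp add: mem_face_U y_\<Psi> b_W)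
    moreover have "?v \<in> face (axis k 1) \<longleftrightarrow> \<epsilon> = -1" "?v \<in> face (- axis k 1) \<longleftrightarrow> \<epsilon> = 1"
      using v by (simp_all add: face_def axis_inner)
    ultimately have "{u \<in> rays. ?v \<in> face u} = U ` {i. i \<noteq> j} \<union> {u. u = axis k 1 \<and> \<epsilon> = -1} \<union> {u. u = - axis k 1 \<and> \<epsilon> = 1}"
      unfolding rays_eq by blast
    moreover have "{i. i \<noteq> j} = UNIV - {j}" by auto
    ultimately show ?thesis using \<epsilon> by auto
  qed
  finally show ?thesis .
qed

text \<open>The basis dual to the normals at a vertex consists of the edge directions there.\<close>

lemma dual_expansion:
  "z = (\<Sum>i\<in>UNIV - {j}. (z \<bullet> (W i - W j)) *\<^sub>R U i) + (z \<bullet> (of_int a *\<^sub>R W j + axis k 1)) *\<^sub>R axis k 1"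
proof -
  define D where "D = z - ((\<Sum>i\<in>UNIV - {j}. (z \<bullet> (W i - W j)) *\<^sub>R U i) + (z \<bullet> (of_int a *\<^sub>R W j + axis k 1)) *\<^sub>R axis k 1)"
  have W0: "D \<bullet> (W l - W j) = 0" for l
  proof (cases "l = j")
    case False
    have "(\<Sum>i\<in>UNIV - {j}. (z \<bullet> (W i - W j)) * (U i \<bullet> (W l - W j))) =
      (\<Sum>i\<in>UNIV - {j}. if i = l then z \<bullet> (W l - W j) else 0)"
      by (intro sum.cong) (auto simp: U_W_diff[OF False])
    also have "\<dots> = z \<bullet> (W l - W j)" using False by simp
    finally show ?thesis
      unfolding D_def by (simp add: inner_diff_left inner_add_left inner_sum_left axis_inner)
  qed simp
  have "U i \<bullet> (of_int a *\<^sub>R W j + axis k 1) = 0" if "i \<noteq> j" for i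
    using that by (auto simp: inner_add_right U_W inner_axis U_nth)
  then have e0: "D \<bullet> (of_int a *\<^sub>R W j + axis k 1) = 0"
    unfolding D_def by (simp add: inner_diff_left inner_add_left inner_sum_left axis_inner)
  \<comment> \<open>\<open>W k = 0\<close>, so the case l = k of \<open>W0\<close> is orthogonality
    to \<open>W j\<close> itself.\<close>
  have Wj: "D \<bullet> W j = 0" using W0[of k] by (simp add: W_def[of k] inner_diff_right)
  have DW: "D \<bullet> W l = 0" for l using W0[of l] Wj by (simp add: inner_diff_right)
  have "D \<bullet> axis k 1 = 0" using e0 Wj by (simp add: inner_add_right)
  then have "D \<bullet> axis l 1 = 0" for l using DW[of l] by (cases "l = k") (simp_all add: W_def)
  then have "D = 0" unfolding vec_eq_iff by (simp add: inner_axis)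
  then show ?thesis unfolding D_def by simp
qed

text \<open>The coefficients in \<open>dual_expansion\<close> are inner products with integer
  vectors, hence integers for lattice points. The expansion also shows spanning, and at most n
  vectors spanning an n-dimensional space are independent.\<close>

lemma lattice_basis_normals:
  assumes \<epsilon>: "\<epsilon> = 1 \<or> \<epsilon> = -1"
  shows "lattice_basis (insert (- \<epsilon> *\<^sub>R axis k 1) (U ` (UNIV - {j})))" (is "lattice_basis ?B")
proof -
  have notin: "- \<epsilon> *\<^sub>R axis k 1 \<notin> U ` (UNIV - {j})"
  proof
    assume "- \<epsilon> *\<^sub>R axis k 1 \<in> U ` (UNIV - {j})"
    then obtain i where "- \<epsilon> *\<^sub>R axis k 1 = U i" by blast
    then show False using U_ne_axis[of i "- \<epsilon>"] by (rule notE[OF _ sym, rotated])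
  qed
  have injU: "inj_on U (UNIV - {j})" using inj_U by (rule inj_on_subset) simp
  have ex: "z = (\<Sum>u\<in>?B. (if u = - \<epsilon> *\<^sub>R axis k 1 then - \<epsilon> * (z \<bullet> (of_int a *\<^sub>R W j + axis k 1))
      else z \<bullet> (W (inv U u) - W j)) *\<^sub>R u)" (is "z = (\<Sum>u\<in>?B. ?c z u *\<^sub>R u)") for z
  proof -
    have 1: "(\<Sum>u\<in>U ` (UNIV - {j}). ?c z u *\<^sub>R u) = (\<Sum>i\<in>UNIV - {j}. (z \<bullet> (W i - W j)) *\<^sub>R U i)"
      unfolding sum.reindex[OF injU]
      by (intro sum.cong refl) (simp add: U_ne_axis[of _ "- \<epsilon>", simplified] inv_f_f[OF inj_U])
    have 2: "?c z (- \<epsilon> *\<^sub>R axis k 1) *\<^sub>R (- \<epsilon> *\<^sub>R axis k 1) = (z \<bullet> (of_int a *\<^sub>R W j + axis k 1)) *\<^sub>R axis k 1"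
      using \<epsilon> by auto
    have 3: "(\<Sum>u\<in>?B. ?c z u *\<^sub>R u) = ?c z (- \<epsilon> *\<^sub>R axis k 1) *\<^sub>R (- \<epsilon> *\<^sub>R axis k 1) +
        (\<Sum>u\<in>U ` (UNIV - {j}). ?c z u *\<^sub>R u)"
      by (rule sum.insert[OF _ notin]) simp
    show ?thesis
      unfolding 3 1 2 by (subst add.commute) (rule dual_expansion)
  qed
  have "?B \<subseteq> rays" using \<epsilon> by (auto simp: rays_eq)
  then have "?B \<subseteq> int_lattice" using rays_int by blast
  moreover have "independent ?B"
  proof (rule card_le_dim_spanning)
    show "?B \<subseteq> UNIV" by simp
    show "UNIV \<subseteq> span ?B"
    proof
      fix z :: "real ^ 'n"
      show "z \<in> span ?B" by (subst ex[of z]) (intro span_sum span_scale span_base)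
    qed
    show "finite ?B" by simp
    have "card ?B \<le> Suc (card (U ` (UNIV - {j})))" by (rule card_insert_le_m1) auto
    also have "card (U ` (UNIV - {j})) = CARD('n) - 1"
      by (simp add: card_image[OF injU] card_Diff_singleton)
    finally show "card ?B \<le> dim (UNIV :: (real ^ 'n) set)" using card_ge_2 by simp
  qed
  moreover have "\<exists>c :: real ^ 'n \<Rightarrow> int. z = (\<Sum>u\<in>?B. of_int (c u) *\<^sub>R u)" if z: "z \<in> int_lattice" for z
  proof -
    have int: "z \<bullet> W i \<in> \<int>" "z \<bullet> axis k 1 \<in> \<int>" for i
      using z by (auto simp: W_def inner_axis int_lattice_def)
    have "?c z u \<in> \<int>" for u
      using \<epsilon> by (auto simp: inner_diff_right inner_add_right intro!: Ints_diff Ints_add Ints_mult Ints_minus int)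
    then have floor: "of_int \<lfloor>?c z u\<rfloor> = ?c z u" for u by (rule of_int_floor)
    show ?thesis by (intro exI[of _ "\<lambda>u. \<lfloor>?c z u\<rfloor>"], unfold floor, rule ex)
  qed
  ultimately show ?thesis unfolding lattice_basis_def by blast
qed

lemma delzant_P: "delzant P"
  unfolding delzant_def
proof (intro allI impI)
  fix v assume "v extreme_point_of P"
  then have "v \<in> ends" unfolding P_eq_hull by (rule extreme_point_of_convex_hull)
  then obtain j \<epsilon> where "v = \<Psi> (W j) \<epsilon>" "\<epsilon> = 1 \<or> \<epsilon> = -1" by (auto simp: ends_def)
  then show "lattice_basis (inward_normal P ` {F. F facet_of P \<and> v \<in> F})"
    using facet_normals lattice_basis_normals by simp
qed

lemma fano_P: "fano_polytope P"
  unfolding fano_polytope_def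
proof (intro conjI lattice_polytope_P zero_interior_P delzant_P)
  show "lattice_polytope (dual_polytope P)"
    unfolding dual_P lattice_polytope_def using finite_rays rays_int by blast
qed

end

section \<open>Stability\<close>

context extremal_bundle begin

section \<open>The extremal potential of \<open>P\<close>\<close>

definition \<theta> :: "real ^ 'n \<Rightarrow> real" where "\<theta> x = \<alpha> * x $ k + \<beta>"

lemma integral_of_height:
  assumes g: "continuous_on {-1..1} g" and 0: "((\<lambda>t. g t * s t ^ m) has_integral 0) {-1..1}"
  shows "(LINT x:P|lborel. g (x $ k)) = 0"
proof -
  have cg: "continuous_on P (\<lambda>x. g (x $ k))"
    by (rule continuous_on_compose2[OF g]) (auto simp: P_iff intro!: continuous_intros)
  have "(LINT t:{-1..1}|lborel. s t ^ m * g t) = integral {-1..1} (\<lambda>t. s t ^ m * g t)"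
    by (intro set_borel_integral_eq_integral(2), unfold set_integrable_def)
       (intro borel_integrable_compact continuous_intros g compact_Icc)
  also have "\<dots> = 0" using integral_unique[OF 0] by (simp add: mult.commute)
  finally show ?thesis
    using radial_integral[OF cg, folded m_def] by simp
qed

lemma \<theta>_affine: "affine_fun \<theta>"
  unfolding affine_fun_def \<theta>_def
  by (intro exI[of _ "\<alpha> *\<^sub>R axis k 1"] exI[of _ \<beta>]) (simp add: axis_inner)

lemma \<theta>_integral: "(LINT x:P|lborel. \<theta> x) = 0"
  unfolding \<theta>_def using moment_0[folded m_def]
  by (intro integral_of_height[of "\<lambda>t. \<alpha> * t + \<beta>"] continuous_intros)

text \<open>For i \<noteq> k: by \<open>integral_y_swap\<close> the integrals of y j (1 - \<theta>)
  agree for all j, and they add up to that of (n + a t) (1 - \<theta>), whose t term vanishes by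
  \<open>moment_1\<close>. So y i (1 - \<theta>) and 1 - \<theta> have the same integral, and
  \<open>y i x = x $ i + 1\<close>.\<close>

lemma \<theta>_moment: "(LINT x:P|lborel. x $ i * (1 - \<theta> x)) = 0"
proof -
  let ?g = "\<lambda>t. 1 - (\<alpha> * t + \<beta>)"
  let ?I = "\<lambda>F. LINT x:P|lborel. F x * ?g (x $ k)"
  have g: "continuous_on {-1..1} ?g" by (intro continuous_intros)
  have k: "?I (\<lambda>x. x $ k) = 0"
    using moment_1[folded m_def] by (intro integral_of_height[of "\<lambda>t. t * ?g t"] continuous_intros)
  show ?thesis
  proof (cases "i = k")
    case True
    then show ?thesis using k by (simp add: \<theta>_def)
  next
    case False
    have int: "set_integrable lborel P (\<lambda>x. F x * ?g (x $ k))" if "continuous_on P F" for F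
      by (intro set_integrable_P continuous_intros that)
    have same: "?I (y j) = ?I (y i)" for j
      using integral_y_swap[OF _ g, of j i] by (cases "j = i") auto
    have "(\<Sum>j\<in>UNIV. ?I (y j)) = (\<Sum>j\<in>(UNIV :: 'n set). ?I (y i))" by (intro sum.cong refl same)
    then have "real CARD('n) * ?I (y i) = (\<Sum>j\<in>UNIV. ?I (y j))" by (simp only: sum_constant)
    also have "\<dots> = (LINT x:P|lborel. (\<Sum>j\<in>UNIV. y j x * ?g (x $ k)))"
      unfolding set_lebesgue_integral_def scaleR_sum_right
      by (intro Bochner_Integration.integral_sum[symmetric] int[unfolded set_integrable_def] continuous_intros)
    also have "\<dots> = ?I (\<lambda>x. s (x $ k))" by (simp add: sum_y flip: sum_distrib_right)
    also have "\<dots> = (LINT x:P|lborel. real CARD('n) * (1 * ?g (x $ k)) + of_int a * (x $ k * ?g (x $ k)))"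
      by (simp add: s_def algebra_simps)
    also have "\<dots> = real CARD('n) * ?I (\<lambda>x. 1) + of_int a * ?I (\<lambda>x. x $ k)"
      unfolding set_integral_mult_right[symmetric]
      by (intro set_integral_add(2) set_integrable_mult_right int continuous_intros)
    finally have "?I (y i) = ?I (\<lambda>x. 1)" using k card_ge_2 by simp
    moreover have "?I (\<lambda>x. x $ i) = (LINT x:P|lborel. y i x * ?g (x $ k) - 1 * ?g (x $ k))"
      using False by (simp add: y_def inner_U algebra_simps)
    moreover have "\<dots> = ?I (y i) - ?I (\<lambda>x. 1)"
      by (intro set_integral_diff(2) int continuous_intros)
    ultimately show ?thesis by (simp add: \<theta>_def)
  qed
qed

lemma P_interior: "interior P \<noteq> {}"
  using zero_interior_P by blast

lemma affine_fun_zero_on_P: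
  fixes d :: "real ^ 'n \<Rightarrow> real"
  assumes "affine_fun d" "\<And>x. x \<in> P \<Longrightarrow> d x = 0" shows "d = (\<lambda>x. 0)"
proof -
  obtain c d0 where d: "d = (\<lambda>x. c \<bullet> x + d0)" using assms(1) by (auto simp: affine_fun_def)
  have d0: "d0 = 0" using assms(2)[OF zero_in_P] by (simp add: d)
  obtain e where e: "e > 0" "ball 0 e \<subseteq> P" using zero_interior_P mem_interior by blast
  have "c = 0"
  proof (rule ccontr)
    assume c: "c \<noteq> 0"
    define x where "x = (e / (2 * norm c)) *\<^sub>R c"
    have "x \<in> ball 0 e" using e(1) c by (simp add: x_def)
    then have "c \<bullet> x = 0" using assms(2)[of x] e(2) d0 by (auto simp: d)
    then show False using e(1) c by (simp add: x_def)
  qed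
  then show ?thesis using d0 d by simp
qed

text \<open>For uniqueness: the difference \<open>D\<close> of two potentials is orthogonal on
  \<open>P\<close> to 1 and to the coordinates, hence, being affine, to itself. So it vanishes on
  \<open>P\<close>, which has interior points.\<close>

lemma extremal_potential_P: "extremal_potential P = \<theta>"
  unfolding extremal_potential_def
proof (rule the_equality)
  show "affine_fun \<theta> \<and> (LINT x:P|lborel. \<theta> x) = 0 \<and> (\<forall>i. (LINT x:P|lborel. x $ i * (1 - \<theta> x)) = 0)"
    using \<theta>_affine \<theta>_integral \<theta>_moment by blast
next
  fix \<eta> assume \<eta>: "affine_fun \<eta> \<and> (LINT x:P|lborel. \<eta> x) = 0 \<and> (\<forall>i. (LINT x:P|lborel. x $ i * (1 - \<eta> x)) = 0)"
  then obtain c d where \<eta>_eq: "\<eta> = (\<lambda>x. c \<bullet> x + d)" by (auto simp: affine_fun_def)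
  define c' where "c' = c - \<alpha> *\<^sub>R axis k 1"
  define D where "D = (\<lambda>x. \<eta> x - \<theta> x)"
  have D: "D = (\<lambda>x. c' \<bullet> x + (d - \<beta>))"
    by (simp add: D_def \<eta>_eq \<theta>_def c'_def inner_diff_left axis_inner algebra_simps)
  have c\<eta>: "continuous_on P \<eta>" unfolding \<eta>_eq by (intro continuous_intros)
  have c\<theta>: "continuous_on P \<theta>" unfolding \<theta>_def by (intro continuous_intros)
  have cD: "continuous_on P D" unfolding D_def by (intro continuous_intros c\<eta> c\<theta>)
  have D0: "(LINT x:P|lborel. D x) = 0"
    unfolding D_def using \<eta> \<theta>_integral
    by (subst set_integral_diff(2)) (auto intro!: set_integrable_P c\<eta> c\<theta>)
  have Di: "(LINT x:P|lborel. x $ i * D x) = 0" for i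
  proof -
    have "(LINT x:P|lborel. x $ i * D x) = (LINT x:P|lborel. x $ i * (1 - \<theta> x) - x $ i * (1 - \<eta> x))"
      by (simp add: D_def algebra_simps)
    also have "\<dots> = (LINT x:P|lborel. x $ i * (1 - \<theta> x)) - (LINT x:P|lborel. x $ i * (1 - \<eta> x))"
      by (intro set_integral_diff(2) set_integrable_P continuous_intros c\<eta> c\<theta>)
    finally show ?thesis using \<eta> \<theta>_moment by simp
  qed
  have "(LINT x:P|lborel. D x * D x) = (LINT x:P|lborel. (\<Sum>i\<in>UNIV. c' $ i * (x $ i * D x)) + (d - \<beta>) * D x)"
  proof -
    have "D x * D x = (\<Sum>i\<in>UNIV. c' $ i * (x $ i * D x)) + (d - \<beta>) * D x" for x
    proof -
      have "D x = (\<Sum>i\<in>UNIV. c' $ i * x $ i) + (d - \<beta>)" by (simp add: D inner_vec_def)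
      then have "D x * D x = ((\<Sum>i\<in>UNIV. c' $ i * x $ i) + (d - \<beta>)) * D x" by simp
      then show ?thesis by (simp add: distrib_right sum_distrib_right mult.assoc)
    qed
    then show ?thesis by (simp only:)
  qed
  also have "\<dots> = (\<Sum>i\<in>UNIV. c' $ i * (LINT x:P|lborel. x $ i * D x)) + (d - \<beta>) * (LINT x:P|lborel. D x)"
  proof -
    have "(LINT x:P|lborel. (\<Sum>i\<in>UNIV. c' $ i * (x $ i * D x))) = (\<Sum>i\<in>UNIV. LINT x:P|lborel. c' $ i * (x $ i * D x))"
      unfolding set_lebesgue_integral_def scaleR_sum_right
      by (intro Bochner_Integration.integral_sum set_integrable_P[unfolded set_integrable_def] continuous_intros cD)
    moreover have "(LINT x:P|lborel. (\<Sum>i\<in>UNIV. c' $ i * (x $ i * D x)) + (d - \<beta>) * D x) =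
      (LINT x:P|lborel. (\<Sum>i\<in>UNIV. c' $ i * (x $ i * D x))) + (LINT x:P|lborel. (d - \<beta>) * D x)"
      by (intro set_integral_add(2) set_integrable_P continuous_intros cD)
    ultimately show ?thesis by (simp only: set_integral_mult_right)
  qed
  also have "\<dots> = 0" by (simp add: D0 Di)
  finally have DD: "(LINT x:P|lborel. D x * D x) = 0" .
  have "D x = 0" if "x \<in> P" for x
    using integral_nonneg_eq_0_imp[OF compact_P convex_P P_interior _ _ DD that] cD
    by (auto intro: continuous_intros)
  moreover have "affine_fun D" unfolding D affine_fun_def by blast
  ultimately have "D = (\<lambda>x. 0)" by (intro affine_fun_zero_on_P)
  then show "\<eta> = \<theta>" unfolding D_def fun_eq_iff by simp
qed

section \<open>The two stability statements\<close>

lemma K_functional_P: "K_functional P f = K f"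
  unfolding K_functional_def K_def boundary_integral_P extremal_potential_P \<theta>_def by simp

lemma convex_on_Max_affine:
  fixes S :: "((real ^ 'n) \<times> real) set"
  assumes "finite S" "S \<noteq> {}"
  shows "convex_on UNIV (\<lambda>x. Max ((\<lambda>(c, d). c \<bullet> x + d) ` S))" (is "convex_on UNIV ?f")
proof (rule convex_onI)
  fix t :: real and x y :: "real ^ 'n" assume t: "0 < t" "t < 1"
  show "?f ((1 - t) *\<^sub>R x + t *\<^sub>R y) \<le> (1 - t) * ?f x + t * ?f y"
  proof (rule Max.boundedI)
    fix r assume "r \<in> (\<lambda>(c, d). c \<bullet> ((1 - t) *\<^sub>R x + t *\<^sub>R y) + d) ` S"
    then obtain c d where cd: "(c, d) \<in> S" and r: "r = c \<bullet> ((1 - t) *\<^sub>R x + t *\<^sub>R y) + d" by auto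
    have le: "c \<bullet> z + d \<le> ?f z" for z
      using assms cd by (intro Max_ge) auto
    have "r = (1 - t) * (c \<bullet> x + d) + t * (c \<bullet> y + d)"
      unfolding r by (simp add: inner_add_right algebra_simps)
    also have "\<dots> \<le> (1 - t) * ?f x + t * ?f y"
      using t le by (intro add_mono mult_left_mono) auto
    finally show "r \<le> (1 - t) * ?f x + t * ?f y" .
  qed (use assms in auto)
qed auto

lemma relatively_K_stable_P: "relatively_K_stable P"
  unfolding relatively_K_stable_def K_functional_P
proof (intro allI impI)
  fix f assume "rational_PL_convex_on P f"
  then obtain S where S: "finite S" "S \<noteq> {}" "\<And>x. x \<in> P \<Longrightarrow> f x = Max ((\<lambda>(c, d). c \<bullet> x + d) ` S)"
    unfolding rational_PL_convex_on_def by blast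
  \<comment> \<open>\<open>f\<close> is prescribed on \<open>P\<close> only; the same maximum taken
    on the whole space is convex there, as the bounds for \<open>K\<close> require.\<close>
  define F where "F x = Max ((\<lambda>(c, d). c \<bullet> x + d) ` S)" for x
  have conv: "convex_on UNIV F" unfolding F_def by (rule convex_on_Max_affine[OF S(1,2)])
  have KF: "K f = K F" by (rule K_cong) (simp add: S(3) F_def)
  have "affine_linear_on P f" if K0: "K F = 0"
  proof -
    have "F 0 \<in> (\<lambda>(c, d). c \<bullet> 0 + d) ` S" unfolding F_def using S by (intro Max_in) auto
    then obtain c d where cd: "(c, d) \<in> S" "F 0 = d" by auto
    have "c \<bullet> x + d \<le> F x" for x unfolding F_def using S(1) cd(1) by (intro Max_ge) auto
    then have "F x = c \<bullet> x + d" if "x \<in> P" for x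
      using K_eq_0_imp_affine[OF conv K0, of "\<lambda>x. c \<bullet> x + d" x] that cd(2)
      by (auto simp: affine_fun_def)
    then show ?thesis
      unfolding affine_linear_on_def affine_fun_def using S(3) by (intro exI[of _ "\<lambda>x. c \<bullet> x + d"]) (auto simp: F_def)
  qed
  moreover have "K f = 0" if aff: "affine_linear_on P f"
  proof -
    obtain g where g: "affine_fun g" "\<And>x. x \<in> P \<Longrightarrow> f x = g x" using aff by (auto simp: affine_linear_on_def)
    then show ?thesis using K_cong[of f g] K_affine by simp
  qed
  ultimately show "0 \<le> K f \<and> (K f = 0 \<longleftrightarrow> affine_linear_on P f)"
    using K_nonneg[OF conv] KF by auto
qed

text \<open>The destabilising function \<open>max 0 (t - c)\<close> lives where \<open>1 - \<theta> < 0\<close>.\<close>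

lemma relatively_Ding_unstable_P: "relatively_Ding_unstable P"
  unfolding relatively_Ding_unstable_def relatively_Ding_semistable_def
proof
  assume ss: "\<forall>f. rational_PL_convex_on P f \<longrightarrow> 0 \<le> ding_functional P f"
  \<comment> \<open>c > 0 gives f 0 = 0, c > (1 - \<beta>) / \<alpha> gives \<theta> > 1 wherever f
    > 0, and c < 1 keeps f from vanishing on \<open>P\<close>.\<close>
  have "max 0 ((1 - \<beta>) / \<alpha>) < 1" using \<alpha>_pos right_gt_1 by simp
  then obtain c where c: "c \<in> \<rat>" "max 0 ((1 - \<beta>) / \<alpha>) < c" "c < 1" using Rats_dense_in_real by blast
  then have c0: "0 < c" and c\<theta>: "1 < \<alpha> * c + \<beta>" using \<alpha>_pos by (simp_all add: field_simps)
  define f where "f x = max 0 (x $ k - c)" for x :: "real ^ 'n"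
  have "rational_PL_convex_on P f"
    unfolding rational_PL_convex_on_def
  proof (intro exI[of _ "{(0, 0), (axis k 1, - c)}"] conjI ballI)
    show "case e of (w, d) \<Rightarrow> (\<forall>i. w $ i \<in> \<rat>) \<and> d \<in> \<rat>" if "e \<in> {(0, 0), (axis k 1, - c)}" for e :: "(real ^ 'n) \<times> real"
      using that c(1) by (auto simp: axis_def)
    show "f x = Max ((\<lambda>(w, d). w \<bullet> x + d) ` {(0, 0), (axis k 1, - c)})" for x
      by (simp add: f_def axis_inner)
  qed auto
  then have ding: "0 \<le> ding_functional P f" using ss by blast
  let ?h = "\<lambda>x. f x * (\<theta> x - 1)"
  have ch: "continuous_on P ?h" unfolding f_def \<theta>_def by (intro continuous_intros)
  have nn: "0 \<le> ?h x" for x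
  proof (cases "x $ k \<le> c")
    case False
    then have "\<alpha> * c \<le> \<alpha> * x $ k" using \<alpha>_pos by simp
    then have "1 < \<theta> x" using c\<theta> by (simp add: \<theta>_def)
    then show ?thesis by (simp add: f_def)
  qed (simp add: f_def)
  have nonneg: "0 \<le> (LINT x:P|lborel. ?h x)"
    unfolding set_lebesgue_integral_def
    by (intro Bochner_Integration.integral_nonneg) (simp add: indicator_def nn del: mult_nonneg_nonneg)
  \<comment> \<open>A vertex at height 1, where both factors of \<open>?h\<close> are
    positive.\<close>
  let ?v = "\<Psi> (W k) 1"
  have v: "?v \<in> P" using ends_subset by (auto simp: ends_def)
  have "(LINT x:P|lborel. ?h x) \<noteq> 0"
  proof
    assume 0: "(LINT x:P|lborel. ?h x) = 0"
    have "?h ?v = 0" by (rule integral_nonneg_eq_0_imp[OF compact_P convex_P P_interior ch nn 0 v])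
    then show False using c(3) right_gt_1 by (simp add: f_def \<theta>_def)
  qed
  with nonneg have pos: "0 < (LINT x:P|lborel. ?h x)" by simp
  have "measure lborel P \<noteq> 0"
  proof
    assume "measure lborel P = 0"
    then have "(LINT x:P|lborel. (1::real)) = 0" by (simp add: set_lebesgue_integral_def)
    from integral_nonneg_eq_0_imp[OF compact_P convex_P P_interior _ _ this v] show False by simp
  qed
  then have vol: "0 < measure lborel P" by (simp add: zero_less_measure_iff)
  have "(LINT x:P|lborel. f x * (1 - \<theta> x)) = - (LINT x:P|lborel. ?h x)"
    using set_integral_mult_right[of lborel P "-1" ?h] by (simp add: algebra_simps)
  then have "ding_functional P f = - f 0 - (LINT x:P|lborel. ?h x) / measure lborel P"
    by (simp add: ding_functional_def extremal_potential_P)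
  moreover have "f 0 = 0" using c0 by (simp add: f_def)
  ultimately show False using ding divide_pos_pos[OF pos vol] by linarith
qed

end

text \<open>The moment equations give \<open>\<alpha> = \<mu> / \<sigma>\<^sup>2\<close> and \<open>\<beta> = - \<alpha> \<mu>\<close>, where \<open>\<mu>\<close> and \<open>\<sigma>\<^sup>2\<close> are the mean and
  the variance of the probability density proportional to \<open>s\<^sup>n\<^sup>-\<^sup>1\<close> on \<open>[-1, 1]\<close>.\<close>

lemma extremal_bundle_3_2: "extremal_bundle TYPE(3) 2 (620 / 349) (-240 / 349)"
proof -
  \<comment> \<open>The predicate is stated for the index type, so any index may serve as
    \<open>k\<close>.\<close>
  interpret proj_bundle "0 :: 3" 2 by unfold_locales simp_all
  show ?thesis
  proof
    \<comment> \<open>\<open>F\<close> is the antiderivative of the expanded polynomial. Its odd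
      coefficients add up to 0, so its values at 1 and -1 agree; the same holds for the other
      moments below.\<close>
    show "((\<lambda>t. (620 / 349 * t + -240 / 349) * s t ^ (CARD(3) - 1)) has_integral 0) {-1..1}"
      by (rule has_integral_eq_rhs[OF has_integral_real_derivative[where
        F = "\<lambda>t. (-2160/349) * t ^ 1 + (1350/349) * t ^ 2 + (2160/349) * t ^ 3 + (620/349) * t ^ 4"]])
        (auto intro!: derivative_eq_intros simp: s_def eval_nat_numeral field_simps)
    show "((\<lambda>t. t * (1 - (620 / 349 * t + -240 / 349)) * s t ^ (CARD(3) - 1)) has_integral 0) {-1..1}"
      by (rule has_integral_eq_rhs[OF has_integral_real_derivative[where
        F = "\<lambda>t. (5301/698) * t ^ 2 + (496/349) * t ^ 3 + (-1271/349) * t ^ 4 + (-496/349) * t ^ 5"]])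
        (auto intro!: derivative_eq_intros simp: s_def eval_nat_numeral field_simps)
  \<comment> \<open>Numerical inequalities; among them \<alpha> + \<beta> = 380 / 349 > 1, the value
    of \<theta> at height 1 that leads to Ding instability.\<close>
  qed (simp_all add: s_def)
qed

lemma extremal_bundle_4_3: "extremal_bundle TYPE(4) 3 (400500 / 108133) (-213867 / 108133)"
proof -
  interpret proj_bundle "0 :: 4" 3 by unfold_locales simp_all
  show ?thesis
  proof
    show "((\<lambda>t. (400500 / 108133 * t + -213867 / 108133) * s t ^ (CARD(4) - 1)) has_integral 0) {-1..1}"
      by (rule has_integral_eq_rhs[OF has_integral_real_derivative[where
        F = "\<lambda>t. (-13687488/108133) * t ^ 1 + (-2582424/108133) * t ^ 2 + (11524788/108133) * t ^ 3 + (37479591/432532) * t ^ 4 + (2162700/108133) * t ^ 5"]])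
        (auto intro!: derivative_eq_intros simp: s_def eval_nat_numeral field_simps)
    show "((\<lambda>t. t * (1 - (400500 / 108133 * t + -213867 / 108133)) * s t ^ (CARD(4) - 1)) has_integral 0) {-1..1}"
      by (rule has_integral_eq_rhs[OF has_integral_real_derivative[where
        F = "\<lambda>t. (10304000/108133) * t ^ 2 + (6912000/108133) * t ^ 3 + (-5724000/108133) * t ^ 4 + (-6912000/108133) * t ^ 5 + (-1802250/108133) * t ^ 6"]])
        (auto intro!: derivative_eq_intros simp: s_def eval_nat_numeral field_simps)
  qed (simp_all add: s_def)
qed

lemma extremal_bundle_4_2: "extremal_bundle TYPE(4) 2 (3150 / 1577) (-1323 / 1577)"
proof -
  interpret proj_bundle "0 :: 4" 2 by unfold_locales simp_all
  show ?thesis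
  proof
    show "((\<lambda>t. (3150 / 1577 * t + -1323 / 1577) * s t ^ (CARD(4) - 1)) has_integral 0) {-1..1}"
      by (rule has_integral_eq_rhs[OF has_integral_real_derivative[where
        F = "\<lambda>t. (-84672/1577) * t ^ 1 + (37296/1577) * t ^ 2 + (79632/1577) * t ^ 3 + (35154/1577) * t ^ 4 + (5040/1577) * t ^ 5"]])
        (auto intro!: derivative_eq_intros simp: s_def eval_nat_numeral field_simps)
    show "((\<lambda>t. t * (1 - (3150 / 1577 * t + -1323 / 1577)) * s t ^ (CARD(4) - 1)) has_integral 0) {-1..1}"
      by (rule has_integral_eq_rhs[OF has_integral_real_derivative[where
        F = "\<lambda>t. (92800/1577) * t ^ 2 + (25600/1577) * t ^ 3 + (-40800/1577) * t ^ 4 + (-25600/1577) * t ^ 5 + (-4200/1577) * t ^ 6"]])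
        (auto intro!: derivative_eq_intros simp: s_def eval_nat_numeral field_simps)
  qed (simp_all add: s_def)
qed

theorem corollary1p6:
  shows "(fano_polytope threefold_B1 \<and> relatively_K_stable threefold_B1 \<and>
            relatively_Ding_unstable threefold_B1) \<and>
         (fano_polytope fourfold_B1 \<and> relatively_K_stable fourfold_B1 \<and>
            relatively_Ding_unstable fourfold_B1) \<and>
         (fano_polytope fourfold_B2 \<and> relatively_K_stable fourfold_B2 \<and>
            relatively_Ding_unstable fourfold_B2)"
proof -
  interpret A: extremal_bundle "3 :: 3" 2 "620 / 349" "-240 / 349"
    by (rule extremal_bundle_3_2)
  interpret B: extremal_bundle "4 :: 4" 3 "400500 / 108133" "-213867 / 108133"
    by (rule extremal_bundle_4_3)
  interpret C: extremal_bundle "4 :: 4" 2 "3150 / 1577" "-1323 / 1577"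
    by (rule extremal_bundle_4_2)
  show ?thesis
    unfolding threefold_B1_def fourfold_B1_def fourfold_B2_def
    using A.fano_P A.relatively_K_stable_P A.relatively_Ding_unstable_P
      B.fano_P B.relatively_K_stable_P B.relatively_Ding_unstable_P
      C.fano_P C.relatively_K_stable_P C.relatively_Ding_unstable_P
    by blast
qed

end
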